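(* Let $\mathcal{L}$ be a Lévy operator and let $p\ge2$. Assume that for every $r\ge p$ the $r$-logarithmic Sobolev inequality $$\mathrm{Ent}(|f|^r)\le C(r)\|f\|_r^r+D(r)\,\mathcal{E}(|f|^{r-2}f,f)\qquad\text{for every } f \text{ with } |f|^{r/2}\in H_{\mathcal{L}}(\mathbb{R}^N)$$ holds with $C(r)\in\mathbb{R}$ and $D(r)>0$ ($C$, $D$ being such that the problem $q'=q^2/D(q)$, $q(0)=p$, has a $C^1$ solution increasing to $\infty$, and $\alpha\mapsto C(\alpha)/\alpha^2$ is integrable on bounded subintervals of $[p,\infty)$). If $$\int_p^\infty\frac{D(\alpha)}{\alpha^2}\,d\alpha<\infty\quad\text{and}\quad\int_p^\infty\frac{C(\alpha)}{\alpha^2}\,d\alpha<\infty ,$$ then $\mathcal{L}$ is eventually ultracontractive.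
   Context: $L^p=L^p(\mathbb{R}^N)$ with Lebesgue measure and norm $\|\cdot\|_p$. A Lévy operator is $\mathcal{L}f(x)=\mathrm{P.V.}\int_{\mathbb{R}^N}(f(x)-f(y))J(x,y)\,dy$ with $J\ge0$ measurable, $J(x,y)=J(y,x)$ and $\sup_x\int J(x,y)\min\{1,|x-y|^2\}\,dy<\infty$. Set $\mathcal{E}(f,g)=\frac12\iint (f(x)-f(y))(g(x)-g(y))J(x,y)\,dx\,dy$, $\overline{\mathcal{E}}(f)=\mathcal{E}(f,f)$, and $H_{\mathcal{L}}(\mathbb{R}^N)=\{f\in L^2:\overline{\mathcal{E}}(f)<\infty\}$; $\mathcal{L}$ is understood as the self-adjoint operator on $L^2$ given by $\langle\mathcal{L}f,g\rangle=\mathcal{E}(f,g)$. For $u_0\in L^2$, the solution of $\partial_tu+\mathcal{L}u=0$, $u(0)=u_0$, is the unique $u\in C([0,\infty);L^2)\cap C^1((0,\infty);L^2)\cap C((0,\infty);H_{\mathcal{L}})$ satisfying $\frac{du}{dt}+\mathcal{L}u=0$ in $(0,\infty)$ and $u(0)=u_0$; write $e^{-t\mathcal{L}}u_0=u(t)$. This semigroup is self-adjoint, positivity preserving and contractive in every $L^p$-norm; for $u_0\in L^p$ the solution is defined by extending $e^{-t\mathcal{L}}$ continuously from $L^2\cap L^p$ to $L^p$. Entropy: $\mathrm{Ent}(f)=\int_{\mathbb{R}^N}\Phi(|f|)-\Phi\left(\int_{\mathbb{R}^N}|f|\right)$ with $\Phi(s)=s\log s$ ($\Phi(0)=0$). $\mathcal{L}$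 is eventually ultracontractive if there are $0<t_0<\infty$ and a finite function $B(t)$ such that $\|u(t)\|_\infty\le B(t)\|u_0\|_2$ for all $t\ge t_0$ and all $u_0\in L^2$. *)

theory Defs
  imports "HOL-Analysis.Analysis" "HOL-Probability.Essential_Supremum"
begin

text \<open>
  Elements of \<open>L\<^sup>p(\<real>\<^sup>N)\<close> are represented by real-valued Lebesgue measurable functions on
  \<^typ>\<open>real ^ 'n\<close>; every notion below is invariant under changes on null sets.
\<close>

definition Lp :: "real \<Rightarrow> (real ^ 'n \<Rightarrow> real) set" where
  "Lp p = {f \<in> borel_measurable lebesgue. integrable lebesgue (\<lambda>x. \<bar>f x\<bar> powr p)}"

definition Lp_norm :: "real \<Rightarrow> (real ^ 'n \<Rightarrow> real) \<Rightarrow> real" where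
  "Lp_norm p f = (LINT x|lebesgue. \<bar>f x\<bar> powr p) powr (1 / p)"

definition Linf_norm :: "(real ^ 'n \<Rightarrow> real) \<Rightarrow> ereal" where
  "Linf_norm f = esssup lebesgue (\<lambda>x. ereal \<bar>f x\<bar>)"

text \<open>
  The integral with values in \<open>[-\<infinity>, \<infinity>]\<close>. It is used where the integrand need not be integrable, so
  that the junk value 0 of the Bochner integral plays no role; note that \<open>\<infinity> - \<infinity> = \<infinity>\<close> in
  \<^typ>\<open>ereal\<close>.
\<close>

definition ext_integral :: "'a measure \<Rightarrow> ('a \<Rightarrow> real) \<Rightarrow> ereal" where
  "ext_integral M f =
     enn2ereal (\<integral>\<^sup>+ x. ennreal (f x) \<partial>M) - enn2ereal (\<integral>\<^sup>+ x. ennreal (- f x) \<partial>M)"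

lemma ext_integral_eq_integral:
  assumes "integrable M f"
  shows "ext_integral M f = ereal (integral\<^sup>L M f)"
proof -
  have fin: "(\<integral>\<^sup>+ x. ennreal (f x) \<partial>M) \<noteq> \<infinity>" "(\<integral>\<^sup>+ x. ennreal (- f x) \<partial>M) \<noteq> \<infinity>"
    using assms by (auto simp: real_integrable_def)
  show ?thesis
    using fin unfolding ext_integral_def real_lebesgue_integral_def[OF assms]
    by (cases "\<integral>\<^sup>+ x. ennreal (f x) \<partial>M"; cases "\<integral>\<^sup>+ x. ennreal (- f x) \<partial>M")
       (auto simp: enn2ereal_ennreal)
qed

text \<open>
  The measurability of every section is what gives a meaning to the integrals in \<open>y\<close>; it does not
  follow from Lebesgue measurability of \<open>J\<close> on the product space.
\<close>

definition levy_kernel :: "(real ^ 'n \<Rightarrow> real ^ 'n \<Rightarrow> real) \<Rightarrow> bool" where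
  "levy_kernel J \<longleftrightarrow>
     (\<lambda>(x, y). J x y) \<in> borel_measurable lebesgue \<and>
     (\<forall>x. J x \<in> borel_measurable lebesgue) \<and>
     (\<forall>x y. 0 \<le> J x y) \<and>
     (\<forall>x y. J x y = J y x) \<and>
     (SUP x. \<integral>\<^sup>+ y. ennreal (J x y * min 1 ((norm (x - y))\<^sup>2)) \<partial>lebesgue) < \<infinity>"

definition levy_form ::
  "(real ^ 'n \<Rightarrow> real ^ 'n \<Rightarrow> real) \<Rightarrow> (real ^ 'n \<Rightarrow> real) \<Rightarrow> (real ^ 'n \<Rightarrow> real) \<Rightarrow> ereal" where
  "levy_form J f g =
     ereal (1 / 2) * ext_integral lebesgue (\<lambda>(x, y). (f x - f y) * (g x - g y) * J x y)"

definition levy_space :: "(real ^ 'n \<Rightarrow> real ^ 'n \<Rightarrow> real) \<Rightarrow> (real ^ 'n \<Rightarrow> real) set" where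
  "levy_space J = {f \<in> Lp 2. levy_form J f f < \<infinity>}"

text \<open>
  The graph of the self-adjoint operator on \<open>L\<^sup>2\<close> associated with the form: \<open>levy_operator J f h\<close>
  says that \<open>f\<close> lies in its domain and is mapped to \<open>h\<close>.
\<close>

definition levy_operator ::
  "(real ^ 'n \<Rightarrow> real ^ 'n \<Rightarrow> real) \<Rightarrow> (real ^ 'n \<Rightarrow> real) \<Rightarrow> (real ^ 'n \<Rightarrow> real) \<Rightarrow> bool" where
  "levy_operator J f h \<longleftrightarrow>
     f \<in> levy_space J \<and> h \<in> Lp 2 \<and>
     (\<forall>g\<in>levy_space J. ereal (LINT x|lebesgue. h x * g x) = levy_form J f g)"

definition L2_continuous_on :: "real set \<Rightarrow> (real \<Rightarrow> real ^ 'n \<Rightarrow> real) \<Rightarrow> bool" where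
  "L2_continuous_on S u \<longleftrightarrow>
     (\<forall>t\<in>S. u t \<in> Lp 2 \<and> ((\<lambda>s. Lp_norm 2 (\<lambda>x. u s x - u t x)) \<longlongrightarrow> 0) (at t within S))"

definition L2_has_derivative_on ::
  "real set \<Rightarrow> (real \<Rightarrow> real ^ 'n \<Rightarrow> real) \<Rightarrow> (real \<Rightarrow> real ^ 'n \<Rightarrow> real) \<Rightarrow> bool" where
  "L2_has_derivative_on S u v \<longleftrightarrow>
     (\<forall>t\<in>S. u t \<in> Lp 2 \<and> v t \<in> Lp 2 \<and>
        ((\<lambda>s. Lp_norm 2 (\<lambda>x. (u s x - u t x) / (s - t) - v t x)) \<longlongrightarrow> 0) (at t within S))"

text \<open>
  Continuity with values in \<open>levy_space J\<close>, whose norm is the square root of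
  \<open>(Lp_norm 2 f)\<^sup>2 + levy_form J f f\<close>.
\<close>

definition levy_space_continuous_on ::
  "(real ^ 'n \<Rightarrow> real ^ 'n \<Rightarrow> real) \<Rightarrow> real set \<Rightarrow> (real \<Rightarrow> real ^ 'n \<Rightarrow> real) \<Rightarrow> bool" where
  "levy_space_continuous_on J S u \<longleftrightarrow>
     L2_continuous_on S u \<and>
     (\<forall>t\<in>S. u t \<in> levy_space J \<and>
        ((\<lambda>s. levy_form J (\<lambda>x. u s x - u t x) (\<lambda>x. u s x - u t x)) \<longlongrightarrow> 0) (at t within S))"

text \<open>
  \<open>u\<close> solves \<open>du/dt + L u = 0\<close>, \<open>u(0) = u0\<close>, in the class
  \<open>C([0,\<infinity>); L\<^sup>2) \<inter> C\<^sup>1((0,\<infinity>); L\<^sup>2) \<inter> C((0,\<infinity>); levy_space J)\<close>. The solution is unique as a curve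
  in \<open>L\<^sup>2\<close>, that is, up to null sets for each \<open>t\<close>.
\<close>

definition levy_solution ::
  "(real ^ 'n \<Rightarrow> real ^ 'n \<Rightarrow> real) \<Rightarrow> (real ^ 'n \<Rightarrow> real) \<Rightarrow> (real \<Rightarrow> real ^ 'n \<Rightarrow> real) \<Rightarrow> bool" where
  "levy_solution J u0 u \<longleftrightarrow>
     L2_continuous_on {0..} u \<and>
     levy_space_continuous_on J {0<..} u \<and>
     (\<exists>v. L2_has_derivative_on {0<..} u v \<and> L2_continuous_on {0<..} v \<and>
          (\<forall>t>0. levy_operator J (u t) (\<lambda>x. - v t x))) \<and>
     (AE x in lebesgue. u 0 x = u0 x)"

definition eventually_ultracontractive :: "(real ^ 'n \<Rightarrow> real ^ 'n \<Rightarrow> real) \<Rightarrow> bool" where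
  "eventually_ultracontractive J \<longleftrightarrow>
     (\<exists>t0>0. \<exists>B :: real \<Rightarrow> real. \<forall>t\<ge>t0. \<forall>u0\<in>Lp 2. \<forall>u. levy_solution J u0 u \<longrightarrow>
        Linf_norm (u t) \<le> ereal (B t * Lp_norm 2 u0))"

text \<open>Since \<open>ln 0 = 0\<close>, this gives \<open>ent_fun 0 = 0\<close>.\<close>

definition ent_fun :: "real \<Rightarrow> real" where
  "ent_fun s = s * ln s"

text \<open>
  Used for integrable \<open>f\<close> only. Even then the first integral may be infinite: for slowly decaying
  \<open>f\<close> the entropy is \<open>-\<infinity>\<close>.
\<close>

definition Ent :: "(real ^ 'n \<Rightarrow> real) \<Rightarrow> ereal" where
  "Ent f = ext_integral lebesgue (\<lambda>x. ent_fun \<bar>f x\<bar>) - ereal (ent_fun (LINT x|lebesgue. \<bar>f x\<bar>))"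

text \<open>
  The integrand of the form on the right-hand side is nonnegative. For sign-changing \<open>f\<close> the form
  may be \<open>\<infinity>\<close>, and then the inequality holds trivially.
\<close>

definition log_sobolev ::
  "(real ^ 'n \<Rightarrow> real ^ 'n \<Rightarrow> real) \<Rightarrow> real \<Rightarrow> real \<Rightarrow> real \<Rightarrow> bool" where
  "log_sobolev J r c d \<longleftrightarrow>
     (\<forall>f \<in> borel_measurable lebesgue. (\<lambda>x. \<bar>f x\<bar> powr (r / 2)) \<in> levy_space J \<longrightarrow>
        Ent (\<lambda>x. \<bar>f x\<bar> powr r)
          \<le> ereal (c * Lp_norm r f powr r)
            + ereal d * levy_form J (\<lambda>x. \<bar>f x\<bar> powr (r - 2) * f x) f)"

text \<open>
  The initial value problem \<open>q' = q\<^sup>2 / D(q)\<close>, \<open>q(0) = p\<close>, has a \<open>C\<^sup>1\<close> solution increasing to \<open>\<infinity>\<close> on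
  \<open>[0, T)\<close>. The end point \<open>T\<close> has to be allowed to be finite: it equals the integral of
  \<open>D(\<alpha>) / \<alpha>\<^sup>2\<close> over \<open>[p, \<infinity>)\<close>.
\<close>

definition exponent_ode_solvable :: "(real \<Rightarrow> real) \<Rightarrow> real \<Rightarrow> bool" where
  "exponent_ode_solvable D p \<longleftrightarrow>
     (\<exists>(T :: ereal) (I :: real set) (q :: real \<Rightarrow> real).
        0 < T \<and> I = {t. 0 \<le> t \<and> ereal t < T} \<and>
        q 0 = p \<and>
        (\<forall>t\<in>I. (q has_real_derivative (q t)\<^sup>2 / D (q t)) (at t within I)) \<and>
        continuous_on I (\<lambda>t. (q t)\<^sup>2 / D (q t)) \<and>
        strict_mono_on I q \<and> (\<forall>M. \<exists>t\<in>I. M < q t))"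

end

theory Submission
  imports Defs "HOL-Real_Asymp.Real_Asymp"
begin

text \<open>
  Take the exponent \<open>\<alpha>\<close> as the parameter, run time by \<open>dt = D(\<alpha>) / \<alpha>\<^sup>2 d\<alpha>\<close>, and follow a truncated
  version of \<open>\<integral>|u|\<^sup>\<alpha> / m\<close> with \<open>m = K\<^sup>\<alpha>\<close>, \<open>(ln K)' = C / \<alpha>\<^sup>2\<close>. The power \<open>|s|\<^sup>\<alpha> / m\<close> is continued linearly
  beyond the level \<open>l\<close> at which its slope reaches a constant \<open>A\<close>; the functional \<open>H\<close> then makes sense for
  every \<open>L\<^sup>2\<close> solution, and with \<open>w = min |u| l\<close> and \<open>G = \<integral>w\<^sup>\<alpha>\<close> the inequality at exponent \<open>\<alpha>\<close> for \<open>w\<close> gives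
  \<open>H' \<le> (G / m) ln (G / m) / \<alpha>\<close>: the contributions of the linear part cancel exactly because \<open>A\<close> does
  not depend on \<open>\<alpha>\<close>. As \<open>G / m \<le> H\<close>, the bound \<open>H \<le> 1\<close> persists. At \<open>\<alpha> = b\<close>, with \<open>A = b\<close>, it says
  \<open>b \<integral>(|u| - l)\<^sup>+ \<le> 1\<close> with \<open>l = K powr (b / (b - 1))\<close>, and \<open>b \<rightarrow> \<infinity>\<close> gives the sup bound. Since \<open>C\<close> is only
  integrable, \<open>K\<close> is defined by a continuous approximation of \<open>C\<close>, whose \<open>L\<^sup>1\<close> error is absorbed by
  starting from \<open>H \<le> 1/4\<close>. Exponents in \<open>[2, p]\<close> are covered because the inequality at \<open>p\<close>, applied to
  \<open>|f| powr (r / p)\<close>, implies the one at \<open>r\<close> with the same constants for nonnegative functions.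
\<close>

section \<open>Powers and truncated powers\<close>

text \<open>A solution is only known to lie in L^2, so above exponent 2 neither the integral of its
  \<open>\<alpha>\<close>-th power nor the pairing of its time derivative with the
  \<open>(\<alpha> - 1)\<close>-th power is at hand. The truncated power grows linearly at infinity
  and its slope is Lipschitz, so the functional is differentiable on L^2 and its gradient lies in
  the form domain. The term \<open>(G / m) * ln (G / m)\<close> has a favourable sign only while
  \<open>G / m \<le> 1\<close>. The differential inequality is therefore conditional on
  \<open>H \<le> 1\<close>, and a first-exit argument closes the bound. The run starts at exponent 2
  because the L^2 norm is the one that the initial value controls, by contraction. The final time
  \<open>t\<close> stays fixed while \<open>b\<close> grows: the run up to exponent \<open>b\<close>
  is timed to end at \<open>t\<close>, so its starting time depends on \<open>b\<close>. That time
  stays positive because the integral of \<open>D(\<alpha>) / \<alpha>\<^sup>2\<close> bounds the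
  durations of all runs together; this is why the conclusion holds only after a waiting
  time.\<close>

lemma powr_tangent_le:
  fixes x k \<beta> :: real
  assumes "0 \<le> x" "0 \<le> k" "1 \<le> \<beta>"
  shows "k powr \<beta> + \<beta> * k powr (\<beta> - 1) * (x - k) \<le> x powr \<beta>"
\<comment> \<open>The mean value theorem below uses the derivative at both end points, so zero is
  split off. At \<open>k = 0\<close> the tangent is the zero line even for
  \<open>\<beta> = 1\<close>, because \<open>0 powr 0 = 0\<close>.\<close>
proof (cases "k = 0 \<or> x = 0 \<or> x = k")
  case True
  then show ?thesis
  proof (elim disjE)
    assume "x = 0"
    moreover have "k powr (\<beta> - 1) * k = k powr \<beta>"
      using \<open>0 \<le> k\<close> by (cases "k = 0") (simp_all add: powr_mult_base mult.commute)
    moreover have "k powr \<beta> \<le> \<beta> * k powr \<beta>"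
      using assms by (simp add: mult_le_cancel_right1)
    ultimately show ?thesis using assms by (simp add: algebra_simps)
  qed (use assms in auto)
next
  case False
  then have pos: "0 < k" "0 < x" "x \<noteq> k" using assms by auto
  have der: "((\<lambda>z. z powr \<beta>) has_real_derivative \<beta> * z powr (\<beta> - 1)) (at z)" if "0 < z" for z
    using that by (rule has_real_derivative_powr)
  show ?thesis
  proof (cases "k < x")
    case True
    obtain z where z: "k < z" "z < x" "x powr \<beta> - k powr \<beta> = (x - k) * (\<beta> * z powr (\<beta> - 1))"
      using MVT2[OF True, of "\<lambda>z. z powr \<beta>" "\<lambda>z. \<beta> * z powr (\<beta> - 1)"] der pos by force
    have "(x - k) * (\<beta> * k powr (\<beta> - 1)) \<le> (x - k) * (\<beta> * z powr (\<beta> - 1))"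
      using z pos assms by (intro mult_left_mono powr_mono2) auto
    with z show ?thesis by (simp add: algebra_simps)
  next
    case False
    then have "x < k" using pos by auto
    then obtain z where z: "x < z" "z < k" "k powr \<beta> - x powr \<beta> = (k - x) * (\<beta> * z powr (\<beta> - 1))"
      using MVT2[of x k "\<lambda>z. z powr \<beta>" "\<lambda>z. \<beta> * z powr (\<beta> - 1)"] der pos by force
    have "(k - x) * (\<beta> * z powr (\<beta> - 1)) \<le> (k - x) * (\<beta> * k powr (\<beta> - 1))"
      using z pos assms by (intro mult_left_mono powr_mono2) auto
    with z show ?thesis by (simp add: algebra_simps)
  qed
qed

lemma abs_powr_diff_le:
  fixes x y n \<beta> :: real
  assumes "0 \<le> x" "x \<le> n" "0 \<le> y" "y \<le> n" "1 \<le> \<beta>"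
  shows "\<bar>x powr \<beta> - y powr \<beta>\<bar> \<le> \<beta> * n powr (\<beta> - 1) * \<bar>x - y\<bar>"
proof -
  have *: "v powr \<beta> - w powr \<beta> \<le> \<beta> * n powr (\<beta> - 1) * \<bar>v - w\<bar>"
    if "0 \<le> v" "v \<le> n" "0 \<le> w" "w \<le> n" for v w
  proof -
    have "v powr \<beta> - w powr \<beta> \<le> \<beta> * v powr (\<beta> - 1) * (v - w)"
      using powr_tangent_le[of w v \<beta>] that assms by (simp add: algebra_simps)
    also have "\<dots> \<le> \<beta> * v powr (\<beta> - 1) * \<bar>v - w\<bar>"
      using assms by (intro mult_left_mono) auto
    also have "\<dots> \<le> \<beta> * n powr (\<beta> - 1) * \<bar>v - w\<bar>"
      using assms that by (intro mult_left_mono mult_right_mono powr_mono2) auto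
    finally show ?thesis .
  qed
  show ?thesis
    using *[of x y] *[of y x] assms by (simp add: abs_le_iff abs_minus_commute)
qed

text \<open>With \<open>\<beta> = \<alpha> - 1\<close>, and up to the factor
  \<open>c * \<alpha>\<close>, this is the derivative of \<open>trunc_pow \<alpha> c l\<close>; it
  is the function against which the equation is tested.\<close>

definition signed_trunc_powr :: "real \<Rightarrow> real \<Rightarrow> real \<Rightarrow> real" where
  "signed_trunc_powr l \<beta> s = sgn s * (min \<bar>s\<bar> l) powr \<beta>"

lemma trunc_powr_lipschitz:
  fixes l \<beta> s t :: real
  assumes "0 < l" "1 \<le> \<beta>"
  shows "\<bar>(min \<bar>s\<bar> l) powr \<beta> - (min \<bar>t\<bar> l) powr \<beta>\<bar> \<le> \<beta> * l powr (\<beta> - 1) * \<bar>s - t\<bar>"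
proof -
  have "\<bar>(min \<bar>s\<bar> l) powr \<beta> - (min \<bar>t\<bar> l) powr \<beta>\<bar>
      \<le> \<beta> * l powr (\<beta> - 1) * \<bar>min \<bar>s\<bar> l - min \<bar>t\<bar> l\<bar>"
    by (rule abs_powr_diff_le) (use assms in auto)
  also have "\<dots> \<le> \<beta> * l powr (\<beta> - 1) * \<bar>s - t\<bar>"
    using assms by (intro mult_left_mono) (auto simp: min_def)
  finally show ?thesis .
qed

text \<open>For opposite signs \<open>\<bar>s - t\<bar> = \<bar>s\<bar> + \<bar>t\<bar>\<close>, so
  each value is compared with 0 separately. The bound puts truncated powers of a solution into the
  form domain and later controls the second-order remainder of \<open>psi\<close>.\<close>

lemma signed_trunc_powr_lipschitz:
  assumes "0 < l" "1 \<le> \<beta>"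
  shows "\<bar>signed_trunc_powr l \<beta> s - signed_trunc_powr l \<beta> t\<bar> \<le> \<beta> * l powr (\<beta> - 1) * \<bar>s - t\<bar>"
proof -
  have *: "(min \<bar>s\<bar> l) powr \<beta> \<le> \<beta> * l powr (\<beta> - 1) * \<bar>s\<bar>" for s
    using trunc_powr_lipschitz[OF assms, of s 0] assms by simp
  consider "0 < s \<and> t < 0 \<or> s < 0 \<and> 0 < t" | "sgn s = sgn t" | "s = 0" | "t = 0"
    by (cases s "0::real" rule: linorder_cases; cases t "0::real" rule: linorder_cases) auto
  then show ?thesis
  proof cases
    case 1
    then have "\<bar>s - t\<bar> = \<bar>s\<bar> + \<bar>t\<bar>" by auto
    moreover have "\<bar>signed_trunc_powr l \<beta> s - signed_trunc_powr l \<beta> t\<bar>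
        = (min \<bar>s\<bar> l) powr \<beta> + (min \<bar>t\<bar> l) powr \<beta>"
      using 1 powr_ge_zero[of "min \<bar>s\<bar> l" \<beta>] powr_ge_zero[of "min \<bar>t\<bar> l" \<beta>]
      by (auto simp: signed_trunc_powr_def simp del: powr_ge_zero)
    ultimately show ?thesis using *[of s] *[of t] by (simp add: distrib_left)
  next
    case 2
    then have "\<bar>signed_trunc_powr l \<beta> s - signed_trunc_powr l \<beta> t\<bar>
        = \<bar>sgn t\<bar> * \<bar>(min \<bar>s\<bar> l) powr \<beta> - (min \<bar>t\<bar> l) powr \<beta>\<bar>"
      by (simp add: signed_trunc_powr_def abs_mult flip: right_diff_distrib)
    also have "\<dots> \<le> 1 * \<bar>(min \<bar>s\<bar> l) powr \<beta> - (min \<bar>t\<bar> l) powr \<beta>\<bar>"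
      by (intro mult_right_mono) (auto simp: sgn_real_def)
    finally show ?thesis using trunc_powr_lipschitz[OF assms, of s t] by simp
  next
    case 3
    then show ?thesis using *[of t] assms by (auto simp: signed_trunc_powr_def abs_mult sgn_real_def)
  next
    case 4
    then show ?thesis using *[of s] assms by (auto simp: signed_trunc_powr_def abs_mult sgn_real_def)
  qed
qed

text \<open>Compares the form of the truncated modulus with the form that the tested equation
  produces. Cutting at \<open>l\<close> shrinks increments without reversing their sign, and passing
  from \<open>s\<close> to \<open>\<bar>s\<bar>\<close> loses only nonnegative cross terms when the
  signs differ.\<close>

lemma trunc_powr_form_le:
  assumes "0 < l" "0 \<le> \<beta>"
  shows "((min \<bar>s\<bar> l) powr \<beta> - (min \<bar>t\<bar> l) powr \<beta>) * (min \<bar>s\<bar> l - min \<bar>t\<bar> l)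
    \<le> (s - t) * (signed_trunc_powr l \<beta> s - signed_trunc_powr l \<beta> t)" (is "?L \<le> ?R")
proof -
  define v w where "v = min \<bar>s\<bar> l" and "w = min \<bar>t\<bar> l"
  have vw: "0 \<le> v" "0 \<le> w" using assms by (auto simp: v_def w_def)
  have mono: "x powr \<beta> \<le> y powr \<beta>" if "0 \<le> x" "x \<le> y" for x y :: real
    using that assms by (intro powr_mono2) auto
  have a: "?L \<le> (\<bar>s\<bar> - \<bar>t\<bar>) * (v powr \<beta> - w powr \<beta>)"
  proof (cases "\<bar>t\<bar> \<le> \<bar>s\<bar>")
    case True
    then have "w \<le> v" "v - w \<le> \<bar>s\<bar> - \<bar>t\<bar>" by (auto simp: v_def w_def)
    then show ?thesis unfolding v_def[symmetric] w_def[symmetric]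
      using mono[of w v] vw by (simp add: mult.commute mult_right_mono)
  next
    case False
    then have "v \<le> w" "\<bar>s\<bar> - \<bar>t\<bar> \<le> v - w" by (auto simp: v_def w_def)
    then show ?thesis unfolding v_def[symmetric] w_def[symmetric]
      using mono[of v w] vw by (simp add: mult.commute mult_right_mono_neg)
  qed
  have b: "(\<bar>s\<bar> - \<bar>t\<bar>) * (v powr \<beta> - w powr \<beta>) \<le> ?R"
  proof -
    have v0: "s = 0 \<Longrightarrow> v powr \<beta> = 0" "t = 0 \<Longrightarrow> w powr \<beta> = 0" using assms by (auto simp: v_def w_def)
    have opp: "(\<bar>s\<bar> - \<bar>t\<bar>) * (a - b) \<le> (s - t) * (c - d)"
      if "s * t < 0" "c = sgn s * a" "d = sgn t * b" "0 \<le> a" "0 \<le> b" for a b c d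
    proof -
      have "(s - t) * (c - d) - (\<bar>s\<bar> - \<bar>t\<bar>) * (a - b) = 2 * (\<bar>s\<bar> * b + \<bar>t\<bar> * a)"
        using that by (auto simp: mult_less_0_iff algebra_simps)
      moreover have "0 \<le> 2 * (\<bar>s\<bar> * b + \<bar>t\<bar> * a)" using that by simp
      ultimately show ?thesis by linarith
    qed
    have st: "signed_trunc_powr l \<beta> s = sgn s * v powr \<beta>" "signed_trunc_powr l \<beta> t = sgn t * w powr \<beta>"
      by (simp_all add: signed_trunc_powr_def v_def w_def)
    show ?thesis
    proof (cases "s * t < 0")
      case False
      then show ?thesis
        unfolding st using v0
        by (cases s "0::real" rule: linorder_cases; cases t "0::real" rule: linorder_cases)
          (simp_all add: algebra_simps mult_less_0_iff)
    qed (rule opp, auto simp: st)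
  qed
  from a b show "?L \<le> ?R" by linarith
qed

text \<open>\<open>f = v powr \<sigma>\<close>, \<open>\<sigma> = r / R\<close>, turns the integrand of the form in the \<open>R\<close>-inequality for
  \<open>f\<close> into the left-hand side, with \<open>v powr r = f powr R\<close>.\<close>

lemma powr_form_le:
  fixes x y r \<sigma> :: real
  assumes "0 \<le> x" "0 \<le> y" "0 < \<sigma>" "\<sigma> \<le> 1" "2 \<le> r"
  shows "(x powr (r - \<sigma>) - y powr (r - \<sigma>)) * (x powr \<sigma> - y powr \<sigma>)
    \<le> (x powr (r - 1) - y powr (r - 1)) * (x - y)"
proof (cases "x = 0 \<or> y = 0")
  case True
  have "z powr (r - \<sigma>) * z powr \<sigma> = z powr r" "z powr (r - 1) * z = z powr r" if "0 \<le> z" for z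
    using that by (cases "z = 0"; simp add: powr_add[symmetric] powr_mult_base mult.commute)+
  then show ?thesis using True assms by auto
next
  case False
  then have pos: "0 < x" "0 < y" using assms by auto
  \<comment> \<open>\<open>P\<close> is a product of two increments of equal sign, the exponents
    \<open>r - 1 - \<sigma>\<close> and \<open>1 - \<sigma>\<close> being nonnegative. Multiplied by
    \<open>x powr \<sigma> * y powr \<sigma>\<close> it is the difference of the two sides of the
    claim.\<close>
  define P where "P = (x powr (r - 1 - \<sigma>) - y powr (r - 1 - \<sigma>)) * (x powr (1 - \<sigma>) - y powr (1 - \<sigma>))"
  have mono: "a powr c \<le> b powr c" if "0 < a" "a \<le> b" "0 \<le> c" for a b c :: real
    using that by (intro powr_mono2) auto
  have "0 \<le> P"
    unfolding P_def using mono[of x y] mono[of y x] pos assms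
    by (cases "x \<le> y") (auto intro!: mult_nonneg_nonneg mult_nonpos_nonpos)
  then have "0 \<le> (x powr \<sigma> * y powr \<sigma>) * P" by simp
  also have "(x powr \<sigma> * y powr \<sigma>) * P =
     x powr (r - \<sigma>) * y powr \<sigma> + x powr \<sigma> * y powr (r - \<sigma>) - x powr (r - 1) * y - x * y powr (r - 1)"
  proof -
    have e: "z powr \<sigma> * z powr (r - 1 - \<sigma>) = z powr (r - 1)" "z powr \<sigma> * z powr (1 - \<sigma>) = z"
      "z powr \<sigma> * (z powr (r - 1 - \<sigma>) * z powr (1 - \<sigma>)) = z powr (r - \<sigma>)" if "0 < z" for z
      using that by (simp_all add: powr_add[symmetric])
    have "(x powr \<sigma> * y powr \<sigma>) * P =
       (x powr \<sigma> * (x powr (r - 1 - \<sigma>) * x powr (1 - \<sigma>))) * y powr \<sigma>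
       + x powr \<sigma> * (y powr \<sigma> * (y powr (r - 1 - \<sigma>) * y powr (1 - \<sigma>)))
       - (x powr \<sigma> * x powr (r - 1 - \<sigma>)) * (y powr \<sigma> * y powr (1 - \<sigma>))
       - (x powr \<sigma> * x powr (1 - \<sigma>)) * (y powr \<sigma> * y powr (r - 1 - \<sigma>))"
      unfolding P_def by (simp only: algebra_simps)
    also have "\<dots> = x powr (r - \<sigma>) * y powr \<sigma> + x powr \<sigma> * y powr (r - \<sigma>) - x powr (r - 1) * y - x * y powr (r - 1)"
      unfolding e[OF pos(1)] e[OF pos(2)] by simp
    finally show ?thesis .
  qed
  finally have "x powr (r - 1) * y + x * y powr (r - 1)
      \<le> x powr (r - \<sigma>) * y powr \<sigma> + x powr \<sigma> * y powr (r - \<sigma>)" by simp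
  moreover have "z powr (r - \<sigma>) * z powr \<sigma> = z powr r" "z powr (r - 1) * z = z powr r" if "0 < z" for z
    using that by (simp_all add: powr_add[symmetric] powr_mult_base mult.commute)
  ultimately show ?thesis using pos by (simp add: algebra_simps)
qed

section \<open>Convexity of the linearly continued power\<close>

definition trunc_pow :: "real \<Rightarrow> real \<Rightarrow> real \<Rightarrow> real \<Rightarrow> real" where
  "trunc_pow \<alpha> c l s =
     c * (min \<bar>s\<bar> l) powr \<alpha> + c * \<alpha> * l powr (\<alpha> - 1) * max 0 (\<bar>s\<bar> - l)"

lemma trunc_pow_tangent_le:
  assumes "0 < l" "0 \<le> c" "1 \<le> \<alpha>" "0 \<le> k" "k \<le> l"
  shows "c * (k powr \<alpha> + \<alpha> * k powr (\<alpha> - 1) * (\<bar>s\<bar> - k)) \<le> trunc_pow \<alpha> c l s"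
proof -
  have "k powr \<alpha> + \<alpha> * k powr (\<alpha> - 1) * (\<bar>s\<bar> - k)
      \<le> (min \<bar>s\<bar> l) powr \<alpha> + \<alpha> * l powr (\<alpha> - 1) * max 0 (\<bar>s\<bar> - l)"
  proof (cases "\<bar>s\<bar> \<le> l")
    case True
    then show ?thesis using powr_tangent_le[of "\<bar>s\<bar>" k \<alpha>] assms by (simp add: min_def)
  next
    case False
    have "k powr (\<alpha> - 1) \<le> l powr (\<alpha> - 1)" using assms by (intro powr_mono2) auto
    then have "\<alpha> * k powr (\<alpha> - 1) * (\<bar>s\<bar> - l) \<le> \<alpha> * l powr (\<alpha> - 1) * (\<bar>s\<bar> - l)"
      using False assms by (intro mult_right_mono mult_left_mono) auto
    then show ?thesis using powr_tangent_le[of l k \<alpha>] assms False by (simp add: min_def algebra_simps)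
  qed
  from mult_left_mono[OF this \<open>0 \<le> c\<close>] show ?thesis
    by (simp add: trunc_pow_def algebra_simps)
qed

text \<open>Beyond \<open>l\<close> the graph is its own tangent at \<open>l\<close>, so the tangent
  at \<open>s\<close> is the one at \<open>k = min \<bar>s\<bar> l\<close> and
  \<open>trunc_pow_tangent_le\<close> applies. Using it also with \<open>s\<close> and
  \<open>t\<close> interchanged traps the Taylor remainder later.\<close>

lemma trunc_pow_subgradient:
  assumes "0 < l" "0 \<le> c" "1 \<le> \<alpha>"
  shows "c * \<alpha> * signed_trunc_powr l (\<alpha> - 1) s * (t - s) \<le> trunc_pow \<alpha> c l t - trunc_pow \<alpha> c l s"
proof -
  define k where "k = min \<bar>s\<bar> l"
  have k: "0 \<le> k" "k \<le> l" using assms by (auto simp: k_def)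
  have eq: "trunc_pow \<alpha> c l s = c * (k powr \<alpha> + \<alpha> * k powr (\<alpha> - 1) * (\<bar>s\<bar> - k))"
    using assms by (auto simp: trunc_pow_def k_def min_def max_def algebra_simps)
  have "sgn s * k powr (\<alpha> - 1) * (t - s) \<le> k powr (\<alpha> - 1) * (\<bar>t\<bar> - \<bar>s\<bar>)"
  proof (cases "s = 0")
    case True
    then show ?thesis using assms by (simp add: k_def min_def)
  next
    case False
    then have "sgn s * (t - s) \<le> \<bar>t\<bar> - \<bar>s\<bar>" by (auto simp: sgn_real_def)
    from mult_left_mono[OF this, of "k powr (\<alpha> - 1)"] show ?thesis by (simp add: ac_simps)
  qed
  from mult_left_mono[OF this, of "c * \<alpha>"]
  have "c * \<alpha> * signed_trunc_powr l (\<alpha> - 1) s * (t - s) \<le> c * \<alpha> * (k powr (\<alpha> - 1) * (\<bar>t\<bar> - \<bar>s\<bar>))"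
    using assms by (simp add: signed_trunc_powr_def k_def mult.assoc)
  also have "\<dots> = c * (k powr \<alpha> + \<alpha> * k powr (\<alpha> - 1) * (\<bar>t\<bar> - k)) - trunc_pow \<alpha> c l s"
    unfolding eq by (simp add: algebra_simps)
  also have "\<dots> \<le> trunc_pow \<alpha> c l t - trunc_pow \<alpha> c l s"
    using trunc_pow_tangent_le[OF assms k, of t] by simp
  finally show ?thesis .
qed

section \<open>The form on truncated powers\<close>

text \<open>The gap \<open>\<delta>\<close> above exponent 2 absorbs the logarithm near zero:
  \<open>ln z \<le> z\<close> at \<open>z = w powr (- \<delta>)\<close> gives
  \<open>w powr \<delta> * \<bar>ln w\<bar> \<le> 1 / \<delta>\<close>. Thus
  \<open>w powr r * ln w\<close> is dominated by a square, uniformly for exponents bounded away from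
  2.\<close>

lemma powr_abs_ln_le:
  fixes w r \<delta> N b :: real
  assumes "0 \<le> w" "w \<le> N" "1 \<le> N" "0 < \<delta>" "2 + \<delta> \<le> r" "r \<le> b"
  shows "w powr r * \<bar>ln w\<bar> \<le> (1 / \<delta> + N powr b) * w\<^sup>2"
proof (cases "w = 0")
  case False
  then have w: "0 < w" using assms by auto
  have "w powr (r - 2) * \<bar>ln w\<bar> \<le> 1 / \<delta> + N powr b"
  proof (cases "w \<le> 1")
    case True
    have "ln (w powr (-\<delta>)) \<le> w powr (-\<delta>)"
      by (rule less_imp_le, rule ln_less_self) (use w in auto)
    then have "\<delta> * \<bar>ln w\<bar> \<le> w powr (-\<delta>)"
      using w True by (simp add: ln_powr)
    then have "w powr \<delta> * (\<delta> * \<bar>ln w\<bar>) \<le> w powr \<delta> * w powr (-\<delta>)"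
      by (intro mult_left_mono) auto
    also have "\<dots> = 1" using w by (simp flip: powr_add)
    finally have "w powr \<delta> * \<bar>ln w\<bar> \<le> 1 / \<delta>" using assms by (simp add: field_simps)
    moreover have "w powr (r - 2) \<le> w powr \<delta>"
      using w True assms by (intro powr_mono') auto
    then have "w powr (r - 2) * \<bar>ln w\<bar> \<le> w powr \<delta> * \<bar>ln w\<bar>" by (intro mult_right_mono) auto
    ultimately show ?thesis by (smt (verit) powr_ge_zero)
  next
    case False
    then have "ln w \<le> w" "0 \<le> ln w" by (auto intro: less_imp_le ln_less_self)
    then have "w powr (r - 2) * \<bar>ln w\<bar> \<le> w powr (r - 2) * w powr 1"
      using False by (intro mult_left_mono) auto
    also have "\<dots> = w powr (r - 1)" unfolding powr_add[symmetric] by simp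
    also have "\<dots> \<le> w powr b" using False assms by (intro powr_mono) auto
    also have "\<dots> \<le> N powr b" using False assms by (intro powr_mono2) auto
    also have "\<dots> \<le> 1 / \<delta> + N powr b" using assms by simp
    finally show ?thesis .
  qed
  moreover have "w powr r = w powr (r - 2) * w\<^sup>2"
    using w by (simp add: powr_add[symmetric] flip: powr_numeral)
  ultimately show ?thesis
    using mult_right_mono[of "w powr (r - 2) * \<bar>ln w\<bar>" "1 / \<delta> + N powr b" "w\<^sup>2"] by (simp add: ac_simps)
qed simp

lemma powr_diff_mult_nonneg:
  fixes x y a b :: real
  assumes "0 \<le> x" "0 \<le> y" "0 \<le> a" "0 \<le> b"
  shows "0 \<le> (x powr a - y powr a) * (x powr b - y powr b)"
proof (cases "x \<le> y")
  case True
  then show ?thesis using assms by (intro mult_nonpos_nonpos) (auto intro: powr_mono2)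
next
  case False
  then show ?thesis using assms by (intro mult_nonneg_nonneg) (auto intro: powr_mono2)
qed

lemma powr_le_square:
  fixes w r l :: real
  assumes "0 \<le> w" "w \<le> l" "2 \<le> r"
  shows "w powr r \<le> l powr (r - 2) * w\<^sup>2"
proof (cases "w = 0")
  case False
  then have "w powr r = w powr (r - 2) * w\<^sup>2"
    using assms by (simp add: powr_add[symmetric] flip: powr_numeral)
  also have "\<dots> \<le> l powr (r - 2) * w\<^sup>2"
    using assms by (intro mult_right_mono powr_mono2) auto
  finally show ?thesis .
qed simp

section \<open>The form and its domain\<close>

lemma Lp_2_iff: "f \<in> Lp 2 \<longleftrightarrow> f \<in> borel_measurable lebesgue \<and> integrable lebesgue (\<lambda>x. (f x)\<^sup>2)"
  by (simp add: Lp_def)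

lemma Lp_norm_2: "Lp_norm 2 f = sqrt (LINT x|lebesgue. (f x)\<^sup>2)"
  by (simp add: Lp_norm_def powr_half_sqrt)

lemma Lp_norm_nonneg: "0 \<le> Lp_norm r f"
  by (simp add: Lp_norm_def)

lemma ext_integral_nonneg:
  assumes "\<And>x. 0 \<le> f x"
  shows "ext_integral M f = enn2ereal (\<integral>\<^sup>+ x. ennreal (f x) \<partial>M)"
  using assms by (simp add: ext_integral_def ennreal_neg zero_ennreal.rep_eq)

text \<open>No measurability of \<open>f\<close> is assumed, so the constant is moved through the
  simple functions below the integrand, which yields an upper bound. The application is to the
  integrand of the form on the product space.\<close>

lemma nn_integral_cmult_finite:
  fixes c :: real
  assumes "0 \<le> c" "(\<integral>\<^sup>+ x. ennreal (f x) \<partial>M) < \<infinity>"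
  shows "(\<integral>\<^sup>+ x. ennreal (c * f x) \<partial>M) < \<infinity>"
proof (cases "c = 0")
  case False
  with assms have c: "0 < c" by simp
  have "integral\<^sup>S M g \<le> ennreal c * (\<integral>\<^sup>+ x. ennreal (f x) \<partial>M)"
    if g: "simple_function M g" "g \<le> (\<lambda>x. ennreal (c * f x))" for g
  proof -
    let ?h = "\<lambda>x. ennreal (1 / c) * g x"
    have h: "simple_function M ?h" using g by (intro simple_function_mult) auto
    have "?h x \<le> ennreal (f x)" for x
    proof -
      have "?h x \<le> ennreal (1 / c) * ennreal (c * f x)"
        using g(2) by (intro mult_left_mono) (auto simp: le_fun_def)
      also have "\<dots> = ennreal (f x)" using c by (simp flip: ennreal_mult')
      finally show ?thesis .
    qed
    then have "integral\<^sup>S M ?h \<le> (\<integral>\<^sup>+ x. ennreal (f x) \<partial>M)"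
      unfolding nn_integral_def using h by (intro SUP_upper) (auto simp: le_fun_def)
    then have "ennreal c * (ennreal (1 / c) * integral\<^sup>S M g) \<le> ennreal c * (\<integral>\<^sup>+ x. ennreal (f x) \<partial>M)"
      using g by (intro mult_left_mono) (auto simp: simple_integral_mult)
    moreover have "ennreal c * ennreal (1 / c) = 1" using c by (simp flip: ennreal_mult')
    ultimately show ?thesis by (simp flip: mult.assoc)
  qed
  then have "(\<integral>\<^sup>+ x. ennreal (c * f x) \<partial>M) \<le> ennreal c * (\<integral>\<^sup>+ x. ennreal (f x) \<partial>M)"
    unfolding nn_integral_def[of M "\<lambda>x. ennreal (c * f x)"] by (intro SUP_least) auto
  also have "\<dots> < \<infinity>" using assms by (simp add: ennreal_mult_less_top)
  finally show ?thesis .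
qed simp

lemma levy_form_nonneg_eq:
  assumes "levy_kernel J" "\<And>x y. 0 \<le> (f x - f y) * (g x - g y)"
  shows "levy_form J f g = ereal (1 / 2) *
    enn2ereal (\<integral>\<^sup>+ z. ennreal (case z of (x, y) \<Rightarrow> (f x - f y) * (g x - g y) * J x y) \<partial>lebesgue)"
  unfolding levy_form_def
  by (subst ext_integral_nonneg) (use assms in \<open>auto simp: levy_kernel_def\<close>)

lemma levy_form_nonneg:
  assumes "levy_kernel J" "\<And>x y. 0 \<le> (f x - f y) * (g x - g y)"
  shows "0 \<le> levy_form J f g"
  using levy_form_nonneg_eq[of J f g] assms by simp

lemma levy_form_mono:
  assumes "levy_kernel J" "\<And>x y. 0 \<le> (f x - f y) * (g x - g y)"
    and le: "\<And>x y. (f x - f y) * (g x - g y) \<le> (f' x - f' y) * (g' x - g' y)"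
  shows "levy_form J f g \<le> levy_form J f' g'"
proof -
  have pos: "0 \<le> (f' x - f' y) * (g' x - g' y)" for x y using assms(2) le order_trans by blast
  have "ennreal (case z of (x, y) \<Rightarrow> (f x - f y) * (g x - g y) * J x y)
      \<le> ennreal (case z of (x, y) \<Rightarrow> (f' x - f' y) * (g' x - g' y) * J x y)" for z
    using assms(1) by (cases z) (auto simp: levy_kernel_def intro!: ennreal_leI mult_right_mono le)
  then show ?thesis
    using assms pos
    by (simp add: levy_form_nonneg_eq nn_integral_mono ereal_mult_left_mono less_eq_ennreal.rep_eq[symmetric])
qed

text \<open>Lipschitz maps fixing 0 operate on the form domain: squared increments grow by at most
  the factor \<open>L\<^sup>2\<close>, and \<open>\<phi> 0 = 0\<close> keeps the composition square
  integrable on a space of infinite measure.\<close>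

lemma levy_space_lipschitz:
  fixes \<phi> :: "real \<Rightarrow> real"
  assumes J: "levy_kernel J" and f: "f \<in> levy_space J"
    and meas: "\<phi> \<in> borel_measurable borel" and zero: "\<phi> 0 = 0"
    and lip: "\<And>a b. \<bar>\<phi> a - \<phi> b\<bar> \<le> L * \<bar>a - b\<bar>"
  shows "(\<lambda>x. \<phi> (f x)) \<in> levy_space J"
proof -
  have sq: "(\<phi> a - \<phi> b)\<^sup>2 \<le> L\<^sup>2 * (a - b)\<^sup>2" for a b
    using lip[of a b] by (metis abs_ge_zero power2_abs power_mono power_mult_distrib)
  have fm[measurable]: "f \<in> borel_measurable lebesgue" and fi: "integrable lebesgue (\<lambda>x. (f x)\<^sup>2)"
    using f by (auto simp: levy_space_def Lp_2_iff)
  have pm[measurable]: "(\<lambda>x. \<phi> (f x)) \<in> borel_measurable lebesgue"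
    using measurable_compose[OF fm meas] .
  have "integrable lebesgue (\<lambda>x. (\<phi> (f x))\<^sup>2)"
    by (rule Bochner_Integration.integrable_bound[of _ "\<lambda>x. L\<^sup>2 * (f x)\<^sup>2"])
      (use fi sq[of _ 0] zero in auto)
  moreover have "levy_form J (\<lambda>x. \<phi> (f x)) (\<lambda>x. \<phi> (f x)) < \<infinity>"
  proof -
    let ?I = "\<lambda>z. case z of (x, y) \<Rightarrow> (f x - f y) * (f x - f y) * J x y"
    have "levy_form J f f < \<infinity>" using f by (simp add: levy_space_def)
    then have "(\<integral>\<^sup>+ z. ennreal (?I z) \<partial>lebesgue) < \<infinity>"
      unfolding levy_form_nonneg_eq[OF J, of f f, simplified]
      by (cases "\<integral>\<^sup>+ z. ennreal (?I z) \<partial>lebesgue" rule: ennreal_cases)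
        (auto simp: top_ennreal.rep_eq)
    then have "(\<integral>\<^sup>+ z. ennreal (L\<^sup>2 * ?I z) \<partial>lebesgue) < \<infinity>"
      by (rule nn_integral_cmult_finite[rotated]) simp
    moreover have "(\<integral>\<^sup>+ z. ennreal (case z of (x, y) \<Rightarrow> (\<phi> (f x) - \<phi> (f y)) * (\<phi> (f x) - \<phi> (f y)) * J x y) \<partial>lebesgue)
      \<le> (\<integral>\<^sup>+ z. ennreal (L\<^sup>2 * ?I z) \<partial>lebesgue)"
    proof (intro nn_integral_mono ennreal_leI)
      fix z :: "(real, 'a) vec \<times> (real, 'a) vec"
      obtain x y where z: "z = (x, y)" by fastforce
      have "(\<phi> (f x) - \<phi> (f y))\<^sup>2 * J x y \<le> (L\<^sup>2 * (f x - f y)\<^sup>2) * J x y"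
        using sq J by (intro mult_right_mono) (auto simp: levy_kernel_def)
      then show "(case z of (x, y) \<Rightarrow> (\<phi> (f x) - \<phi> (f y)) * (\<phi> (f x) - \<phi> (f y)) * J x y) \<le> L\<^sup>2 * ?I z"
        by (simp add: z power2_eq_square mult.assoc)
    qed
    ultimately have fin: "(\<integral>\<^sup>+ z. ennreal (case z of (x, y) \<Rightarrow> (\<phi> (f x) - \<phi> (f y)) * (\<phi> (f x) - \<phi> (f y)) * J x y) \<partial>lebesgue) < \<infinity>"
      (is "?X < \<infinity>") by order
    show ?thesis
      unfolding levy_form_nonneg_eq[OF J, of "\<lambda>x. \<phi> (f x)" "\<lambda>x. \<phi> (f x)", simplified]
      using fin by (cases ?X rule: ennreal_cases) auto
  qed
  ultimately show ?thesis by (simp add: levy_space_def Lp_2_iff)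
qed

lemma signed_trunc_powr_measurable: "signed_trunc_powr l \<beta> \<in> borel_measurable borel"
  unfolding signed_trunc_powr_def[abs_def] by measurable

text \<open>The inequality at \<open>R\<close> is applied to \<open>f = w powr (r / R)\<close>, for
  which \<open>f powr R = w powr r\<close>; the freedom \<open>r < R\<close> serves the exponents
  below \<open>p\<close>. Its form is bounded, through \<open>powr_form_le\<close> and
  \<open>trunc_powr_form_le\<close>, by the value \<open>e\<close> that the equation delivers. The
  strict \<open>2 < r\<close> makes the entropy integral finite, so the conclusion is an inequality
  between real numbers.\<close>

lemma trunc_entropy_le:
  fixes J :: "real ^ 'n \<Rightarrow> real ^ 'n \<Rightarrow> real"
  assumes J: "levy_kernel J" and ls: "log_sobolev J R C D" and "0 < D"
    and u: "u \<in> levy_space J" and "0 < l" "2 < r" "r \<le> R"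
    and e: "levy_form J u (\<lambda>x. signed_trunc_powr l (r - 1) (u x)) = ereal e"
  defines "w \<equiv> \<lambda>x. min \<bar>u x\<bar> l"
  defines "G \<equiv> LINT x|lebesgue. w x powr r"
  shows "integrable lebesgue (\<lambda>x. w x powr r)"
    and "integrable lebesgue (\<lambda>x. w x powr r * ln (w x))"
    and "r * (LINT x|lebesgue. w x powr r * ln (w x)) - G * ln G \<le> C * G + D * e"
proof -
  have um[measurable]: "u \<in> borel_measurable lebesgue" and ui: "integrable lebesgue (\<lambda>x. (u x)\<^sup>2)"
    using u by (auto simp: levy_space_def Lp_2_iff)
  have wm[measurable]: "w \<in> borel_measurable lebesgue" unfolding w_def by measurable
  have w: "0 \<le> w x" "w x \<le> l" "(w x)\<^sup>2 \<le> (u x)\<^sup>2" for x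
    using \<open>0 < l\<close> by (auto simp: w_def abs_le_square_iff[symmetric])
  show int1: "integrable lebesgue (\<lambda>x. w x powr r)"
  proof (rule Bochner_Integration.integrable_bound[of _ "\<lambda>x. l powr (r - 2) * (u x)\<^sup>2"])
    have "w x powr r \<le> l powr (r - 2) * (u x)\<^sup>2" for x
      by (rule order_trans[OF powr_le_square[of "w x" l r]])
        (use w[of x] \<open>2 < r\<close> in \<open>auto intro!: mult_left_mono\<close>)
    then show "AE x in lebesgue. norm (w x powr r) \<le> norm (l powr (r - 2) * (u x)\<^sup>2)"
      by simp
  qed (use ui in auto)
  show int2: "integrable lebesgue (\<lambda>x. w x powr r * ln (w x))"
  proof (rule Bochner_Integration.integrable_bound
      [of _ "\<lambda>x. (1 / (r - 2) + (max 1 l) powr r) * (u x)\<^sup>2"])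
    have "\<bar>w x powr r * ln (w x)\<bar> \<le> (1 / (r - 2) + (max 1 l) powr r) * (u x)\<^sup>2" for x
    proof -
      have "w x powr r * \<bar>ln (w x)\<bar> \<le> (1 / (r - 2) + (max 1 l) powr r) * (w x)\<^sup>2"
        using w[of x] assms by (intro powr_abs_ln_le) auto
      also have "\<dots> \<le> (1 / (r - 2) + (max 1 l) powr r) * (u x)\<^sup>2"
        using w[of x] assms by (intro mult_left_mono) auto
      finally show ?thesis by (simp add: abs_mult)
    qed
    then show "AE x in lebesgue. norm (w x powr r * ln (w x))
        \<le> norm ((1 / (r - 2) + (max 1 l) powr r) * (u x)\<^sup>2)"
      using \<open>2 < r\<close> by (intro AE_I2) (simp add: abs_mult)
  qed (use ui in auto)
  have R: "2 < R" "0 < R" "0 < r" using assms by auto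
  define \<sigma> where "\<sigma> = r / R"
  have \<sigma>: "0 < \<sigma>" "\<sigma> \<le> 1" "\<sigma> * R = r" "\<sigma> * (R - 1) = r - \<sigma>" using assms R by (auto simp: \<sigma>_def field_simps)
  define f where "f = (\<lambda>x. w x powr \<sigma>)"
  have fm: "f \<in> borel_measurable lebesgue" unfolding f_def by measurable
  have f0: "0 \<le> f x" for x by (simp add: f_def)
  have fR: "\<bar>f x\<bar> powr R = w x powr r" for x
    using \<sigma> by (simp add: f_def powr_powr)
  \<comment> \<open>Admissibility of \<open>f\<close>: \<open>\<bar>f x\<bar> powr (R / 2)\<close>
    is the truncated \<open>r / 2\<close>-th power of \<open>u\<close>, a Lipschitz function of
    \<open>u\<close> because \<open>r / 2 \<ge> 1\<close>.\<close>
  have "(\<lambda>x. (min \<bar>u x\<bar> l) powr (r / 2)) \<in> levy_space J"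
  proof (rule levy_space_lipschitz[OF J u, of "\<lambda>s. (min \<bar>s\<bar> l) powr (r / 2)"])
    show "\<bar>(min \<bar>a\<bar> l) powr (r / 2) - (min \<bar>b\<bar> l) powr (r / 2)\<bar>
        \<le> (r / 2 * l powr (r / 2 - 1)) * \<bar>a - b\<bar>" for a b
      using assms by (intro trunc_powr_lipschitz) auto
  qed (use \<open>0 < l\<close> in \<open>auto simp: min_def\<close>)
  moreover have "\<bar>f x\<bar> powr (R / 2) = (min \<bar>u x\<bar> l) powr (r / 2)" for x
    using \<sigma> by (simp add: f_def powr_powr w_def)
  ultimately have "(\<lambda>x. \<bar>f x\<bar> powr (R / 2)) \<in> levy_space J" by simp
  with ls fm have "Ent (\<lambda>x. \<bar>f x\<bar> powr R)
     \<le> ereal (C * Lp_norm R f powr R) + ereal D * levy_form J (\<lambda>x. \<bar>f x\<bar> powr (R - 2) * f x) f"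
    unfolding log_sobolev_def by blast
  also have "Lp_norm R f powr R = G"
    using R by (simp add: Lp_norm_def fR G_def powr_powr)
  also have "Ent (\<lambda>x. \<bar>f x\<bar> powr R) = ereal (r * (LINT x|lebesgue. w x powr r * ln (w x)) - G * ln G)"
  proof -
    have eq: "ent_fun \<bar>w x powr r\<bar> = r * (w x powr r * ln (w x))" for x
      using w[of x] by (cases "w x = 0") (auto simp: ent_fun_def ln_powr)
    show ?thesis
      unfolding Ent_def fR eq
      using int2 by (subst ext_integral_eq_integral) (auto simp: ent_fun_def G_def)
  qed
  also have "(\<lambda>x. \<bar>f x\<bar> powr (R - 2) * f x) = (\<lambda>x. w x powr (r - \<sigma>))"
  proof
    fix x
    show "\<bar>f x\<bar> powr (R - 2) * f x = w x powr (r - \<sigma>)"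
    proof (cases "w x = 0")
      case False
      then have "f x > 0" using w[of x] by (simp add: f_def)
      then have "\<bar>f x\<bar> powr (R - 2) * f x = f x powr (R - 1)"
        by (simp add: mult.commute powr_mult_base)
      then show ?thesis using \<sigma> by (simp add: f_def powr_powr)
    qed (simp add: f_def)
  qed
  finally have main: "ereal (r * (LINT x|lebesgue. w x powr r * ln (w x)) - G * ln G)
      \<le> ereal (C * G) + ereal D * levy_form J (\<lambda>x. w x powr (r - \<sigma>)) f" .
  have "levy_form J (\<lambda>x. w x powr (r - \<sigma>)) f \<le> levy_form J u (\<lambda>x. signed_trunc_powr l (r - 1) (u x))"
  proof (rule levy_form_mono[OF J])
    show "0 \<le> (w x powr (r - \<sigma>) - w y powr (r - \<sigma>)) * (f x - f y)" for x y
      unfolding f_def using w(1) \<sigma>(1,2) \<open>2 < r\<close> by (intro powr_diff_mult_nonneg) auto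
    show "(w x powr (r - \<sigma>) - w y powr (r - \<sigma>)) * (f x - f y)
      \<le> (u x - u y) * (signed_trunc_powr l (r - 1) (u x) - signed_trunc_powr l (r - 1) (u y))" for x y
    proof -
      have "(w x powr (r - \<sigma>) - w y powr (r - \<sigma>)) * (f x - f y)
          \<le> (w x powr (r - 1) - w y powr (r - 1)) * (w x - w y)"
        unfolding f_def using w(1) \<sigma>(1,2) \<open>2 < r\<close> by (intro powr_form_le) auto
      also have "\<dots> \<le> (u x - u y) * (signed_trunc_powr l (r - 1) (u x) - signed_trunc_powr l (r - 1) (u y))"
        unfolding w_def using assms by (intro trunc_powr_form_le) auto
      finally show ?thesis .
    qed
  qed
  then have "ereal D * levy_form J (\<lambda>x. w x powr (r - \<sigma>)) f \<le> ereal D * ereal e"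
    unfolding e using \<open>0 < D\<close> by (intro ereal_mult_left_mono) auto
  from order_trans[OF main add_left_mono[OF this]]
  show "r * (LINT x|lebesgue. w x powr r * ln (w x)) - G * ln G \<le> C * G + D * e"
    unfolding times_ereal.simps plus_ereal.simps ereal_less_eq(3) .
qed

section \<open>Differentiation along curves in \<open>L\<^sup>2\<close>\<close>

lemma integrable_mult_squares:
  fixes f g :: "'a \<Rightarrow> real"
  assumes "f \<in> borel_measurable M" "g \<in> borel_measurable M"
    "integrable M (\<lambda>x. (f x)\<^sup>2)" "integrable M (\<lambda>x. (g x)\<^sup>2)"
  shows "integrable M (\<lambda>x. f x * g x)"
proof (rule Bochner_Integration.integrable_bound[of _ "\<lambda>x. (f x)\<^sup>2 + (g x)\<^sup>2"])
  have "\<bar>f x * g x\<bar> \<le> (f x)\<^sup>2 + (g x)\<^sup>2" for x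
  proof -
    have "0 \<le> \<bar>f x\<bar> * \<bar>g x\<bar>" by simp
    then show ?thesis using sum_squares_bound[of "\<bar>f x\<bar>" "\<bar>g x\<bar>"] unfolding abs_mult power2_abs by linarith
  qed
  then show "AE x in M. norm (f x * g x) \<le> norm ((f x)\<^sup>2 + (g x)\<^sup>2)" by simp
qed (use assms in auto)

lemma integrable_square_diff:
  fixes f g :: "'a \<Rightarrow> real"
  assumes "f \<in> borel_measurable M" "g \<in> borel_measurable M"
    "integrable M (\<lambda>x. (f x)\<^sup>2)" "integrable M (\<lambda>x. (g x)\<^sup>2)"
  shows "integrable M (\<lambda>x. (f x - g x)\<^sup>2)"
  using assms integrable_mult_squares[OF assms]
  by (simp add: power2_diff mult.assoc)

lemma integral_mult_le_sqrt:
  fixes f g :: "'a \<Rightarrow> real"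
  assumes "f \<in> borel_measurable M" "g \<in> borel_measurable M"
    and f2: "integrable M (\<lambda>x. (f x)\<^sup>2)" and g2: "integrable M (\<lambda>x. (g x)\<^sup>2)"
  shows "\<bar>LINT x|M. f x * g x\<bar> \<le> sqrt (LINT x|M. (f x)\<^sup>2) * sqrt (LINT x|M. (g x)\<^sup>2)"
proof -
  define a b c where "a = (LINT x|M. (f x)\<^sup>2)" and "b = (LINT x|M. (g x)\<^sup>2)"
    and "c = (LINT x|M. f x * g x)"
  have fg: "integrable M (\<lambda>x. f x * g x)" using assms by (rule integrable_mult_squares)
  have nonneg: "0 \<le> a" "0 \<le> b" by (auto simp: a_def b_def)
  have quad: "0 \<le> a + 2 * t * c + t\<^sup>2 * b" for t
  proof -
    have "0 \<le> (LINT x|M. (f x + t * g x)\<^sup>2)" by simp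
    also have "\<dots> = (LINT x|M. (f x)\<^sup>2 + (2 * t) * (f x * g x) + t\<^sup>2 * (g x)\<^sup>2)"
      by (rule Bochner_Integration.integral_cong) (auto simp: power2_sum power_mult_distrib)
    also have "\<dots> = a + 2 * t * c + t\<^sup>2 * b" using f2 g2 fg by (simp add: a_def b_def c_def)
    finally show ?thesis .
  qed
  have "c\<^sup>2 \<le> a * b"
  proof (cases "b = 0")
    case True
    \<comment> \<open>For \<open>b = 0\<close> the quadratic is affine in \<open>t\<close>; if
      \<open>c \<noteq> 0\<close>, the chosen \<open>t\<close> would give it the value
      \<open>-1\<close>.\<close>
    then have "c = 0" using quad[of "- (a + 1) / (2 * c)"] by (cases "c = 0") (auto simp: field_simps)
    then show ?thesis using nonneg by simp
  next
    case False
    then have "0 \<le> a - c\<^sup>2 / b" using quad[of "- c / b"] by (simp add: power2_eq_square field_simps)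
    then show ?thesis using False nonneg by (simp add: field_simps)
  qed
  then have "\<bar>c\<bar> \<le> sqrt (a * b)" by (simp add: real_le_rsqrt)
  then show ?thesis by (simp add: a_def b_def c_def real_sqrt_mult)
qed

lemma dominated_convergence_at_within:
  fixes s :: "real \<Rightarrow> 'a \<Rightarrow> real"
  assumes "\<And>\<beta>. \<beta> \<in> S - {\<alpha>} \<Longrightarrow> s \<beta> \<in> borel_measurable M" "f \<in> borel_measurable M" "integrable M w"
    and "\<And>\<beta> x. \<beta> \<in> S - {\<alpha>} \<Longrightarrow> \<bar>s \<beta> x\<bar> \<le> w x"
    and lim: "\<And>x. ((\<lambda>\<beta>. s \<beta> x) \<longlongrightarrow> f x) (at \<alpha> within S)"
  shows "((\<lambda>\<beta>. LINT x|M. s \<beta> x) \<longlongrightarrow> (LINT x|M. f x)) (at \<alpha> within S)"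
  unfolding tendsto_at_iff_sequentially comp_def
proof (intro allI impI)
  fix X :: "nat \<Rightarrow> real" assume X: "\<forall>i. X i \<in> S - {\<alpha>}" "X \<longlonglongrightarrow> \<alpha>"
  show "(\<lambda>i. LINT x|M. s (X i) x) \<longlonglongrightarrow> (LINT x|M. f x)"
  proof (rule integral_dominated_convergence[where w = w])
    show "AE x in M. (\<lambda>i. s (X i) x) \<longlonglongrightarrow> f x"
      using lim X unfolding tendsto_at_iff_sequentially comp_def by blast
  qed (use assms X in auto)
qed

text \<open>On L^2 only a quadratic remainder is integrable. The two bounds say that the functional
  given by integrating \<open>\<psi> \<beta>\<close> is differentiable on L^2 with gradient
  \<open>\<phi> \<beta>\<close>, with one constant \<open>K\<close> for all parameters;
  \<open>\<psi> \<beta> 0 = 0\<close> makes the integral finite.\<close>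

definition quadratic_family ::
  "real set \<Rightarrow> real \<Rightarrow> (real \<Rightarrow> real \<Rightarrow> real) \<Rightarrow> (real \<Rightarrow> real \<Rightarrow> real) \<Rightarrow> bool" where
  "quadratic_family S K \<psi> \<phi> \<longleftrightarrow>
     (\<forall>\<beta>\<in>S. \<psi> \<beta> \<in> borel_measurable borel \<and> \<phi> \<beta> \<in> borel_measurable borel \<and> \<psi> \<beta> 0 = 0 \<and>
        (\<forall>s. \<bar>\<phi> \<beta> s\<bar> \<le> K * \<bar>s\<bar>) \<and>
        (\<forall>s t. \<bar>\<psi> \<beta> t - \<psi> \<beta> s - \<phi> \<beta> s * (t - s)\<bar> \<le> K * (t - s)\<^sup>2))"

lemma quadratic_family_bound:
  assumes "quadratic_family S K \<psi> \<phi>" "\<beta> \<in> S"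
  shows "\<bar>\<psi> \<beta> s\<bar> \<le> K * s\<^sup>2"
proof -
  have "\<bar>\<phi> \<beta> 0\<bar> \<le> K * \<bar>0\<bar>" "\<psi> \<beta> 0 = 0" "\<bar>\<psi> \<beta> s - \<psi> \<beta> 0 - \<phi> \<beta> 0 * (s - 0)\<bar> \<le> K * (s - 0)\<^sup>2"
    using assms unfolding quadratic_family_def by blast+
  then show ?thesis by simp
qed

lemma quadratic_family_integrable:
  assumes "quadratic_family S K \<psi> \<phi>" "\<beta> \<in> S" "f \<in> borel_measurable M" "integrable M (\<lambda>x. (f x)\<^sup>2)"
  shows "integrable M (\<lambda>x. \<psi> \<beta> (f x))"
proof (rule Bochner_Integration.integrable_bound[of _ "\<lambda>x. K * (f x)\<^sup>2"])
  have "\<psi> \<beta> \<in> borel_measurable borel" using assms by (auto simp: quadratic_family_def)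
  then show "(\<lambda>x. \<psi> \<beta> (f x)) \<in> borel_measurable M" using assms(3) by (rule measurable_compose[rotated])
  show "AE x in M. norm (\<psi> \<beta> (f x)) \<le> norm (K * (f x)\<^sup>2)"
    using quadratic_family_bound[OF assms(1,2)] by (simp add: order_trans[OF _ abs_ge_self])
qed (use assms in auto)

text \<open>Two moves: from \<open>U \<alpha>\<close> to \<open>U \<beta>\<close> at the fixed
  parameter \<open>\<beta>\<close>, controlled by gradient and remainder uniformly in
  \<open>\<beta>\<close>, and from \<open>\<beta>\<close> to \<open>\<alpha>\<close> at the fixed
  function \<open>U \<alpha>\<close>, with the majorant
  \<open>K * (U \<alpha> x)\<^sup>2\<close>.\<close>

lemma integral_quadratic_family_continuous:
  fixes U :: "real \<Rightarrow> 'a \<Rightarrow> real"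
  assumes q: "quadratic_family S K \<psi> \<phi>" and \<alpha>: "\<alpha> \<in> S"
    and U: "\<And>\<beta>. \<beta> \<in> S \<Longrightarrow> U \<beta> \<in> borel_measurable M" "\<And>\<beta>. \<beta> \<in> S \<Longrightarrow> integrable M (\<lambda>x. (U \<beta> x)\<^sup>2)"
    and Ucont: "((\<lambda>\<beta>. LINT x|M. (U \<beta> x - U \<alpha> x)\<^sup>2) \<longlongrightarrow> 0) (at \<alpha> within S)"
    and \<psi>cont: "\<And>s. ((\<lambda>\<beta>. \<psi> \<beta> s) \<longlongrightarrow> \<psi> \<alpha> s) (at \<alpha> within S)"
  shows "((\<lambda>\<beta>. LINT x|M. \<psi> \<beta> (U \<beta> x)) \<longlongrightarrow> (LINT x|M. \<psi> \<alpha> (U \<alpha> x))) (at \<alpha> within S)"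
proof -
  have meas: "\<psi> \<beta> \<in> borel_measurable borel" "\<phi> \<beta> \<in> borel_measurable borel" if "\<beta> \<in> S" for \<beta>
    using q that by (auto simp: quadratic_family_def)
  note int = quadratic_family_integrable[OF q _ U]
  have U2: "integrable M (\<lambda>x. (U \<beta> x - U \<alpha> x)\<^sup>2)" if "\<beta> \<in> S" for \<beta>
    using U that \<alpha> by (intro integrable_square_diff) auto
  have "((\<lambda>\<beta>. (LINT x|M. \<psi> \<beta> (U \<alpha> x))) \<longlongrightarrow> (LINT x|M. \<psi> \<alpha> (U \<alpha> x))) (at \<alpha> within S)"
  proof (rule dominated_convergence_at_within[where w = "\<lambda>x. K * (U \<alpha> x)\<^sup>2"])
    show "(\<lambda>x. \<psi> \<beta> (U \<alpha> x)) \<in> borel_measurable M" if "\<beta> \<in> S - {\<alpha>}" for \<beta>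
      using measurable_compose[OF U(1)[OF \<alpha>] meas(1)] that by auto
    show "(\<lambda>x. \<psi> \<alpha> (U \<alpha> x)) \<in> borel_measurable M"
      using measurable_compose[OF U(1)[OF \<alpha>] meas(1)[OF \<alpha>]] .
  qed (use U \<alpha> \<psi>cont quadratic_family_bound[OF q] in auto)
  moreover have "((\<lambda>\<beta>. (LINT x|M. \<psi> \<beta> (U \<beta> x)) - (LINT x|M. \<psi> \<beta> (U \<alpha> x))) \<longlongrightarrow> 0) (at \<alpha> within S)"
  proof (rule Lim_null_comparison)
    let ?a = "LINT x|M. (U \<alpha> x)\<^sup>2" and ?d = "\<lambda>\<beta>. LINT x|M. (U \<beta> x - U \<alpha> x)\<^sup>2"
    show "((\<lambda>\<beta>. sqrt (K\<^sup>2 * ?a) * sqrt (?d \<beta>) + K * ?d \<beta>) \<longlongrightarrow> 0) (at \<alpha> within S)"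
      using tendsto_real_sqrt[OF Ucont] Ucont by (auto intro!: tendsto_eq_intros)
    have "\<bar>(LINT x|M. \<psi> \<beta> (U \<beta> x)) - (LINT x|M. \<psi> \<beta> (U \<alpha> x))\<bar> \<le> sqrt (K\<^sup>2 * ?a) * sqrt (?d \<beta>) + K * ?d \<beta>"
      if \<beta>: "\<beta> \<in> S" for \<beta>
    proof -
      let ?p = "\<lambda>x. \<phi> \<beta> (U \<alpha> x)" and ?D = "\<lambda>x. U \<beta> x - U \<alpha> x"
      have pm: "?p \<in> borel_measurable M" using measurable_compose[OF U(1)[OF \<alpha>] meas(2)[OF \<beta>]] .
      have p_le: "(?p x)\<^sup>2 \<le> K\<^sup>2 * (U \<alpha> x)\<^sup>2" for x
      proof -
        have "\<bar>\<phi> \<beta> (U \<alpha> x)\<bar> \<le> K * \<bar>U \<alpha> x\<bar>" using q \<beta> by (auto simp: quadratic_family_def)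
        then have "\<bar>\<phi> \<beta> (U \<alpha> x)\<bar>\<^sup>2 \<le> (K * \<bar>U \<alpha> x\<bar>)\<^sup>2" by (intro power_mono) auto
        then show ?thesis by (simp add: power_mult_distrib)
      qed
      have p2: "integrable M (\<lambda>x. (?p x)\<^sup>2)"
        by (rule Bochner_Integration.integrable_bound[of _ "\<lambda>x. K\<^sup>2 * (U \<alpha> x)\<^sup>2"]) (use pm p_le U \<alpha> in auto)
      have Dm: "?D \<in> borel_measurable M" using U \<alpha> \<beta> by auto
      have pD: "integrable M (\<lambda>x. ?p x * ?D x)" using pm Dm p2 U2[OF \<beta>] by (rule integrable_mult_squares)
      have "(LINT x|M. \<psi> \<beta> (U \<beta> x)) - (LINT x|M. \<psi> \<beta> (U \<alpha> x))
         = (LINT x|M. ?p x * ?D x) + (LINT x|M. \<psi> \<beta> (U \<beta> x) - \<psi> \<beta> (U \<alpha> x) - ?p x * ?D x)"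
        using int[OF \<beta> \<beta> \<beta>] int[OF \<beta> \<alpha> \<alpha>] pD by simp
      moreover have "\<bar>LINT x|M. ?p x * ?D x\<bar> \<le> sqrt (K\<^sup>2 * ?a) * sqrt (?d \<beta>)"
      proof -
        have "(LINT x|M. (?p x)\<^sup>2) \<le> (LINT x|M. K\<^sup>2 * (U \<alpha> x)\<^sup>2)"
          using p2 p_le U \<alpha> by (intro integral_mono) auto
        then have "sqrt (LINT x|M. (?p x)\<^sup>2) \<le> sqrt (K\<^sup>2 * ?a)" by simp
        from mult_right_mono[OF this, of "sqrt (?d \<beta>)"] show ?thesis
          using integral_mult_le_sqrt[OF pm Dm p2 U2[OF \<beta>]] by simp
      qed
      moreover have "\<bar>LINT x|M. \<psi> \<beta> (U \<beta> x) - \<psi> \<beta> (U \<alpha> x) - ?p x * ?D x\<bar> \<le> K * ?d \<beta>"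
      proof -
        have "\<bar>LINT x|M. \<psi> \<beta> (U \<beta> x) - \<psi> \<beta> (U \<alpha> x) - ?p x * ?D x\<bar>
           \<le> (LINT x|M. \<bar>\<psi> \<beta> (U \<beta> x) - \<psi> \<beta> (U \<alpha> x) - ?p x * ?D x\<bar>)"
          by (rule integral_abs_bound)
        also have "\<dots> \<le> (LINT x|M. K * (?D x)\<^sup>2)"
          using int[OF \<beta> \<beta> \<beta>] int[OF \<beta> \<alpha> \<alpha>] pD U2[OF \<beta>] q \<beta>
          by (intro integral_mono) (auto simp: quadratic_family_def)
        finally show ?thesis by simp
      qed
      ultimately show ?thesis by linarith
    qed
    then show "\<forall>\<^sub>F \<beta> in at \<alpha> within S. norm ((LINT x|M. \<psi> \<beta> (U \<beta> x)) - (LINT x|M. \<psi> \<beta> (U \<alpha> x)))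
        \<le> sqrt (K\<^sup>2 * ?a) * sqrt (?d \<beta>) + K * ?d \<beta>"
      by (auto simp: eventually_at_filter)
  qed
  ultimately show ?thesis using tendsto_add by fastforce
qed

text \<open>The functional is expanded around \<open>U \<alpha>\<close> with the parameter held at
  \<open>\<beta>\<close>, and the parameter moves afterwards at \<open>U \<alpha>\<close>. The
  quotient becomes four integrals: the gradient against \<open>W \<beta> - V\<close> (null by
  Cauchy-Schwarz), the gradient against \<open>V\<close> (dominated convergence), the remainder
  (null), and the quotient in the parameter (dominated by means of
  \<open>\<psi>lip\<close>).\<close>

lemma integral_quadratic_family_has_derivative:
  fixes U :: "real \<Rightarrow> 'a \<Rightarrow> real"
  assumes q: "quadratic_family S K \<psi> \<phi>" and S: "open S" and \<alpha>: "\<alpha> \<in> S"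
    and U: "\<And>\<beta>. \<beta> \<in> S \<Longrightarrow> U \<beta> \<in> borel_measurable M" "\<And>\<beta>. \<beta> \<in> S \<Longrightarrow> integrable M (\<lambda>x. (U \<beta> x)\<^sup>2)"
    and V: "V \<in> borel_measurable M" "integrable M (\<lambda>x. (V x)\<^sup>2)"
    and Uder: "((\<lambda>\<beta>. LINT x|M. ((U \<beta> x - U \<alpha> x) / (\<beta> - \<alpha>) - V x)\<^sup>2) \<longlongrightarrow> 0) (at \<alpha>)"
    and \<phi>cont: "\<And>s. ((\<lambda>\<beta>. \<phi> \<beta> s) \<longlongrightarrow> \<phi> \<alpha> s) (at \<alpha>)"
    and \<psi>der: "\<And>s. ((\<lambda>\<beta>. \<psi> \<beta> s) has_real_derivative \<eta> s) (at \<alpha>)"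
    and \<psi>lip: "\<And>\<beta> s. \<beta> \<in> S \<Longrightarrow> \<bar>\<psi> \<beta> s - \<psi> \<alpha> s\<bar> \<le> L * s\<^sup>2 * \<bar>\<beta> - \<alpha>\<bar>"
    and \<eta>: "\<eta> \<in> borel_measurable borel"
  shows "((\<lambda>\<beta>. LINT x|M. \<psi> \<beta> (U \<beta> x)) has_real_derivative
      (LINT x|M. \<phi> \<alpha> (U \<alpha> x) * V x) + (LINT x|M. \<eta> (U \<alpha> x))) (at \<alpha>)"
proof -
  have meas: "\<psi> \<beta> \<in> borel_measurable borel" "\<phi> \<beta> \<in> borel_measurable borel" if "\<beta> \<in> S" for \<beta>
    using q that by (auto simp: quadratic_family_def)
  have at: "at \<alpha> within S = at \<alpha>" using at_within_open[OF \<alpha> S] .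
  note int = quadratic_family_integrable[OF q _ U]
  let ?a = "LINT x|M. (U \<alpha> x)\<^sup>2" and ?v = "LINT x|M. (V x)\<^sup>2"
  define W where "W = (\<lambda>\<beta> x. (U \<beta> x - U \<alpha> x) / (\<beta> - \<alpha>))"
  define d where "d = (\<lambda>\<beta>. LINT x|M. (W \<beta> x - V x)\<^sup>2)"
  have d0: "(d \<longlongrightarrow> 0) (at \<alpha>)" using Uder by (simp add: d_def W_def)
  have Wm: "W \<beta> \<in> borel_measurable M" if "\<beta> \<in> S" for \<beta> using U that \<alpha> by (auto simp: W_def)
  have W2: "integrable M (\<lambda>x. (W \<beta> x)\<^sup>2)" if "\<beta> \<in> S" for \<beta>
    using integrable_square_diff[OF U(1)[OF that] U(1)[OF \<alpha>] U(2)[OF that] U(2)[OF \<alpha>]]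
    by (simp add: W_def power_divide)
  have WV2: "integrable M (\<lambda>x. (W \<beta> x - V x)\<^sup>2)" if "\<beta> \<in> S" for \<beta>
    using Wm W2 V that by (intro integrable_square_diff) auto
  have pm: "(\<lambda>x. \<phi> \<beta> (U \<alpha> x)) \<in> borel_measurable M" if "\<beta> \<in> S" for \<beta>
    using measurable_compose[OF U(1)[OF \<alpha>] meas(2)[OF that]] .
  have p_abs: "\<bar>\<phi> \<beta> s\<bar> \<le> K * \<bar>s\<bar>" if "\<beta> \<in> S" for \<beta> s using q that by (auto simp: quadratic_family_def)
  have p_le: "(\<phi> \<beta> (U \<alpha> x))\<^sup>2 \<le> K\<^sup>2 * (U \<alpha> x)\<^sup>2" if "\<beta> \<in> S" for x \<beta>
  proof -
    have "\<bar>\<phi> \<beta> (U \<alpha> x)\<bar>\<^sup>2 \<le> (K * \<bar>U \<alpha> x\<bar>)\<^sup>2" using p_abs[OF that] by (intro power_mono) auto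
    then show ?thesis by (simp add: power_mult_distrib)
  qed
  have p2: "integrable M (\<lambda>x. (\<phi> \<beta> (U \<alpha> x))\<^sup>2)" if "\<beta> \<in> S" for \<beta>
    by (rule Bochner_Integration.integrable_bound[of _ "\<lambda>x. K\<^sup>2 * (U \<alpha> x)\<^sup>2"])
      (use pm p_le U \<alpha> that in auto)
  have T1: "((\<lambda>\<beta>. LINT x|M. \<phi> \<beta> (U \<alpha> x) * (W \<beta> x - V x)) \<longlongrightarrow> 0) (at \<alpha>)"
  proof (rule Lim_null_comparison)
    show "((\<lambda>\<beta>. sqrt (K\<^sup>2 * ?a) * sqrt (d \<beta>)) \<longlongrightarrow> 0) (at \<alpha>)"
      using tendsto_mult_right_zero[OF tendsto_real_sqrt[OF d0, simplified]] .
    have "\<bar>LINT x|M. \<phi> \<beta> (U \<alpha> x) * (W \<beta> x - V x)\<bar> \<le> sqrt (K\<^sup>2 * ?a) * sqrt (d \<beta>)" if \<beta>: "\<beta> \<in> S" for \<beta>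
    proof -
      have "(LINT x|M. (\<phi> \<beta> (U \<alpha> x))\<^sup>2) \<le> (LINT x|M. K\<^sup>2 * (U \<alpha> x)\<^sup>2)"
        using p2 p_le U \<alpha> \<beta> by (intro integral_mono) auto
      then have "sqrt (LINT x|M. (\<phi> \<beta> (U \<alpha> x))\<^sup>2) \<le> sqrt (K\<^sup>2 * ?a)" by simp
      from mult_right_mono[OF this, of "sqrt (d \<beta>)"] show ?thesis
        using integral_mult_le_sqrt[OF pm[OF \<beta>] _ p2[OF \<beta>] WV2[OF \<beta>]] Wm[OF \<beta>] V(1)
        by (simp add: d_def)
    qed
    then show "\<forall>\<^sub>F \<beta> in at \<alpha>. norm (LINT x|M. \<phi> \<beta> (U \<alpha> x) * (W \<beta> x - V x)) \<le> sqrt (K\<^sup>2 * ?a) * sqrt (d \<beta>)"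
      using eventually_at_in_open'[OF S \<alpha>] by (auto elim!: eventually_mono)
  qed
  have T2: "((\<lambda>\<beta>. LINT x|M. \<phi> \<beta> (U \<alpha> x) * V x) \<longlongrightarrow> (LINT x|M. \<phi> \<alpha> (U \<alpha> x) * V x)) (at \<alpha>)"
    unfolding at[symmetric]
  proof (rule dominated_convergence_at_within[where w = "\<lambda>x. K * \<bar>U \<alpha> x * V x\<bar>"])
    show "integrable M (\<lambda>x. K * \<bar>U \<alpha> x * V x\<bar>)"
      using integrable_mult_squares[OF U(1)[OF \<alpha>] V(1) U(2)[OF \<alpha>] V(2)] by auto
    show "\<bar>\<phi> \<beta> (U \<alpha> x) * V x\<bar> \<le> K * \<bar>U \<alpha> x * V x\<bar>" if "\<beta> \<in> S - {\<alpha>}" for \<beta> x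
      using mult_right_mono[OF p_abs[of \<beta> "U \<alpha> x"], of "\<bar>V x\<bar>"] that by (simp add: abs_mult mult.assoc)
    show "((\<lambda>\<beta>. \<phi> \<beta> (U \<alpha> x) * V x) \<longlongrightarrow> \<phi> \<alpha> (U \<alpha> x) * V x) (at \<alpha> within S)" for x
      using \<phi>cont unfolding at by (intro tendsto_intros) auto
  qed (use pm \<alpha> V in auto)
  \<comment> \<open>The remainder is at most
    \<open>K * \<bar>\<beta> - \<alpha>\<bar> * (W \<beta> x)\<^sup>2\<close>: one factor survives
    the division by \<open>\<beta> - \<alpha>\<close>, and \<open>W \<beta>\<close> stays bounded in
    L^2 since it converges to \<open>V\<close>.\<close>
  have T3: "((\<lambda>\<beta>. LINT x|M. (\<psi> \<beta> (U \<beta> x) - \<psi> \<beta> (U \<alpha> x) - \<phi> \<beta> (U \<alpha> x) * (U \<beta> x - U \<alpha> x)) / (\<beta> - \<alpha>)) \<longlongrightarrow> 0) (at \<alpha>)"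
  proof (rule Lim_null_comparison)
    show "((\<lambda>\<beta>. K * \<bar>\<beta> - \<alpha>\<bar> * (2 * d \<beta> + 2 * ?v)) \<longlongrightarrow> 0) (at \<alpha>)"
      using d0 by (auto intro!: tendsto_eq_intros)
    have "\<bar>LINT x|M. (\<psi> \<beta> (U \<beta> x) - \<psi> \<beta> (U \<alpha> x) - \<phi> \<beta> (U \<alpha> x) * (U \<beta> x - U \<alpha> x)) / (\<beta> - \<alpha>)\<bar>
        \<le> K * \<bar>\<beta> - \<alpha>\<bar> * (2 * d \<beta> + 2 * ?v)" if \<beta>: "\<beta> \<in> S" "\<beta> \<noteq> \<alpha>" for \<beta>
    proof -
      let ?r = "\<lambda>x. (\<psi> \<beta> (U \<beta> x) - \<psi> \<beta> (U \<alpha> x) - \<phi> \<beta> (U \<alpha> x) * (U \<beta> x - U \<alpha> x)) / (\<beta> - \<alpha>)"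
      have pD: "integrable M (\<lambda>x. \<phi> \<beta> (U \<alpha> x) * (U \<beta> x - U \<alpha> x))"
        using pm p2 U \<alpha> \<beta> by (intro integrable_mult_squares integrable_square_diff borel_measurable_diff) auto
      have r: "integrable M ?r" using int[OF \<beta>(1) \<beta>(1) \<beta>(1)] int[OF \<beta>(1) \<alpha> \<alpha>] pD by auto
      have K: "0 \<le> K" using p_abs[OF \<alpha>, of 1] by simp
      have "\<bar>LINT x|M. ?r x\<bar> \<le> (LINT x|M. \<bar>?r x\<bar>)" by (rule integral_abs_bound)
      also have "\<dots> \<le> (LINT x|M. K * \<bar>\<beta> - \<alpha>\<bar> * (2 * (W \<beta> x - V x)\<^sup>2 + 2 * (V x)\<^sup>2))"
      proof (rule integral_mono)
        fix x
        have "\<bar>\<psi> \<beta> (U \<beta> x) - \<psi> \<beta> (U \<alpha> x) - \<phi> \<beta> (U \<alpha> x) * (U \<beta> x - U \<alpha> x)\<bar> \<le> K * (U \<beta> x - U \<alpha> x)\<^sup>2"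
          using q \<beta> by (auto simp: quadratic_family_def)
        then have "\<bar>?r x\<bar> \<le> K * (U \<beta> x - U \<alpha> x)\<^sup>2 / \<bar>\<beta> - \<alpha>\<bar>"
          using \<beta> by (simp add: divide_right_mono)
        also have "\<dots> = K * \<bar>\<beta> - \<alpha>\<bar> * (W \<beta> x)\<^sup>2"
          using \<beta> by (simp add: W_def power_divide power2_eq_square divide_simps)
        also have "\<dots> \<le> K * \<bar>\<beta> - \<alpha>\<bar> * (2 * (W \<beta> x - V x)\<^sup>2 + 2 * (V x)\<^sup>2)"
        proof (rule mult_left_mono)
          have "0 \<le> (W \<beta> x - 2 * V x)\<^sup>2" by simp
          then show "(W \<beta> x)\<^sup>2 \<le> 2 * (W \<beta> x - V x)\<^sup>2 + 2 * (V x)\<^sup>2"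
            by (simp add: power2_eq_square algebra_simps)
        qed (use K in auto)
        finally show "\<bar>?r x\<bar> \<le> K * \<bar>\<beta> - \<alpha>\<bar> * (2 * (W \<beta> x - V x)\<^sup>2 + 2 * (V x)\<^sup>2)" .
      qed (use integrable_abs[OF r] WV2[OF \<beta>(1)] V in auto)
      also have "\<dots> = K * \<bar>\<beta> - \<alpha>\<bar> * (2 * d \<beta> + 2 * ?v)"
        using WV2[OF \<beta>(1)] V by (simp add: d_def)
      finally show ?thesis .
    qed
    then show "\<forall>\<^sub>F \<beta> in at \<alpha>. norm (LINT x|M. (\<psi> \<beta> (U \<beta> x) - \<psi> \<beta> (U \<alpha> x) - \<phi> \<beta> (U \<alpha> x) * (U \<beta> x - U \<alpha> x)) / (\<beta> - \<alpha>))
        \<le> K * \<bar>\<beta> - \<alpha>\<bar> * (2 * d \<beta> + 2 * ?v)"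
      using eventually_at_in_open[OF S \<alpha>] by (auto elim!: eventually_mono)
  qed
  have T4: "((\<lambda>\<beta>. LINT x|M. (\<psi> \<beta> (U \<alpha> x) - \<psi> \<alpha> (U \<alpha> x)) / (\<beta> - \<alpha>)) \<longlongrightarrow> (LINT x|M. \<eta> (U \<alpha> x))) (at \<alpha>)"
    unfolding at[symmetric]
  proof (rule dominated_convergence_at_within[where w = "\<lambda>x. L * (U \<alpha> x)\<^sup>2"])
    show "(\<lambda>x. (\<psi> \<beta> (U \<alpha> x) - \<psi> \<alpha> (U \<alpha> x)) / (\<beta> - \<alpha>)) \<in> borel_measurable M" if "\<beta> \<in> S - {\<alpha>}" for \<beta>
      using measurable_compose[OF U(1)[OF \<alpha>] meas(1)[of \<beta>]] measurable_compose[OF U(1)[OF \<alpha>] meas(1)[OF \<alpha>]] that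
      by (intro borel_measurable_divide borel_measurable_diff) auto
    show "(\<lambda>x. \<eta> (U \<alpha> x)) \<in> borel_measurable M" using measurable_compose[OF U(1)[OF \<alpha>] \<eta>] .
    show "\<bar>(\<psi> \<beta> (U \<alpha> x) - \<psi> \<alpha> (U \<alpha> x)) / (\<beta> - \<alpha>)\<bar> \<le> L * (U \<alpha> x)\<^sup>2" if "\<beta> \<in> S - {\<alpha>}" for \<beta> x
      using \<psi>lip[of \<beta> "U \<alpha> x"] that by (auto simp: pos_divide_le_eq)
    show "((\<lambda>\<beta>. (\<psi> \<beta> (U \<alpha> x) - \<psi> \<alpha> (U \<alpha> x)) / (\<beta> - \<alpha>)) \<longlongrightarrow> \<eta> (U \<alpha> x)) (at \<alpha> within S)" for x
      using \<psi>der[of "U \<alpha> x"] unfolding at has_field_derivative_iff .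
  qed (use U \<alpha> in auto)
  have "((\<lambda>\<beta>. ((LINT x|M. \<psi> \<beta> (U \<beta> x)) - (LINT x|M. \<psi> \<alpha> (U \<alpha> x))) / (\<beta> - \<alpha>)) \<longlongrightarrow>
      0 + (LINT x|M. \<phi> \<alpha> (U \<alpha> x) * V x) + 0 + (LINT x|M. \<eta> (U \<alpha> x))) (at \<alpha>)"
  proof (rule Lim_transform_eventually[OF tendsto_add[OF tendsto_add[OF tendsto_add[OF T1 T2] T3] T4]])
    have "(LINT x|M. \<phi> \<beta> (U \<alpha> x) * (W \<beta> x - V x)) + (LINT x|M. \<phi> \<beta> (U \<alpha> x) * V x)
       + (LINT x|M. (\<psi> \<beta> (U \<beta> x) - \<psi> \<beta> (U \<alpha> x) - \<phi> \<beta> (U \<alpha> x) * (U \<beta> x - U \<alpha> x)) / (\<beta> - \<alpha>))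
       + (LINT x|M. (\<psi> \<beta> (U \<alpha> x) - \<psi> \<alpha> (U \<alpha> x)) / (\<beta> - \<alpha>))
       = ((LINT x|M. \<psi> \<beta> (U \<beta> x)) - (LINT x|M. \<psi> \<alpha> (U \<alpha> x))) / (\<beta> - \<alpha>)" if \<beta>: "\<beta> \<in> S" "\<beta> \<noteq> \<alpha>" for \<beta>
    proof -
      have i1: "integrable M (\<lambda>x. \<phi> \<beta> (U \<alpha> x) * (W \<beta> x - V x))"
        using pm p2 Wm WV2 V \<beta> by (intro integrable_mult_squares) auto
      have i2: "integrable M (\<lambda>x. \<phi> \<beta> (U \<alpha> x) * V x)"
        using pm p2 V \<beta> by (intro integrable_mult_squares) auto
      have i3: "integrable M (\<lambda>x. \<phi> \<beta> (U \<alpha> x) * (U \<beta> x - U \<alpha> x))"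
        using pm p2 U \<alpha> \<beta> by (intro integrable_mult_squares integrable_square_diff borel_measurable_diff) auto
      have "(LINT x|M. \<phi> \<beta> (U \<alpha> x) * (W \<beta> x - V x)) + (LINT x|M. \<phi> \<beta> (U \<alpha> x) * V x)
         = (LINT x|M. \<phi> \<beta> (U \<alpha> x) * (U \<beta> x - U \<alpha> x)) / (\<beta> - \<alpha>)"
        using i1 i2 by (simp add: W_def algebra_simps flip: Bochner_Integration.integral_add)
      moreover have "(LINT x|M. (\<psi> \<beta> (U \<beta> x) - \<psi> \<beta> (U \<alpha> x) - \<phi> \<beta> (U \<alpha> x) * (U \<beta> x - U \<alpha> x)) / (\<beta> - \<alpha>))
         = ((LINT x|M. \<psi> \<beta> (U \<beta> x)) - (LINT x|M. \<psi> \<beta> (U \<alpha> x)) - (LINT x|M. \<phi> \<beta> (U \<alpha> x) * (U \<beta> x - U \<alpha> x))) / (\<beta> - \<alpha>)"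
        using i3 int[OF \<beta>(1) \<beta>(1) \<beta>(1)] int[OF \<beta>(1) \<alpha> \<alpha>] by simp
      moreover have "(LINT x|M. (\<psi> \<beta> (U \<alpha> x) - \<psi> \<alpha> (U \<alpha> x)) / (\<beta> - \<alpha>))
         = ((LINT x|M. \<psi> \<beta> (U \<alpha> x)) - (LINT x|M. \<psi> \<alpha> (U \<alpha> x))) / (\<beta> - \<alpha>)"
        using int[OF \<alpha> \<alpha> \<alpha>] int[OF \<beta>(1) \<alpha> \<alpha>] by simp
      ultimately show ?thesis using \<beta> by (simp add: diff_divide_distrib)
    qed
    then show "\<forall>\<^sub>F \<beta> in at \<alpha>. (LINT x|M. \<phi> \<beta> (U \<alpha> x) * (W \<beta> x - V x)) + (LINT x|M. \<phi> \<beta> (U \<alpha> x) * V x)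
       + (LINT x|M. (\<psi> \<beta> (U \<beta> x) - \<psi> \<beta> (U \<alpha> x) - \<phi> \<beta> (U \<alpha> x) * (U \<beta> x - U \<alpha> x)) / (\<beta> - \<alpha>))
       + (LINT x|M. (\<psi> \<beta> (U \<alpha> x) - \<psi> \<alpha> (U \<alpha> x)) / (\<beta> - \<alpha>))
       = ((LINT x|M. \<psi> \<beta> (U \<beta> x)) - (LINT x|M. \<psi> \<alpha> (U \<alpha> x))) / (\<beta> - \<alpha>)"
      using eventually_at_in_open[OF S \<alpha>] by (auto elim!: eventually_mono)
  qed
  then show ?thesis by (simp add: has_field_derivative_iff)
qed

section \<open>Solutions as curves in L^2\<close>

lemma Lp_norm_2_tendsto_0_iff:
  "((\<lambda>s. Lp_norm 2 (f s)) \<longlongrightarrow> 0) F \<longleftrightarrow> ((\<lambda>s. LINT x|lebesgue. (f s x)\<^sup>2) \<longlongrightarrow> 0) F"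
proof
  assume "((\<lambda>s. Lp_norm 2 (f s)) \<longlongrightarrow> 0) F"
  from tendsto_power[OF this, of 2] show "((\<lambda>s. LINT x|lebesgue. (f s x)\<^sup>2) \<longlongrightarrow> 0) F"
    by (simp add: Lp_norm_2)
next
  assume "((\<lambda>s. LINT x|lebesgue. (f s x)\<^sup>2) \<longlongrightarrow> 0) F"
  from tendsto_real_sqrt[OF this] show "((\<lambda>s. Lp_norm 2 (f s)) \<longlongrightarrow> 0) F"
    by (simp add: Lp_norm_2)
qed

text \<open>The part of \<open>levy_solution\<close> that the flow consumes: squared integrals in
  place of norms, and the equation tested with every \<open>g\<close> of the form domain,
  \<open>v\<close> being the time derivative. The initial value is left out; it enters only through
  the L^2 contraction.\<close>

definition levy_curve ::
  "(real ^ 'n \<Rightarrow> real ^ 'n \<Rightarrow> real) \<Rightarrow> (real \<Rightarrow> real ^ 'n \<Rightarrow> real) \<Rightarrow> (real \<Rightarrow> real ^ 'n \<Rightarrow> real) \<Rightarrow> bool" where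
  "levy_curve J u v \<longleftrightarrow>
    (\<forall>t\<ge>0. u t \<in> borel_measurable lebesgue \<and> integrable lebesgue (\<lambda>x. (u t x)\<^sup>2) \<and>
      ((\<lambda>s. LINT x|lebesgue. (u s x - u t x)\<^sup>2) \<longlongrightarrow> 0) (at t within {0..})) \<and>
    (\<forall>t>0. u t \<in> levy_space J \<and> v t \<in> borel_measurable lebesgue \<and> integrable lebesgue (\<lambda>x. (v t x)\<^sup>2) \<and>
      ((\<lambda>s. LINT x|lebesgue. ((u s x - u t x) / (s - t) - v t x)\<^sup>2) \<longlongrightarrow> 0) (at t) \<and>
      (\<forall>g\<in>levy_space J. levy_form J (u t) g = ereal (- (LINT x|lebesgue. g x * v t x))))"

lemma levy_curveD:
  assumes "levy_curve J u v"
  shows "\<And>t. 0 \<le> t \<Longrightarrow> u t \<in> borel_measurable lebesgue"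
    and "\<And>t. 0 \<le> t \<Longrightarrow> integrable lebesgue (\<lambda>x. (u t x)\<^sup>2)"
    and "\<And>t. 0 \<le> t \<Longrightarrow> ((\<lambda>s. LINT x|lebesgue. (u s x - u t x)\<^sup>2) \<longlongrightarrow> 0) (at t within {0..})"
    and "\<And>t. 0 < t \<Longrightarrow> u t \<in> levy_space J"
    and "\<And>t. 0 < t \<Longrightarrow> v t \<in> borel_measurable lebesgue"
    and "\<And>t. 0 < t \<Longrightarrow> integrable lebesgue (\<lambda>x. (v t x)\<^sup>2)"
    and "\<And>t. 0 < t \<Longrightarrow> ((\<lambda>s. LINT x|lebesgue. ((u s x - u t x) / (s - t) - v t x)\<^sup>2) \<longlongrightarrow> 0) (at t)"
    and "\<And>t g. 0 < t \<Longrightarrow> g \<in> levy_space J \<Longrightarrow> levy_form J (u t) g = ereal (- (LINT x|lebesgue. g x * v t x))"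
  using assms unfolding levy_curve_def by blast+

lemma levy_solution_imp_levy_curve:
  assumes "levy_solution J u0 u"
  obtains v where "levy_curve J u v"
proof -
  from assms obtain v where v: "L2_has_derivative_on {0<..} u v" "L2_continuous_on {0<..} v"
     "\<forall>t>0. levy_operator J (u t) (\<lambda>x. - v t x)" and uc: "L2_continuous_on {0..} u"
    unfolding levy_solution_def by blast
  have "levy_curve J u v"
    unfolding levy_curve_def
  proof (intro conjI allI impI ballI)
    fix t :: real
    show "u t \<in> borel_measurable lebesgue" "integrable lebesgue (\<lambda>x. (u t x)\<^sup>2)"
      "((\<lambda>s. LINT x|lebesgue. (u s x - u t x)\<^sup>2) \<longlongrightarrow> 0) (at t within {0..})" if "0 \<le> t"
      using uc that by (auto simp: L2_continuous_on_def Lp_2_iff Lp_norm_2_tendsto_0_iff)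
    assume t: "0 < t"
    show "u t \<in> levy_space J" using v(3) t by (auto simp: levy_operator_def)
    show "v t \<in> borel_measurable lebesgue" "integrable lebesgue (\<lambda>x. (v t x)\<^sup>2)"
      using v(2) t by (auto simp: L2_continuous_on_def Lp_2_iff)
    show "((\<lambda>s. LINT x|lebesgue. ((u s x - u t x) / (s - t) - v t x)\<^sup>2) \<longlongrightarrow> 0) (at t)"
    proof -
      have "((\<lambda>s. LINT x|lebesgue. ((u s x - u t x) / (s - t) - v t x)\<^sup>2) \<longlongrightarrow> 0) (at t within {0<..})"
        using v(1) t unfolding L2_has_derivative_on_def Lp_norm_2_tendsto_0_iff by blast
      moreover have "at t within {0<..} = at t" using t by (intro at_within_open) auto
      ultimately show ?thesis by simp
    qed
    fix g assume "g \<in> levy_space J"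
    with v(3) t have "ereal (LINT x|lebesgue. - v t x * g x) = levy_form J (u t) g"
      unfolding levy_operator_def by blast
    then show "levy_form J (u t) g = ereal (- (LINT x|lebesgue. g x * v t x))"
      by (simp add: mult.commute)
  qed
  then show ?thesis by (rule that)
qed

lemma quadratic_family_square: "quadratic_family S 2 (\<lambda>_ s. s\<^sup>2) (\<lambda>_ s. 2 * s)"
proof -
  have "t\<^sup>2 - s\<^sup>2 - 2 * s * (t - s) = (t - s)\<^sup>2" for s t :: real
    by (simp add: power2_eq_square algebra_simps)
  then show ?thesis by (simp add: quadratic_family_def abs_mult)
qed

text \<open>The derivative of the squared norm at \<open>s\<close> is \<open>-2\<close> times the
  form at \<open>u s\<close>, hence nonpositive. At time 0 only continuity is available, which is
  enough for the mean value theorem.\<close>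

lemma levy_solution_L2_contraction:
  fixes u0 :: "real ^ 'n \<Rightarrow> real"
  assumes J: "levy_kernel J" and sol: "levy_solution J u0 u" and u0: "u0 \<in> Lp 2" and "0 \<le> t"
  shows "(LINT x|lebesgue. (u t x)\<^sup>2) \<le> (LINT x|lebesgue. (u0 x)\<^sup>2)"
proof -
  obtain v where "levy_curve J u v" using levy_solution_imp_levy_curve[OF sol] .
  note um = levy_curveD(1)[OF this] and ui = levy_curveD(2)[OF this] and uc = levy_curveD(3)[OF this]
    and us = levy_curveD(4)[OF this] and vm = levy_curveD(5)[OF this] and vi = levy_curveD(6)[OF this]
    and ud = levy_curveD(7)[OF this] and uf = levy_curveD(8)[OF this]
  define N where "N = (\<lambda>t. LINT x|lebesgue. (u t x)\<^sup>2)"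
  have cont: "continuous_on {0..} N"
    unfolding continuous_on_def N_def
    by (auto intro!: integral_quadratic_family_continuous[OF quadratic_family_square] um ui uc)
  have der: "(N has_real_derivative 2 * (LINT x|lebesgue. u s x * v s x)) (at s)" if "0 < s" for s
  proof -
    have "(N has_real_derivative (LINT x|lebesgue. (2 * u s x) * v s x) + (LINT x|(lebesgue :: (real ^ 'n) measure). 0)) (at s)"
      unfolding N_def
      by (rule integral_quadratic_family_has_derivative[OF quadratic_family_square[of "{0<..}"], where L = 0
            and \<eta> = "\<lambda>_. 0"])
        (use that um ui vm vi ud in auto)
    then show ?thesis by (simp add: mult.assoc)
  qed
  have nonpos: "(LINT x|lebesgue. u s x * v s x) \<le> 0" if "0 < s" for s
    using levy_form_nonneg[OF J, of "u s" "u s"] uf[OF that us[OF that]] by simp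
  have "N t \<le> N 0"
  proof (cases "t = 0")
    case False
    then have t: "0 < t" using \<open>0 \<le> t\<close> by simp
    have "\<exists>l z. 0 < z \<and> z < t \<and> DERIV N z :> l \<and> N t - N 0 = (t - 0) * l"
    proof (rule MVT[OF t])
      show "continuous_on {0..t} N" using cont by (rule continuous_on_subset) auto
      show "N differentiable (at x)" if "0 < x" for x
        using der[OF that] real_differentiable_def by blast
    qed
    then obtain l z where z: "0 < z" "DERIV N z :> l" "N t - N 0 = t * l" by auto
    from DERIV_unique[OF z(2) der[OF z(1)]] nonpos[OF z(1)] have "l \<le> 0" by simp
    with z(3) t have "N t - N 0 \<le> 0" by (simp add: mult_nonneg_nonpos)
    then show ?thesis by simp
  qed simp
  moreover have "N 0 = (LINT x|lebesgue. (u0 x)\<^sup>2)"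
    unfolding N_def
    by (rule integral_cong_AE) (use sol um[of 0] u0 in \<open>auto simp: levy_solution_def Lp_2_iff\<close>)
  ultimately show ?thesis by (simp add: N_def)
qed

text \<open>Chain rule in L^2: the quotient minus \<open>d * v x\<close> equals
  \<open>q \<beta> * (W - v x) + (q \<beta> - d) * v x\<close>, where \<open>W\<close> is the
  quotient in time. Keeping \<open>\<theta> \<beta>\<close> off \<open>\<theta> \<alpha>\<close>
  allows the punctured limit in time to be composed with \<open>\<theta>\<close>.\<close>

lemma L2_derivative_compose:
  fixes u :: "real \<Rightarrow> 'a \<Rightarrow> real"
  assumes S: "open S" "\<alpha> \<in> S"
    and u: "\<And>\<beta>. \<beta> \<in> S \<Longrightarrow> u (\<theta> \<beta>) \<in> borel_measurable M" "\<And>\<beta>. \<beta> \<in> S \<Longrightarrow> integrable M (\<lambda>x. (u (\<theta> \<beta>) x)\<^sup>2)"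
    and v: "v \<in> borel_measurable M" "integrable M (\<lambda>x. (v x)\<^sup>2)"
    and lim: "((\<lambda>s. LINT x|M. ((u s x - u (\<theta> \<alpha>) x) / (s - \<theta> \<alpha>) - v x)\<^sup>2) \<longlongrightarrow> 0) (at (\<theta> \<alpha>))"
    and \<theta>: "(\<theta> has_real_derivative d) (at \<alpha>)" "\<And>\<beta>. \<beta> \<in> S \<Longrightarrow> \<beta> \<noteq> \<alpha> \<Longrightarrow> \<theta> \<beta> \<noteq> \<theta> \<alpha>"
  shows "((\<lambda>\<beta>. LINT x|M. ((u (\<theta> \<beta>) x - u (\<theta> \<alpha>) x) / (\<beta> - \<alpha>) - d * v x)\<^sup>2) \<longlongrightarrow> 0) (at \<alpha>)"
proof (rule Lim_null_comparison)
  define q where "q = (\<lambda>\<beta>. (\<theta> \<beta> - \<theta> \<alpha>) / (\<beta> - \<alpha>))"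
  define e where "e = (\<lambda>s. LINT x|M. ((u s x - u (\<theta> \<alpha>) x) / (s - \<theta> \<alpha>) - v x)\<^sup>2)"
  have q: "(q \<longlongrightarrow> d) (at \<alpha>)" using \<theta>(1) by (simp add: q_def has_field_derivative_iff)
  have ev: "\<forall>\<^sub>F \<beta> in at \<alpha>. \<beta> \<in> S - {\<alpha>}"
    using eventually_at_in_open[OF S] .
  have "filterlim \<theta> (at (\<theta> \<alpha>)) (at \<alpha>)"
    using DERIV_isCont[OF \<theta>(1)] ev \<theta>(2) by (auto simp: filterlim_at isCont_def elim!: eventually_mono)
  then have e: "((\<lambda>\<beta>. e (\<theta> \<beta>)) \<longlongrightarrow> 0) (at \<alpha>)"
    using lim filterlim_compose unfolding e_def by blast
  show "((\<lambda>\<beta>. 2 * (q \<beta>)\<^sup>2 * e (\<theta> \<beta>) + 2 * (q \<beta> - d)\<^sup>2 * (LINT x|M. (v x)\<^sup>2)) \<longlongrightarrow> 0) (at \<alpha>)"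
    using q e by (auto intro!: tendsto_eq_intros)
  have "(LINT x|M. ((u (\<theta> \<beta>) x - u (\<theta> \<alpha>) x) / (\<beta> - \<alpha>) - d * v x)\<^sup>2)
      \<le> 2 * (q \<beta>)\<^sup>2 * e (\<theta> \<beta>) + 2 * (q \<beta> - d)\<^sup>2 * (LINT x|M. (v x)\<^sup>2)" if \<beta>: "\<beta> \<in> S" "\<beta> \<noteq> \<alpha>" for \<beta>
  proof -
    let ?W = "\<lambda>x. (u (\<theta> \<beta>) x - u (\<theta> \<alpha>) x) / (\<theta> \<beta> - \<theta> \<alpha>)"
    have ud: "integrable M (\<lambda>x. (u (\<theta> \<beta>) x - u (\<theta> \<alpha>) x)\<^sup>2)"
      using u S(2) \<beta> by (intro integrable_square_diff) auto
    then have W: "integrable M (\<lambda>x. (?W x)\<^sup>2)" by (simp add: power_divide)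
    have WV: "integrable M (\<lambda>x. (?W x - v x)\<^sup>2)"
      using u S(2) \<beta> v W by (intro integrable_square_diff) auto
    have dv: "integrable M (\<lambda>x. (d * v x)\<^sup>2)" using v by (simp add: power_mult_distrib)
    have "(LINT x|M. ((u (\<theta> \<beta>) x - u (\<theta> \<alpha>) x) / (\<beta> - \<alpha>) - d * v x)\<^sup>2)
       \<le> (LINT x|M. 2 * (q \<beta>)\<^sup>2 * (?W x - v x)\<^sup>2 + 2 * (q \<beta> - d)\<^sup>2 * (v x)\<^sup>2)"
    proof (rule integral_mono)
      show "integrable M (\<lambda>x. ((u (\<theta> \<beta>) x - u (\<theta> \<alpha>) x) / (\<beta> - \<alpha>) - d * v x)\<^sup>2)"
        using u S(2) \<beta> v dv ud by (intro integrable_square_diff) (auto simp: power_divide)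
      fix x
      have "(u (\<theta> \<beta>) x - u (\<theta> \<alpha>) x) / (\<beta> - \<alpha>) - d * v x = q \<beta> * (?W x - v x) + (q \<beta> - d) * v x"
      proof -
        have "q \<beta> * ?W x = (u (\<theta> \<beta>) x - u (\<theta> \<alpha>) x) / (\<beta> - \<alpha>)"
          using \<theta>(2)[OF \<beta>] by (simp add: q_def)
        then show ?thesis by (simp only: right_diff_distrib left_diff_distrib)
      qed
      moreover have "(a + b)\<^sup>2 \<le> 2 * a\<^sup>2 + 2 * b\<^sup>2" for a b :: real
        using sum_squares_bound[of a b] by (simp add: power2_sum)
      ultimately show "((u (\<theta> \<beta>) x - u (\<theta> \<alpha>) x) / (\<beta> - \<alpha>) - d * v x)\<^sup>2
          \<le> 2 * (q \<beta>)\<^sup>2 * (?W x - v x)\<^sup>2 + 2 * (q \<beta> - d)\<^sup>2 * (v x)\<^sup>2"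
        by (metis (no_types, lifting) mult.assoc power_mult_distrib)
    qed (use WV v in auto)
    also have "\<dots> = 2 * (q \<beta>)\<^sup>2 * e (\<theta> \<beta>) + 2 * (q \<beta> - d)\<^sup>2 * (LINT x|M. (v x)\<^sup>2)"
      using WV v by (simp add: e_def)
    finally show ?thesis .
  qed
  then show "\<forall>\<^sub>F \<beta> in at \<alpha>. norm (LINT x|M. ((u (\<theta> \<beta>) x - u (\<theta> \<alpha>) x) / (\<beta> - \<alpha>) - d * v x)\<^sup>2)
      \<le> 2 * (q \<beta>)\<^sup>2 * e (\<theta> \<beta>) + 2 * (q \<beta> - d)\<^sup>2 * (LINT x|M. (v x)\<^sup>2)"
    using ev by (auto elim!: eventually_mono)
qed

text \<open>Density of continuous functions in L^1. First \<open>f\<close> is cut at a height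
  \<open>m\<close>; then continuous functions converging almost everywhere are cut at the same
  height, so that \<open>2 * m\<close> on the bounded interval is a majorant for dominated
  convergence.\<close>

lemma set_integrable_approx_continuous:
  fixes f :: "real \<Rightarrow> real"
  assumes f: "set_integrable lebesgue {a..b} f" and "0 < e"
  obtains g where "continuous_on UNIV g" "set_integrable lebesgue {a..b} g"
    "(LINT x:{a..b}|lebesgue. \<bar>f x - g x\<bar>) \<le> e"
proof -
  define F where "F = (\<lambda>x. if x \<in> {a..b} then f x else 0)"
  have F: "integrable lebesgue F"
  proof -
    have "F = (\<lambda>x. indicat_real {a..b} x *\<^sub>R f x)" by (auto simp: F_def)
    then show ?thesis using f by (simp add: set_integrable_def)
  qed
  have "F \<in> borel_measurable lebesgue" using F by auto
  then have "F measurable_on UNIV"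
    by (simp add: lebesgue_measurable_imp_measurable_on_real)
  then obtain N G where N: "negligible N" and Gc: "\<And>n. continuous_on UNIV (G n)"
    and Glim: "\<And>x. x \<notin> N \<Longrightarrow> (\<lambda>n. G n x) \<longlonglongrightarrow> F x"
    unfolding measurable_on_def by force
  define tr where "tr = (\<lambda>n x. max (- real n) (min (real n) x))"
  have lb: "integrable lebesgue (indicator {a..b} :: real \<Rightarrow> real)"
    by (simp add: integrable_indicator_iff emeasure_lborel_Icc_eq)
  have trF: "(\<lambda>n. LINT x|lebesgue. \<bar>F x - tr n (F x)\<bar>) \<longlonglongrightarrow> (LINT x|(lebesgue :: real measure). 0)"
  proof (rule integral_dominated_convergence[where w = "\<lambda>x. \<bar>F x\<bar>"])
    show "AE x in lebesgue. (\<lambda>n. \<bar>F x - tr n (F x)\<bar>) \<longlonglongrightarrow> 0"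
    proof (rule AE_I2)
      fix x
      obtain m where "\<bar>F x\<bar> \<le> real m" using real_arch_simple by blast
      then have "\<forall>n\<ge>m. \<bar>F x - tr n (F x)\<bar> = 0" by (auto simp: tr_def)
      then show "(\<lambda>n. \<bar>F x - tr n (F x)\<bar>) \<longlonglongrightarrow> 0"
        by (intro tendsto_eventually) (auto simp: eventually_sequentially)
    qed
  qed (use F in \<open>auto simp: tr_def\<close>)
  then have "\<forall>\<^sub>F n in sequentially. (LINT x|lebesgue. \<bar>F x - tr n (F x)\<bar>) < e / 2"
    using \<open>0 < e\<close> by (intro order_tendstoD) auto
  then obtain m where m: "(LINT x|lebesgue. \<bar>F x - tr m (F x)\<bar>) < e / 2"
    by (auto simp: eventually_sequentially)
  have trF_int: "integrable lebesgue (\<lambda>x. tr m (F x))"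
    by (rule Bochner_Integration.integrable_bound[OF F]) (use F in \<open>auto simp: tr_def\<close>)
  have Gm: "G n \<in> borel_measurable lebesgue" for n
    by (intro measurable_completion) (simp add: borel_measurable_continuous_onI Gc)
  have cont: "continuous_on UNIV (\<lambda>x. tr m (G n x))" for n
    unfolding tr_def by (intro continuous_intros Gc)
  have int: "integrable lebesgue (\<lambda>x. indicator {a..b} x * tr m (G n x))" for n
  proof (rule Bochner_Integration.integrable_bound[of _ "\<lambda>x. real m * indicator {a..b} x"])
    show "(\<lambda>x. indicator {a..b} x * tr m (G n x)) \<in> borel_measurable lebesgue"
      unfolding tr_def by (intro borel_measurable_times borel_measurable_max borel_measurable_min
        borel_measurable_const Gm borel_measurable_indicator) auto
    show "AE x in lebesgue. norm (indicator {a..b} x * tr m (G n x)) \<le> norm (real m * indicator {a..b} x)"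
      by (rule AE_I2) (auto simp: tr_def indicator_def)
  qed (use lb in auto)
  have "(\<lambda>n. LINT x|lebesgue. \<bar>tr m (F x) - indicator {a..b} x * tr m (G n x)\<bar>) \<longlonglongrightarrow> (LINT x|(lebesgue :: real measure). 0)"
  proof (rule integral_dominated_convergence[where w = "\<lambda>x. 2 * real m * indicator {a..b} x"])
    have "AE x in lebesgue. x \<notin> N" using N by (auto simp: negligible_iff_null_sets AE_not_in)
    then show "AE x in lebesgue. (\<lambda>n. \<bar>tr m (F x) - indicator {a..b} x * tr m (G n x)\<bar>) \<longlonglongrightarrow> 0"
    proof eventually_elim
      fix x assume "x \<notin> N"
      then have lim: "(\<lambda>n. tr m (G n x)) \<longlonglongrightarrow> tr m (F x)"
        unfolding tr_def by (intro tendsto_intros Glim)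
      show "(\<lambda>n. \<bar>tr m (F x) - indicator {a..b} x * tr m (G n x)\<bar>) \<longlonglongrightarrow> 0"
      proof (cases "x \<in> {a..b}")
        case True
        then show ?thesis using tendsto_rabs[OF tendsto_diff[OF tendsto_const[of "tr m (F x)"] lim]] by simp
      next
        case False
        then show ?thesis by (auto simp: F_def tr_def)
      qed
    qed
    show "AE x in lebesgue. norm \<bar>tr m (F x) - indicator {a..b} x * tr m (G n x)\<bar> \<le> 2 * real m * indicator {a..b} x" for n
      by (rule AE_I2) (auto simp: tr_def F_def indicator_def)
  qed (use lb int[THEN borel_measurable_integrable] trF_int in auto)
  then have "\<forall>\<^sub>F n in sequentially. (LINT x|lebesgue. \<bar>tr m (F x) - indicator {a..b} x * tr m (G n x)\<bar>) < e / 2"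
    using \<open>0 < e\<close> by (intro order_tendstoD) auto
  then obtain n where n: "(LINT x|lebesgue. \<bar>tr m (F x) - indicator {a..b} x * tr m (G n x)\<bar>) < e / 2"
    by (auto simp: eventually_sequentially)
  show ?thesis
  proof
    show "continuous_on UNIV (\<lambda>x. tr m (G n x))" by (rule cont)
    show "set_integrable lebesgue {a..b} (\<lambda>x. tr m (G n x))" using int by (simp add: set_integrable_def)
    have "(LINT x:{a..b}|lebesgue. \<bar>f x - tr m (G n x)\<bar>) = (LINT x|lebesgue. \<bar>F x - indicator {a..b} x * tr m (G n x)\<bar>)"
      unfolding set_lebesgue_integral_def
      by (rule Bochner_Integration.integral_cong) (auto simp: F_def indicator_def)
    also have "\<dots> \<le> (LINT x|lebesgue. \<bar>F x - tr m (F x)\<bar> + \<bar>tr m (F x) - indicator {a..b} x * tr m (G n x)\<bar>)"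
      using F trF_int int by (intro integral_mono) auto
    also have "\<dots> \<le> e" using F trF_int int m n by simp
    finally show "(LINT x:{a..b}|lebesgue. \<bar>f x - tr m (G n x)\<bar>) \<le> e" .
  qed
qed

section \<open>The family of truncated powers\<close>

text \<open>Serves the exponents at which the level meets \<open>\<bar>s\<bar>\<close>: nearby, the
  level may lie on either side in any pattern, and all that is known is that each value comes from
  one of two functions that are tangent to each other at \<open>a\<close>.\<close>

lemma has_real_derivative_alternatives:
  fixes f f1 f2 :: "real \<Rightarrow> real"
  assumes "(f1 has_real_derivative d) (at a)" "(f2 has_real_derivative d) (at a)"
    and "f1 a = f a" "f2 a = f a" and alt: "\<forall>\<^sub>F x in at a. f x = f1 x \<or> f x = f2 x"
  shows "(f has_real_derivative d) (at a)"
proof -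
  let ?q = "\<lambda>g x. (g x - g a) / (x - a)"
  have "((\<lambda>x. \<bar>?q f1 x - d\<bar> + \<bar>?q f2 x - d\<bar>) \<longlongrightarrow> \<bar>d - d\<bar> + \<bar>d - d\<bar>) (at a)"
    using assms(1,2) unfolding has_field_derivative_iff by (intro tendsto_intros)
  then have "((\<lambda>x. ?q f x - d) \<longlongrightarrow> 0) (at a)"
    by (rule Lim_null_comparison[rotated, OF tendsto_eq_rhs])
      (use alt assms(3,4) in \<open>auto elim!: eventually_mono\<close>)
  then show ?thesis by (simp add: has_field_derivative_iff LIM_zero_iff)
qed

lemma quadratic_family_subset:
  "quadratic_family S K \<psi> \<phi> \<Longrightarrow> T \<subseteq> S \<Longrightarrow> quadratic_family T K \<psi> \<phi>"
  unfolding quadratic_family_def by blast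

text \<open>\<open>M\<close> is the logarithm of the normalisation \<open>m\<close>, left abstract
  here. The bound \<open>B\<close> on its derivative makes the estimates uniform up to the ends of
  the exponent interval, where only continuity is asked.\<close>

locale trunc_power_flow =
  fixes A b B :: real and M M' :: "real \<Rightarrow> real"
  assumes A: "0 < A" and b: "2 < b"
    and M_cont: "continuous_on {2..b} M"
    and M_der: "\<And>\<alpha>. 2 < \<alpha> \<Longrightarrow> \<alpha> < b \<Longrightarrow> (M has_real_derivative M' \<alpha>) (at \<alpha>)"
    and M'_le: "\<And>\<alpha>. 2 < \<alpha> \<Longrightarrow> \<alpha> < b \<Longrightarrow> \<bar>M' \<alpha>\<bar> \<le> B"
begin

text \<open>The level at which the slope of \<open>exp (- M \<alpha>) * s powr \<alpha>\<close> is \<open>A\<close>.\<close>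

definition lvl :: "real \<Rightarrow> real" where
  "lvl \<alpha> = exp ((ln A + M \<alpha> - ln \<alpha>) / (\<alpha> - 1))"

definition psi :: "real \<Rightarrow> real \<Rightarrow> real" where
  "psi \<alpha> s = trunc_pow \<alpha> (exp (- M \<alpha>)) (lvl \<alpha>) s"

definition phi :: "real \<Rightarrow> real \<Rightarrow> real" where
  "phi \<alpha> s = exp (- M \<alpha>) * \<alpha> * signed_trunc_powr (lvl \<alpha>) (\<alpha> - 1) s"

definition eta :: "real \<Rightarrow> real \<Rightarrow> real" where
  "eta \<alpha> s = exp (- M \<alpha>) * ((min \<bar>s\<bar> (lvl \<alpha>)) powr \<alpha> * (ln (min \<bar>s\<bar> (lvl \<alpha>)) - M' \<alpha>))"

lemma lvl_pos: "0 < lvl \<alpha>"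
  by (simp add: lvl_def)

lemma lvl_slope:
  assumes "1 < \<alpha>"
  shows "exp (- M \<alpha>) * \<alpha> * lvl \<alpha> powr (\<alpha> - 1) = A"
proof -
  have "lvl \<alpha> powr (\<alpha> - 1) = exp (ln A + M \<alpha> - ln \<alpha>)"
    using assms by (simp add: lvl_def powr_def)
  then show ?thesis using A assms by (simp add: exp_add exp_diff exp_minus)
qed

lemma psi_eq:
  "1 < \<alpha> \<Longrightarrow> psi \<alpha> s = exp (- M \<alpha>) * (min \<bar>s\<bar> (lvl \<alpha>)) powr \<alpha> + A * max 0 (\<bar>s\<bar> - lvl \<alpha>)"
  using lvl_slope[of \<alpha>] by (simp add: psi_def trunc_pow_def)

lemma lvl_cont: "continuous_on {2..b} lvl"
  unfolding lvl_def by (intro continuous_intros M_cont) auto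

lemma lvl_bounds:
  obtains l0 l1 where "0 < l0" "\<And>\<alpha>. \<alpha> \<in> {2..b} \<Longrightarrow> l0 \<le> lvl \<alpha>" "\<And>\<alpha>. \<alpha> \<in> {2..b} \<Longrightarrow> lvl \<alpha> \<le> l1"
proof -
  have ne: "{2..b} \<noteq> {}" using b by auto
  obtain x where x: "\<forall>y\<in>{2..b}. lvl x \<le> lvl y"
    using continuous_attains_inf[OF compact_Icc ne lvl_cont] by blast
  obtain z where z: "\<forall>y\<in>{2..b}. lvl y \<le> lvl z"
    using continuous_attains_sup[OF compact_Icc ne lvl_cont] by blast
  show ?thesis by (rule that[OF lvl_pos[of x]]) (use x z in auto)
qed

text \<open>The Lipschitz constant of \<open>phi \<alpha>\<close> is
  \<open>(\<alpha> - 1) * A / lvl \<alpha>\<close>, bounded because the level stays away from 0 on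
  the compact interval. By convexity the Taylor remainder lies between 0 and
  \<open>(phi \<alpha> t - phi \<alpha> s) * (t - s)\<close>.\<close>

lemma quadratic_family: obtains K where "quadratic_family {2..b} K psi phi"
proof -
  obtain l0 l1 where l: "0 < l0" "\<And>\<alpha>. \<alpha> \<in> {2..b} \<Longrightarrow> l0 \<le> lvl \<alpha>"
    using lvl_bounds by metis
  define K where "K = A * b / l0"
  have lip: "\<bar>phi \<alpha> s - phi \<alpha> t\<bar> \<le> K * \<bar>s - t\<bar>" if \<alpha>: "\<alpha> \<in> {2..b}" for \<alpha> s t
  proof -
    have "\<bar>phi \<alpha> s - phi \<alpha> t\<bar>
        = exp (- M \<alpha>) * \<alpha> * \<bar>signed_trunc_powr (lvl \<alpha>) (\<alpha> - 1) s - signed_trunc_powr (lvl \<alpha>) (\<alpha> - 1) t\<bar>"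
      using \<alpha> by (simp add: phi_def abs_mult flip: right_diff_distrib)
    also have "\<dots> \<le> exp (- M \<alpha>) * \<alpha> * ((\<alpha> - 1) * lvl \<alpha> powr (\<alpha> - 1 - 1) * \<bar>s - t\<bar>)"
      using \<alpha> lvl_pos by (intro mult_left_mono signed_trunc_powr_lipschitz) auto
    also have "\<dots> = (\<alpha> - 1) * (exp (- M \<alpha>) * \<alpha> * lvl \<alpha> powr (\<alpha> - 1)) / lvl \<alpha> * \<bar>s - t\<bar>"
      using lvl_pos[of \<alpha>] powr_diff[of "lvl \<alpha>" "\<alpha> - 1" 1] by simp
    also have "\<dots> = A * (\<alpha> - 1) / lvl \<alpha> * \<bar>s - t\<bar>"
      using lvl_slope[of \<alpha>] \<alpha> by simp
    also have "\<dots> \<le> K * \<bar>s - t\<bar>"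
      unfolding K_def using A b l \<alpha> by (intro mult_right_mono frac_le mult_left_mono) auto
    finally show ?thesis .
  qed
  have phi0: "phi \<alpha> 0 = 0" for \<alpha> by (simp add: phi_def signed_trunc_powr_def)
  have taylor: "\<bar>psi \<alpha> t - psi \<alpha> s - phi \<alpha> s * (t - s)\<bar> \<le> K * (t - s)\<^sup>2" if \<alpha>: "\<alpha> \<in> {2..b}" for \<alpha> s t
  proof -
    have sub: "phi \<alpha> s * (t - s) \<le> psi \<alpha> t - psi \<alpha> s" for s t
      unfolding phi_def psi_def using \<alpha> lvl_pos by (intro trunc_pow_subgradient) auto
    have "psi \<alpha> t - psi \<alpha> s - phi \<alpha> s * (t - s) \<le> (phi \<alpha> t - phi \<alpha> s) * (t - s)"
      using sub[of t s] by (simp add: algebra_simps)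
    also have "\<dots> \<le> \<bar>phi \<alpha> t - phi \<alpha> s\<bar> * \<bar>t - s\<bar>" by (simp add: abs_mult[symmetric])
    also have "\<dots> \<le> (K * \<bar>t - s\<bar>) * \<bar>t - s\<bar>" using lip[OF \<alpha>] by (intro mult_right_mono) auto
    also have "\<dots> = K * (t - s)\<^sup>2" by (simp add: power2_eq_square)
    finally show ?thesis using sub[of s t] by simp
  qed
  have "quadratic_family {2..b} K psi phi"
    unfolding quadratic_family_def
  proof (intro ballI conjI allI)
    fix \<alpha> s t assume \<alpha>: "\<alpha> \<in> {2..b}"
    show "psi \<alpha> \<in> borel_measurable borel" unfolding psi_def[abs_def] trunc_pow_def by measurable
    show "phi \<alpha> \<in> borel_measurable borel"
      unfolding phi_def[abs_def] using signed_trunc_powr_measurable by measurable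
    show "psi \<alpha> 0 = 0" using lvl_pos[of \<alpha>] by (simp add: psi_def trunc_pow_def)
    show "\<bar>phi \<alpha> s\<bar> \<le> K * \<bar>s\<bar>" using lip[OF \<alpha>, of s 0] phi0 by simp
    show "\<bar>psi \<alpha> t - psi \<alpha> s - phi \<alpha> s * (t - s)\<bar> \<le> K * (t - s)\<^sup>2" by (rule taylor[OF \<alpha>])
  qed
  then show ?thesis by (rule that)
qed

lemma psi_cont: "continuous_on {2..b} (\<lambda>\<alpha>. psi \<alpha> s)"
proof (cases "s = 0")
  case True
  then show ?thesis using lvl_pos by (simp add: psi_def trunc_pow_def less_imp_le)
next
  case False
  then have "0 < min \<bar>s\<bar> (lvl \<alpha>)" for \<alpha> using lvl_pos by simp
  then show ?thesis
    unfolding psi_def trunc_pow_def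
    by (intro continuous_intros M_cont lvl_cont) (auto simp: less_imp_neq[symmetric] lvl_pos less_imp_le)
qed

lemma phi_cont: "continuous_on {2..b} (\<lambda>\<alpha>. phi \<alpha> s)"
proof (cases "s = 0")
  case True
  then show ?thesis by (simp add: phi_def signed_trunc_powr_def)
next
  case False
  then have "0 < min \<bar>s\<bar> (lvl \<alpha>)" for \<alpha> using lvl_pos by simp
  then show ?thesis
    unfolding phi_def signed_trunc_powr_def
    by (intro continuous_intros M_cont lvl_cont) (auto simp: less_imp_neq[symmetric] lvl_pos less_imp_le)
qed

text \<open>Above the level, \<open>s\<close> enters \<open>f2\<close> only through
  \<open>A * \<bar>s\<bar>\<close>, which is constant in the exponent. The terms from the moving
  level, rewritten by the formula for \<open>ln (lvl \<alpha>)\<close>, add up to the derivative of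
  the pure power evaluated at the level. So both branches agree there, and \<open>eta\<close> sees
  only \<open>min \<bar>s\<bar> (lvl \<alpha>)\<close>.\<close>

lemma psi_has_derivative:
  assumes \<alpha>: "2 < \<alpha>" "\<alpha> < b"
  shows "((\<lambda>\<beta>. psi \<beta> s) has_real_derivative eta \<alpha> s) (at \<alpha>)"
proof -
  define f1 where "f1 = (\<lambda>\<beta>. exp (- M \<beta>) * \<bar>s\<bar> powr \<beta>)"
  define f2 where "f2 = (\<lambda>\<beta>. A * lvl \<beta> / \<beta> + A * (\<bar>s\<bar> - lvl \<beta>))"
  have ev: "\<forall>\<^sub>F \<beta> in nhds \<alpha>. \<beta> \<in> {2<..<b}"
    using \<alpha> by (intro eventually_nhds_in_open) auto
  have lvl_powr: "exp (- M \<beta>) * lvl \<beta> powr \<beta> = A * lvl \<beta> / \<beta>" if "1 < \<beta>" for \<beta>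
    using lvl_slope[OF that] lvl_pos[of \<beta>] that powr_add[of "lvl \<beta>" "\<beta> - 1" 1] by (simp add: field_simps)
  have alt1: "psi \<beta> s = f1 \<beta>" if "\<beta> \<in> {2<..<b}" "\<bar>s\<bar> \<le> lvl \<beta>" for \<beta>
    using that by (simp add: psi_eq f1_def min_def)
  have alt2: "psi \<beta> s = f2 \<beta>" if "\<beta> \<in> {2<..<b}" "lvl \<beta> \<le> \<bar>s\<bar>" for \<beta>
    using that lvl_powr[of \<beta>] by (simp add: psi_eq f2_def min_absorb2)
  have d1: "(f1 has_real_derivative exp (- M \<alpha>) * (\<bar>s\<bar> powr \<alpha> * (ln \<bar>s\<bar> - M' \<alpha>))) (at \<alpha>)"
  proof (cases "s = 0")
    case False
    then have eq: "f1 = (\<lambda>\<beta>. exp (\<beta> * ln \<bar>s\<bar> - M \<beta>))"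
      by (auto simp: f1_def powr_def simp flip: exp_add)
    have "exp (\<alpha> * ln \<bar>s\<bar> - M \<alpha>) = exp (- M \<alpha>) * \<bar>s\<bar> powr \<alpha>"
      using False by (simp add: powr_def flip: exp_add)
    then show ?thesis
      unfolding eq using M_der[OF \<alpha>] by (auto intro!: derivative_eq_intros)
  qed (simp add: f1_def)
  define L' where "L' = (M' \<alpha> - 1 / \<alpha> - (ln A + M \<alpha> - ln \<alpha>) / (\<alpha> - 1)) / (\<alpha> - 1)"
  have "((\<lambda>\<beta>. (ln A + M \<beta> - ln \<beta>) / (\<beta> - 1)) has_real_derivative L') (at \<alpha>)"
    using M_der[OF \<alpha>] \<alpha> unfolding L'_def
    by (auto intro!: derivative_eq_intros simp: divide_simps)
  then have dl: "(lvl has_real_derivative lvl \<alpha> * L') (at \<alpha>)"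
    unfolding lvl_def[abs_def] by (rule DERIV_fun_exp)
  have ln_lvl: "ln (lvl \<alpha>) = (ln A + M \<alpha> - ln \<alpha>) / (\<alpha> - 1)" by (simp add: lvl_def)
  have "(f2 has_real_derivative (A * (lvl \<alpha> * L') * \<alpha> - A * lvl \<alpha>) / (\<alpha> * \<alpha>) - A * (lvl \<alpha> * L')) (at \<alpha>)"
    unfolding f2_def using \<alpha> by (auto intro!: derivative_eq_intros dl)
  moreover have "(A * (lvl \<alpha> * L') * \<alpha> - A * lvl \<alpha>) / (\<alpha> * \<alpha>) - A * (lvl \<alpha> * L')
      = exp (- M \<alpha>) * (lvl \<alpha> powr \<alpha> * (ln (lvl \<alpha>) - M' \<alpha>))"
  proof -
    have L: "(\<alpha> - 1) * L' = M' \<alpha> - 1 / \<alpha> - ln (lvl \<alpha>)" using \<alpha> by (simp add: L'_def ln_lvl)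
    have "(A * (lvl \<alpha> * L') * \<alpha> - A * lvl \<alpha>) / (\<alpha> * \<alpha>) - A * (lvl \<alpha> * L')
       = A * lvl \<alpha> / \<alpha> * (- ((\<alpha> - 1) * L') - 1 / \<alpha>)"
      using \<alpha> by (simp add: field_simps)
    also have "\<dots> = A * lvl \<alpha> / \<alpha> * (ln (lvl \<alpha>) - M' \<alpha>)" unfolding L by simp
    finally show ?thesis using lvl_powr[of \<alpha>] \<alpha> by (simp only: mult.assoc[symmetric])
  qed
  ultimately have d2: "(f2 has_real_derivative exp (- M \<alpha>) * (lvl \<alpha> powr \<alpha> * (ln (lvl \<alpha>) - M' \<alpha>))) (at \<alpha>)"
    by simp
  have lc: "(lvl \<longlongrightarrow> lvl \<alpha>) (nhds \<alpha>)"
    using DERIV_isCont[OF dl] by (simp add: isCont_def tendsto_at_iff_tendsto_nhds)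
  consider "\<bar>s\<bar> < lvl \<alpha>" | "lvl \<alpha> < \<bar>s\<bar>" | "\<bar>s\<bar> = lvl \<alpha>" by linarith
  then show ?thesis
  proof cases
    case 1
    have "\<forall>\<^sub>F \<beta> in nhds \<alpha>. psi \<beta> s = f1 \<beta>"
      using ev order_tendstoD(1)[OF lc 1] by eventually_elim (use alt1 in auto)
    from DERIV_cong_ev[OF refl this refl] show ?thesis
      using d1 1 by (simp add: eta_def min_def)
  next
    case 2
    have "\<forall>\<^sub>F \<beta> in nhds \<alpha>. psi \<beta> s = f2 \<beta>"
      using ev order_tendstoD(2)[OF lc 2] by eventually_elim (use alt2 in auto)
    from DERIV_cong_ev[OF refl this refl] show ?thesis
      using d2 2 by (simp add: eta_def min_def)
  next
    case 3
    show ?thesis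
    proof (rule has_real_derivative_alternatives)
      show "(f1 has_real_derivative eta \<alpha> s) (at \<alpha>)" "(f2 has_real_derivative eta \<alpha> s) (at \<alpha>)"
        using d1 d2 3 by (simp_all add: eta_def)
      show "f1 \<alpha> = psi \<alpha> s" "f2 \<alpha> = psi \<alpha> s" using alt1[of \<alpha>] alt2[of \<alpha>] \<alpha> 3 by simp_all
      have "\<forall>\<^sub>F \<beta> in nhds \<alpha>. psi \<beta> s = f1 \<beta> \<or> psi \<beta> s = f2 \<beta>"
        using ev by eventually_elim (use alt1 alt2 linear in blast)
      then show "\<forall>\<^sub>F \<beta> in at \<alpha>. psi \<beta> s = f1 \<beta> \<or> psi \<beta> s = f2 \<beta>"
        by (simp add: eventually_at_filter eventually_mono)
    qed
  qed
qed

text \<open>Mean value estimate in the exponent with \<open>eta\<close> bounded by a multiple of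
  \<open>s\<^sup>2\<close>. The distance \<open>\<delta>\<close> from 2 pays for the logarithm in
  \<open>eta\<close>; the quadratic bound is the majorant that differentiation under the integral
  requires.\<close>

lemma psi_lipschitz_exponent:
  assumes \<delta>: "0 < \<delta>"
  obtains L where "\<And>\<beta> \<alpha> s. 2 + \<delta> < \<beta> \<Longrightarrow> \<beta> < b \<Longrightarrow> 2 + \<delta> < \<alpha> \<Longrightarrow> \<alpha> < b \<Longrightarrow>
    \<bar>psi \<beta> s - psi \<alpha> s\<bar> \<le> L * s\<^sup>2 * \<bar>\<beta> - \<alpha>\<bar>"
proof -
  obtain l1 where l1: "\<And>\<alpha>. \<alpha> \<in> {2..b} \<Longrightarrow> lvl \<alpha> \<le> l1" using lvl_bounds by metis
  have "{2..b} \<noteq> {}" using b by auto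
  then obtain z where z: "\<forall>y\<in>{2..b}. M z \<le> M y"
    using continuous_attains_inf[OF compact_Icc _ M_cont] by blast
  define N where "N = max 1 l1"
  define L where "L = exp (- M z) * ((1 / \<delta> + N powr b) + N powr b * B)"
  have B: "0 \<le> B" using M'_le[of "(2 + b) / 2"] b abs_ge_zero order_trans by fastforce
  have eta: "\<bar>eta \<alpha> s\<bar> \<le> L * s\<^sup>2" if \<alpha>: "2 + \<delta> < \<alpha>" "\<alpha> < b" for \<alpha> s
  proof -
    define w where "w = min \<bar>s\<bar> (lvl \<alpha>)"
    have w: "0 \<le> w" "w \<le> N" "w\<^sup>2 \<le> s\<^sup>2"
      using lvl_pos[of \<alpha>] l1[of \<alpha>] \<alpha> \<delta> by (auto simp: w_def N_def abs_le_square_iff[symmetric])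
    have "w powr \<alpha> \<le> N powr b * w\<^sup>2"
    proof -
      have "w powr \<alpha> \<le> N powr (\<alpha> - 2) * w\<^sup>2" using w \<alpha> \<delta> by (intro powr_le_square) auto
      also have "\<dots> \<le> N powr b * w\<^sup>2"
        using \<alpha> by (intro mult_right_mono powr_mono) (auto simp: N_def)
      finally show ?thesis .
    qed
    moreover have "w powr \<alpha> * \<bar>ln w\<bar> \<le> (1 / \<delta> + N powr b) * w\<^sup>2"
      using w \<alpha> \<delta> by (intro powr_abs_ln_le) (auto simp: N_def)
    moreover have "w powr \<alpha> * \<bar>ln w - M' \<alpha>\<bar> \<le> w powr \<alpha> * \<bar>ln w\<bar> + w powr \<alpha> * B"
      using M'_le[of \<alpha>] \<alpha> \<delta> abs_triangle_ineq4[of "ln w" "M' \<alpha>"]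
      by (simp flip: distrib_left) (intro mult_left_mono, auto)
    ultimately have "w powr \<alpha> * \<bar>ln w - M' \<alpha>\<bar> \<le> (1 / \<delta> + N powr b) * w\<^sup>2 + (N powr b * w\<^sup>2) * B"
      using B mult_right_mono[of "w powr \<alpha>" "N powr b * w\<^sup>2" B] by linarith
    also have "\<dots> = ((1 / \<delta> + N powr b) + N powr b * B) * w\<^sup>2" by (simp add: algebra_simps)
    also have "\<dots> \<le> ((1 / \<delta> + N powr b) + N powr b * B) * s\<^sup>2"
      using w B \<delta> by (intro mult_left_mono) auto
    finally have "exp (- M \<alpha>) * (w powr \<alpha> * \<bar>ln w - M' \<alpha>\<bar>)
       \<le> exp (- M z) * (((1 / \<delta> + N powr b) + N powr b * B) * s\<^sup>2)"
      using z \<alpha> \<delta> B by (intro mult_mono[where c = "w powr \<alpha> * \<bar>ln w - M' \<alpha>\<bar>"]) auto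
    then show ?thesis by (simp add: eta_def w_def[symmetric] L_def abs_mult mult.assoc)
  qed
  show ?thesis
  proof (rule that)
    fix \<beta> \<alpha> s assume "2 + \<delta> < \<beta>" "\<beta> < b" "2 + \<delta> < \<alpha>" "\<alpha> < b"
    then have "norm (psi \<beta> s - psi \<alpha> s) \<le> (L * s\<^sup>2) * norm (\<beta> - \<alpha>)"
      using \<delta> by (intro field_differentiable_bound[of "{2 + \<delta><..<b}" _ "\<lambda>\<alpha>. eta \<alpha> s"])
        (auto intro!: eta psi_has_derivative[THEN has_field_derivative_at_within])
    then show "\<bar>psi \<beta> s - psi \<alpha> s\<bar> \<le> L * s\<^sup>2 * \<bar>\<beta> - \<alpha>\<bar>" by simp
  qed
qed

end

section \<open>Propagation of the bound\<close>

text \<open>One run over the exponents from 2 to a fixed \<open>b\<close> along the times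
  \<open>\<theta> \<alpha>\<close>. The exempted exponent \<open>p\<close> is where two branches of
  the clock are joined. The summand 1 in \<open>n\<close> covers the replacement of \<open>C\<close>
  by a continuous function; the factor 4 in \<open>start\<close> is the room in which
  \<open>H\<close> may grow without reaching 1.\<close>

proposition levy_curve_excess_le:
  fixes J :: "real ^ 'n \<Rightarrow> real ^ 'n \<Rightarrow> real" and \<theta> C D :: "real \<Rightarrow> real"
  assumes J: "levy_kernel J" and curve: "levy_curve J u v" and b: "2 < b"
    and \<theta>_cont: "continuous_on {2..b} \<theta>" and \<theta>_inj: "inj_on \<theta> {2..b}"
    and \<theta>_pos: "\<And>\<alpha>. \<alpha> \<in> {2..b} \<Longrightarrow> 0 < \<theta> \<alpha>"
    and \<theta>_der: "\<And>\<alpha>. 2 < \<alpha> \<Longrightarrow> \<alpha> < b \<Longrightarrow> \<alpha> \<noteq> p \<Longrightarrow> (\<theta> has_real_derivative D \<alpha> / \<alpha>\<^sup>2) (at \<alpha>)"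
    and D_pos: "\<And>\<alpha>. 2 < \<alpha> \<Longrightarrow> \<alpha> < b \<Longrightarrow> 0 < D \<alpha>"
    and ls: "\<And>\<alpha>. 2 < \<alpha> \<Longrightarrow> \<alpha> < b \<Longrightarrow> \<exists>R\<ge>\<alpha>. log_sobolev J R (C \<alpha>) (D \<alpha>)"
    and C_int: "set_integrable lebesgue {2..b} C"
    and C_sq_int: "set_integrable lebesgue {2..b} (\<lambda>\<alpha>. C \<alpha> / \<alpha>\<^sup>2)"
    and C_le: "(LINT \<alpha>:{2..b}|lebesgue. C \<alpha> / \<alpha>\<^sup>2) \<le> c"
    and k: "0 < k" and start: "4 * (LINT x|lebesgue. (u (\<theta> 2) x)\<^sup>2) \<le> k\<^sup>2"
  defines "n \<equiv> exp (b / (b - 1) * (ln k + c + 1))"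
  shows "integrable lebesgue (\<lambda>x. max 0 (\<bar>u (\<theta> b) x\<bar> - n))"
    and "b * (LINT x|lebesgue. max 0 (\<bar>u (\<theta> b) x\<bar> - n)) \<le> 1"
proof -
  note um = levy_curveD(1)[OF curve] and ui = levy_curveD(2)[OF curve] and uc = levy_curveD(3)[OF curve]
    and us = levy_curveD(4)[OF curve] and vm = levy_curveD(5)[OF curve] and vi = levy_curveD(6)[OF curve]
    and ud = levy_curveD(7)[OF curve] and uf = levy_curveD(8)[OF curve]
  \<comment> \<open>An error of 1/4 on top of \<open>H 2 \<le> 1 / 4\<close> leaves
    \<open>H \<le> 1 / 2\<close>, strictly below the threshold 1.\<close>
  obtain g where g: "continuous_on UNIV g" "set_integrable lebesgue {2..b} g"
    "(LINT \<alpha>:{2..b}|lebesgue. \<bar>C \<alpha> - g \<alpha>\<bar>) \<le> 1 / 4"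
    by (rule set_integrable_approx_continuous[OF C_int, of "1 / 4"]) auto
  have g_cont: "continuous_on S g" for S using g(1) by (rule continuous_on_subset) auto
  have diff_int: "set_integrable lebesgue {2..b} (\<lambda>\<alpha>. \<bar>C \<alpha> - g \<alpha>\<bar>)"
    using C_int g(2) by (intro set_integrable_abs set_integral_diff) auto
  have gs_cont: "continuous_on {2..b} (\<lambda>\<alpha>. g \<alpha> / \<alpha>\<^sup>2)" by (intro continuous_intros g_cont) auto
  \<comment> \<open>\<open>\<kappa>\<close> is \<open>ln K\<close>, and \<open>M\<close>, defined
    below as \<open>\<alpha> * \<kappa> \<alpha>\<close>, is \<open>ln m\<close>. Continuity of
    \<open>g\<close> makes \<open>\<kappa>\<close> differentiable at every exponent.\<close>
  define \<kappa> where "\<kappa> = (\<lambda>\<alpha>. ln k + integral {2..\<alpha>} (\<lambda>\<alpha>. g \<alpha> / \<alpha>\<^sup>2))"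
  have \<kappa>_within: "(\<kappa> has_real_derivative g \<alpha> / \<alpha>\<^sup>2) (at \<alpha> within {2..b})" if "\<alpha> \<in> {2..b}" for \<alpha>
    unfolding \<kappa>_def using integral_has_real_derivative[OF gs_cont that] by (auto intro!: derivative_eq_intros)
  have \<kappa>_cont: "continuous_on {2..b} \<kappa>"
    using \<kappa>_within DERIV_continuous continuous_on_eq_continuous_within by blast
  define M where "M = (\<lambda>\<alpha>. \<alpha> * \<kappa> \<alpha>)"
  define M' where "M' = (\<lambda>\<alpha>. \<kappa> \<alpha> + g \<alpha> / \<alpha>)"
  have M'_cont: "continuous_on {2..b} M'"
    unfolding M'_def by (intro continuous_intros \<kappa>_cont g_cont) auto
  then obtain B where B: "\<forall>\<alpha>\<in>{2..b}. \<bar>M' \<alpha>\<bar> \<le> B"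
    using compact_imp_bounded[OF compact_continuous_image[OF M'_cont compact_Icc]]
    by (auto simp: bounded_iff)
  \<comment> \<open>The slope is \<open>A = b\<close>: then \<open>ln A\<close> and
    \<open>ln b\<close> cancel in \<open>lvl b\<close>, and the factor \<open>b\<close> stands
    before the excess.\<close>
  interpret trunc_power_flow b b B M M'
  proof
    show "continuous_on {2..b} M" unfolding M_def by (intro continuous_intros \<kappa>_cont)
    fix \<alpha> assume \<alpha>: "2 < \<alpha>" "\<alpha> < b"
    have "(\<kappa> has_real_derivative g \<alpha> / \<alpha>\<^sup>2) (at \<alpha>)"
      using \<kappa>_within[of \<alpha>] \<alpha> by (simp add: at_within_Icc_at)
    then show "(M has_real_derivative M' \<alpha>) (at \<alpha>)"
      unfolding M_def M'_def using \<alpha> by (auto intro!: derivative_eq_intros simp: power2_eq_square)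
  qed (use b B in auto)
  obtain K where qf: "quadratic_family {2..b} K psi phi" using quadratic_family .
  define U where "U = (\<lambda>\<alpha>. u (\<theta> \<alpha>))"
  define H where "H = (\<lambda>\<alpha>. LINT x|lebesgue. psi \<alpha> (U \<alpha> x))"
  have Um: "U \<alpha> \<in> borel_measurable lebesgue" and Ui: "integrable lebesgue (\<lambda>x. (U \<alpha> x)\<^sup>2)"
    if "\<alpha> \<in> {2..b}" for \<alpha>
    using um ui \<theta>_pos[OF that] by (auto simp: U_def)
  have psi_int: "integrable lebesgue (\<lambda>x. psi \<alpha> (U \<alpha> x))" if "\<alpha> \<in> {2..b}" for \<alpha>
    using quadratic_family_integrable[OF qf that Um[OF that] Ui[OF that]] .
  have H_cont: "continuous_on {2..b} H"
    unfolding continuous_on_def H_def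
  proof
    fix \<alpha> assume \<alpha>: "\<alpha> \<in> {2..b}"
    have "filterlim \<theta> (at (\<theta> \<alpha>) within {0..}) (at \<alpha> within {2..b})"
      using \<theta>_cont \<theta>_pos \<theta>_inj \<alpha>
      by (auto simp: filterlim_at continuous_on_def eventually_at_filter inj_on_def less_imp_le intro!: always_eventually)
    from filterlim_compose[OF uc this]
    have "((\<lambda>\<beta>. LINT x|lebesgue. (U \<beta> x - U \<alpha> x)\<^sup>2) \<longlongrightarrow> 0) (at \<alpha> within {2..b})"
      using \<theta>_pos[OF \<alpha>] by (simp add: U_def)
    then show "((\<lambda>\<beta>. LINT x|lebesgue. psi \<beta> (U \<beta> x)) \<longlongrightarrow> (LINT x|lebesgue. psi \<alpha> (U \<alpha> x))) (at \<alpha> within {2..b})"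
      using psi_cont \<alpha> by (intro integral_quadratic_family_continuous[OF qf] Um Ui) (auto simp: continuous_on_def)
  qed
  define H' where "H' = (\<lambda>\<alpha>. (LINT x|lebesgue. phi \<alpha> (U \<alpha> x) * (D \<alpha> / \<alpha>\<^sup>2 * v (\<theta> \<alpha>) x))
      + (LINT x|lebesgue. eta \<alpha> (U \<alpha> x)))"
  have H_der: "(H has_real_derivative H' \<alpha>) (at \<alpha>)" if \<alpha>: "2 < \<alpha>" "\<alpha> < b" "\<alpha> \<noteq> p" for \<alpha>
  proof -
    define \<delta> where "\<delta> = (\<alpha> - 2) / 2"
    have \<delta>: "0 < \<delta>" "2 + \<delta> < \<alpha>" using \<alpha> by (auto simp: \<delta>_def field_simps)
    obtain L where L: "\<And>\<beta> \<alpha> s. 2 + \<delta> < \<beta> \<Longrightarrow> \<beta> < b \<Longrightarrow> 2 + \<delta> < \<alpha> \<Longrightarrow> \<alpha> < b \<Longrightarrow>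
      \<bar>psi \<beta> s - psi \<alpha> s\<bar> \<le> L * s\<^sup>2 * \<bar>\<beta> - \<alpha>\<bar>"
      using psi_lipschitz_exponent[OF \<delta>(1)] by blast
    have \<theta>\<alpha>: "0 < \<theta> \<alpha>" using \<theta>_pos \<alpha> by auto
    have S: "{2 + \<delta><..<b} \<subseteq> {2..b}" using \<delta> by auto
    show ?thesis
      unfolding H_def H'_def
    proof (rule integral_quadratic_family_has_derivative[OF quadratic_family_subset[OF qf S]])
      show "open {2 + \<delta><..<b}" by simp
      show "\<alpha> \<in> {2 + \<delta><..<b}" using \<alpha> \<delta> by simp
      show "U \<beta> \<in> borel_measurable lebesgue" "integrable lebesgue (\<lambda>x. (U \<beta> x)\<^sup>2)" if "\<beta> \<in> {2 + \<delta><..<b}" for \<beta>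
        using Um Ui that S by auto
      show "(\<lambda>x. D \<alpha> / \<alpha>\<^sup>2 * v (\<theta> \<alpha>) x) \<in> borel_measurable lebesgue" using vm[OF \<theta>\<alpha>] by simp
      show "integrable lebesgue (\<lambda>x. (D \<alpha> / \<alpha>\<^sup>2 * v (\<theta> \<alpha>) x)\<^sup>2)"
        using vi[OF \<theta>\<alpha>] by (simp add: power_mult_distrib power_divide)
      show "((\<lambda>\<beta>. LINT x|lebesgue. ((U \<beta> x - U \<alpha> x) / (\<beta> - \<alpha>) - D \<alpha> / \<alpha>\<^sup>2 * v (\<theta> \<alpha>) x)\<^sup>2) \<longlongrightarrow> 0) (at \<alpha>)"
        unfolding U_def
      proof (rule L2_derivative_compose[where S = "{2<..<b}"])
        show "\<theta> \<beta> \<noteq> \<theta> \<alpha>" if "\<beta> \<in> {2<..<b}" "\<beta> \<noteq> \<alpha>" for \<beta>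
          using \<theta>_inj that \<alpha> by (auto simp: inj_on_def)
      qed (use \<alpha> Um Ui vm[OF \<theta>\<alpha>] vi[OF \<theta>\<alpha>] ud[OF \<theta>\<alpha>] \<theta>_der in \<open>auto simp: U_def\<close>)
      show "((\<lambda>\<beta>. phi \<beta> s) \<longlongrightarrow> phi \<alpha> s) (at \<alpha>)" for s
      proof -
        have "((\<lambda>\<beta>. phi \<beta> s) \<longlongrightarrow> phi \<alpha> s) (at \<alpha> within {2..b})"
          using phi_cont[of s] \<alpha> by (simp add: continuous_on_def)
        then show ?thesis using \<alpha> by (simp add: at_within_Icc_at)
      qed
      show "((\<lambda>\<beta>. psi \<beta> s) has_real_derivative eta \<alpha> s) (at \<alpha>)" for s
        using psi_has_derivative \<alpha> by simp
      show "\<bar>psi \<beta> s - psi \<alpha> s\<bar> \<le> L * s\<^sup>2 * \<bar>\<beta> - \<alpha>\<bar>" if "\<beta> \<in> {2 + \<delta><..<b}" for \<beta> s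
        using L that \<alpha> \<delta> by auto
      show "eta \<alpha> \<in> borel_measurable borel" unfolding eta_def[abs_def] by measurable
    qed
  qed
  \<comment> \<open>The clock is chosen so that the form term of the entropy inequality cancels the
    one from the time derivative. Since the linear part of \<open>psi\<close> is nonnegative,
    \<open>H \<alpha> \<le> 1\<close> forces \<open>G \<le> exp (M \<alpha>)\<close>, which makes
    \<open>G * (ln G - M \<alpha>)\<close> nonpositive; only the approximation error of
    \<open>C\<close> remains.\<close>
  have H'_le: "H' \<alpha> \<le> \<bar>C \<alpha> - g \<alpha>\<bar>" if \<alpha>: "2 < \<alpha>" "\<alpha> < b" and "H \<alpha> \<le> 1" for \<alpha>
  proof -
    have \<alpha>b: "\<alpha> \<in> {2..b}" and \<theta>\<alpha>: "0 < \<theta> \<alpha>" using \<theta>_pos \<alpha> by auto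
    obtain R where R: "\<alpha> \<le> R" "log_sobolev J R (C \<alpha>) (D \<alpha>)" using ls[OF \<alpha>] by blast
    let ?l = "lvl \<alpha>"
    define w where "w = (\<lambda>x. min \<bar>U \<alpha> x\<bar> ?l)"
    define G I e E where "G = (LINT x|lebesgue. w x powr \<alpha>)"
      and "I = (LINT x|lebesgue. w x powr \<alpha> * ln (w x))"
      and "e = - (LINT x|lebesgue. signed_trunc_powr ?l (\<alpha> - 1) (U \<alpha> x) * v (\<theta> \<alpha>) x)"
      and "E = exp (- M \<alpha>)"
    have Us: "U \<alpha> \<in> levy_space J" using us[OF \<theta>\<alpha>] by (simp add: U_def)
    have "(\<lambda>x. signed_trunc_powr ?l (\<alpha> - 1) (U \<alpha> x)) \<in> levy_space J"
      by (rule levy_space_lipschitz[OF J Us signed_trunc_powr_measurable _ signed_trunc_powr_lipschitz])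
        (use \<alpha> lvl_pos in \<open>auto simp: signed_trunc_powr_def\<close>)
    then have "levy_form J (U \<alpha>) (\<lambda>x. signed_trunc_powr ?l (\<alpha> - 1) (U \<alpha> x)) = ereal e"
      using uf[OF \<theta>\<alpha>] by (simp add: U_def e_def)
    note ent = trunc_entropy_le[OF J R(2) D_pos[OF \<alpha>] Us lvl_pos \<alpha>(1) R(1) this]
    have wi: "integrable lebesgue (\<lambda>x. w x powr \<alpha>)" "integrable lebesgue (\<lambda>x. w x powr \<alpha> * ln (w x))"
      using ent(1,2) by (simp_all add: w_def)
    have ent3: "\<alpha> * I - G * ln G \<le> C \<alpha> * G + D \<alpha> * e"
      using ent(3) by (simp add: w_def I_def G_def)
    have "(LINT x|lebesgue. phi \<alpha> (U \<alpha> x) * (D \<alpha> / \<alpha>\<^sup>2 * v (\<theta> \<alpha>) x))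
        = (LINT x|lebesgue. (E * \<alpha> * (D \<alpha> / \<alpha>\<^sup>2)) * (signed_trunc_powr ?l (\<alpha> - 1) (U \<alpha> x) * v (\<theta> \<alpha>) x))"
      by (rule Bochner_Integration.integral_cong) (auto simp: phi_def E_def)
    also have "\<dots> = - (E * D \<alpha> * e / \<alpha>)"
      using \<alpha> by (simp add: e_def power2_eq_square)
    finally have p1: "(LINT x|lebesgue. phi \<alpha> (U \<alpha> x) * (D \<alpha> / \<alpha>\<^sup>2 * v (\<theta> \<alpha>) x)) = - (E * D \<alpha> * e / \<alpha>)" .
    have "(LINT x|lebesgue. eta \<alpha> (U \<alpha> x)) = (LINT x|lebesgue. E * (w x powr \<alpha> * ln (w x) - w x powr \<alpha> * M' \<alpha>))"
      by (rule Bochner_Integration.integral_cong) (auto simp: eta_def w_def E_def right_diff_distrib)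
    also have "\<dots> = E * (I - G * M' \<alpha>)" using wi by (simp add: I_def G_def)
    finally have p2: "(LINT x|lebesgue. eta \<alpha> (U \<alpha> x)) = E * (I - G * M' \<alpha>)" .
    have H'_eq: "H' \<alpha> = E * (I - G * M' \<alpha> - D \<alpha> * e / \<alpha>)"
      unfolding H'_def p1 p2 by (simp add: right_diff_distrib)
    have "E * G = (LINT x|lebesgue. E * w x powr \<alpha>)" by (simp add: G_def)
    also have "\<dots> \<le> H \<alpha>"
      unfolding H_def using \<alpha> wi psi_int[OF \<alpha>b] b
      by (intro integral_mono) (auto simp: psi_eq w_def E_def)
    finally have EG: "E * G \<le> 1" using \<open>H \<alpha> \<le> 1\<close> by simp
    \<comment> \<open>\<open>\<alpha> * M' \<alpha> = M \<alpha> + g \<alpha>\<close>: here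
      \<open>g\<close> offsets \<open>C\<close> up to their difference.\<close>
    have "\<alpha> * (I - G * M' \<alpha> - D \<alpha> * e / \<alpha>) = (\<alpha> * I - D \<alpha> * e) - G * (M \<alpha> + g \<alpha>)"
      using \<alpha> by (simp add: M_def M'_def right_diff_distrib algebra_simps)
    also have "\<dots> \<le> (C \<alpha> * G + G * ln G) - G * (M \<alpha> + g \<alpha>)" using ent3 by simp
    also have "\<dots> = G * (ln G - M \<alpha> + (C \<alpha> - g \<alpha>))" by (simp add: algebra_simps)
    also have "\<dots> \<le> G * \<bar>C \<alpha> - g \<alpha>\<bar>"
    proof (cases "G = 0")
      case False
      have "0 \<le> G" by (simp add: G_def)
      then have G: "0 < G" using False by simp
      have "G \<le> exp (M \<alpha>)" using EG by (simp add: E_def exp_minus field_simps)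
      then have "ln G \<le> ln (exp (M \<alpha>))" using G by (subst ln_le_cancel_iff) auto
      then have "ln G \<le> M \<alpha>" by simp
      then show ?thesis using G by (intro mult_left_mono) auto
    qed simp
    finally have "I - G * M' \<alpha> - D \<alpha> * e / \<alpha> \<le> G * \<bar>C \<alpha> - g \<alpha>\<bar> / \<alpha>"
      using \<alpha> by (simp add: pos_le_divide_eq mult.commute)
    then have "H' \<alpha> \<le> E * (G * \<bar>C \<alpha> - g \<alpha>\<bar> / \<alpha>)"
      unfolding H'_eq by (intro mult_left_mono) (auto simp: E_def)
    also have "\<dots> = (E * G / \<alpha>) * \<bar>C \<alpha> - g \<alpha>\<bar>" by simp
    also have "\<dots> \<le> 1 * \<bar>C \<alpha> - g \<alpha>\<bar>"
    proof (intro mult_right_mono)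
      show "E * G / \<alpha> \<le> 1" using EG \<alpha> by (simp add: field_simps)
    qed simp
    finally show ?thesis by simp
  qed
  \<comment> \<open>\<open>M 2 = 2 * ln k\<close>, and at exponent 2 the linear continuation lies
    below the parabola, so \<open>H 2\<close> is at most the squared L^2 norm divided by
    \<open>k\<^sup>2\<close>.\<close>
  have H_2: "H 2 \<le> 1 / 4"
  proof -
    have e2: "exp (- M 2) = 1 / k\<^sup>2"
      using k by (simp add: M_def \<kappa>_def exp_minus inverse_eq_divide exp_double)
    have "psi 2 s \<le> exp (- M 2) * s\<^sup>2" for s
    proof -
      have "(min \<bar>s\<bar> l)\<^sup>2 + 2 * l * max 0 (\<bar>s\<bar> - l) \<le> s\<^sup>2" if "0 < l" for l
      proof (cases "\<bar>s\<bar> \<le> l")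
        case False
        have "0 \<le> (\<bar>s\<bar> - l)\<^sup>2" by simp
        then show ?thesis using False by (simp add: power2_eq_square algebra_simps)
      qed (simp add: min_def)
      from mult_left_mono[OF this[OF lvl_pos], of "exp (- M 2)" 2] show ?thesis
        using lvl_pos[of 2] by (simp add: psi_def trunc_pow_def algebra_simps)
    qed
    then have "H 2 \<le> (LINT x|lebesgue. exp (- M 2) * (U 2 x)\<^sup>2)"
      unfolding H_def using psi_int[of 2] Ui[of 2] b by (intro integral_mono) auto
    also have "\<dots> = (LINT x|lebesgue. (U 2 x)\<^sup>2) / k\<^sup>2" by (simp add: e2)
    also have "\<dots> \<le> 1 / 4" using start k by (simp add: U_def field_simps)
    finally show ?thesis .
  qed
  \<comment> \<open>The bound on \<open>H'\<close> is available only where \<open>H \<le> 1\<close>.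
    Assuming this before \<open>a\<close>, integration returns the stronger bound 1/2 at
    \<open>a\<close>.\<close>
  have step: "H a \<le> 1 / 2" if a: "a \<in> {2..b}" and le: "\<And>\<alpha>. 2 < \<alpha> \<Longrightarrow> \<alpha> < a \<Longrightarrow> H \<alpha> \<le> 1" for a
  proof -
    define h where "h = (\<lambda>\<alpha>. if 2 < \<alpha> \<and> \<alpha> < a \<and> \<alpha> \<noteq> p then H' \<alpha> else 0)"
    have h: "(h has_integral (H a - H 2)) {2..a}"
    \<comment> \<open>The set \<open>{p}\<close> holds the one interior point at which
      \<open>H\<close> is not shown to be differentiable; continuity suffices there.\<close>
    proof (rule fundamental_theorem_of_calculus_interior_strong[of "{p}"])
      show "continuous_on {2..a} H" using H_cont a by (auto elim: continuous_on_subset)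
      fix \<alpha> assume \<alpha>: "\<alpha> \<in> {2<..<a} - {p}"
      then show "(H has_vector_derivative h \<alpha>) (at \<alpha>)"
        using H_der[of \<alpha>] a by (simp add: h_def has_real_derivative_iff_has_vector_derivative)
    qed (use a in auto)
    have sub: "set_integrable lebesgue {2..a} (\<lambda>\<alpha>. \<bar>C \<alpha> - g \<alpha>\<bar>)"
      by (rule set_integrable_subset[OF diff_int]) (use a in auto)
    have "H a - H 2 \<le> (LINT \<alpha>:{2..a}|lebesgue. \<bar>C \<alpha> - g \<alpha>\<bar>)"
      by (rule has_integral_le[OF h has_integral_set_lebesgue[OF sub]])
        (use H'_le le a in \<open>auto simp: h_def\<close>)
    also have "\<dots> \<le> (LINT \<alpha>:{2..b}|lebesgue. \<bar>C \<alpha> - g \<alpha>\<bar>)"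
      using sub diff_int a unfolding set_lebesgue_integral_def set_integrable_def
      by (intro integral_mono) (auto simp: indicator_def)
    finally show ?thesis using g(3) H_2 by simp
  qed
  \<comment> \<open>First exit: at the least exponent with \<open>H \<ge> 1\<close> the hypothesis
    of \<open>step\<close> holds, and its conclusion contradicts \<open>H \<ge> 1\<close>.\<close>
  have H_lt: "H \<alpha> < 1" if "\<alpha> \<in> {2..b}" for \<alpha>
  proof (rule ccontr)
    define Z where "Z = {2..b} \<inter> H -` {1..}"
    assume "\<not> H \<alpha> < 1"
    then have ne: "Z \<noteq> {}" using that by (auto simp: Z_def)
    have "closed Z" unfolding Z_def using H_cont by (intro continuous_closed_preimage) auto
    moreover have "bdd_below Z" by (auto simp: Z_def intro: bdd_belowI[of _ 2])
    ultimately have Inf: "Inf Z \<in> Z" using ne by (intro closed_contains_Inf) auto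
    have "H (Inf Z) \<le> 1 / 2"
    proof (rule step)
      show "H \<beta> \<le> 1" if "2 < \<beta>" "\<beta> < Inf Z" for \<beta>
      proof (rule ccontr)
        assume "\<not> H \<beta> \<le> 1"
        then have "\<beta> \<in> Z" using that Inf by (auto simp: Z_def)
        then show False using cInf_lower[OF _ \<open>bdd_below Z\<close>] that by force
      qed
    qed (use Inf in \<open>auto simp: Z_def\<close>)
    then show False using Inf by (auto simp: Z_def)
  qed
  have "\<kappa> b \<le> ln k + c + 1"
  proof -
    have g_sq: "set_integrable lebesgue {2..b} (\<lambda>\<alpha>. g \<alpha> / \<alpha>\<^sup>2)"
      unfolding absolutely_integrable_on_def[symmetric]
      by (rule absolutely_integrable_continuous_real[OF gs_cont])
    have "integral {2..b} (\<lambda>\<alpha>. g \<alpha> / \<alpha>\<^sup>2) = (LINT \<alpha>:{2..b}|lebesgue. g \<alpha> / \<alpha>\<^sup>2)"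
      using has_integral_set_lebesgue[OF g_sq] by (rule integral_unique)
    also have "\<dots> \<le> (LINT \<alpha>:{2..b}|lebesgue. C \<alpha> / \<alpha>\<^sup>2 + \<bar>C \<alpha> - g \<alpha>\<bar>)"
    proof (rule set_integral_mono[OF g_sq])
      show "set_integrable lebesgue {2..b} (\<lambda>\<alpha>. C \<alpha> / \<alpha>\<^sup>2 + \<bar>C \<alpha> - g \<alpha>\<bar>)"
        using C_sq_int diff_int by (rule set_integral_add)
      fix \<alpha> assume "\<alpha> \<in> {2..b}"
      then have "1 \<le> \<alpha>\<^sup>2" by (simp add: one_le_power)
      then have "(g \<alpha> - C \<alpha>) / \<alpha>\<^sup>2 \<le> \<bar>C \<alpha> - g \<alpha>\<bar> / 1" by (intro frac_le) auto
      then show "g \<alpha> / \<alpha>\<^sup>2 \<le> C \<alpha> / \<alpha>\<^sup>2 + \<bar>C \<alpha> - g \<alpha>\<bar>" by (simp add: diff_divide_distrib)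
    qed
    also have "\<dots> \<le> c + 1"
      using C_le g(3) C_sq_int diff_int by (simp add: set_integral_add)
    finally show ?thesis by (simp add: \<kappa>_def)
  qed
  then have "b / (b - 1) * \<kappa> b \<le> b / (b - 1) * (ln k + c + 1)" using b by (intro mult_left_mono) auto
  moreover have "lvl b = exp (b / (b - 1) * \<kappa> b)" unfolding lvl_def by (simp add: M_def)
  ultimately have lvl_le: "lvl b \<le> n" unfolding n_def by simp
  have bb: "b \<in> {2..b}" using b by simp
  have excess: "b * max 0 (\<bar>U b x\<bar> - n) \<le> psi b (U b x)" for x
  proof -
    have "b * max 0 (\<bar>U b x\<bar> - n) \<le> b * max 0 (\<bar>U b x\<bar> - lvl b)"
      using lvl_le b by (intro mult_left_mono) auto
    then show ?thesis using b psi_eq[of b "U b x"] by (simp add: add_increasing)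
  qed
  have int: "integrable lebesgue (\<lambda>x. b * max 0 (\<bar>U b x\<bar> - n))"
  proof (rule Bochner_Integration.integrable_bound[OF psi_int[OF bb]])
    show "(\<lambda>x. b * max 0 (\<bar>U b x\<bar> - n)) \<in> borel_measurable lebesgue"
      using Um[OF bb] by measurable
    show "AE x in lebesgue. norm (b * max 0 (\<bar>U b x\<bar> - n)) \<le> norm (psi b (U b x))"
      using excess b by (intro AE_I2) (simp add: order_trans[OF _ abs_ge_self])
  qed
  then show "integrable lebesgue (\<lambda>x. max 0 (\<bar>u (\<theta> b) x\<bar> - n))" using b by (simp add: U_def)
  have "(LINT x|lebesgue. b * max 0 (\<bar>U b x\<bar> - n)) \<le> H b"
    unfolding H_def using int psi_int[OF bb] excess by (intro integral_mono) auto
  then show "b * (LINT x|lebesgue. max 0 (\<bar>u (\<theta> b) x\<bar> - n)) \<le> 1"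
    using H_lt[OF bb] by (simp add: U_def)
qed

section \<open>The time change\<close>

text \<open>\<open>\<sigma>\<close> is the inverse of \<open>q\<close>, that is, time as a function
  of the exponent. By unboundedness and the intermediate value theorem \<open>q\<close> reaches
  every exponent from \<open>p\<close> on, even if its interval of existence is bounded.\<close>

lemma exponent_ode_inverse:
  assumes ode: "exponent_ode_solvable D p" and p: "0 < p" and D: "\<And>r. p \<le> r \<Longrightarrow> 0 < D r"
  obtains \<sigma> :: "real \<Rightarrow> real" where "\<sigma> p = 0" "strict_mono_on {p..} \<sigma>"
    "\<And>b. continuous_on {p..b} \<sigma>"
    "\<And>\<alpha>. p < \<alpha> \<Longrightarrow> (\<sigma> has_real_derivative D \<alpha> / \<alpha>\<^sup>2) (at \<alpha>)"
proof -
  obtain T :: ereal and I q where T: "0 < T" and I: "I = {t. 0 \<le> t \<and> ereal t < T}" and q0: "q 0 = p"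
    and qd: "\<And>t. t \<in> I \<Longrightarrow> (q has_real_derivative (q t)\<^sup>2 / D (q t)) (at t within I)"
    and qm: "strict_mono_on I q" and qinf: "\<And>K. \<exists>t\<in>I. K < q t"
    using ode unfolding exponent_ode_solvable_def by blast
  have I0: "0 \<in> I" using T by (simp add: I zero_ereal_def[symmetric])
  have I_Icc: "{0..t} \<subseteq> I" if "t \<in> I" for t
    using that by (auto simp: I) (meson ereal_less_eq(3) le_less_trans)
  have qc: "continuous_on I q"
    using qd DERIV_continuous continuous_on_eq_continuous_within by blast
  have q_less_iff: "q s < q t \<longleftrightarrow> s < t" if "s \<in> I" "t \<in> I" for s t
    using strict_mono_on_less[OF qm that] .
  have inj: "inj_on q I" using qm by (rule strict_mono_on_imp_inj_on)
  have im: "\<alpha> \<in> q ` I" if "p \<le> \<alpha>" for \<alpha>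
  proof -
    obtain t where t: "t \<in> I" "\<alpha> < q t" using qinf by blast
    have "\<exists>s\<ge>0. s \<le> t \<and> q s = \<alpha>"
      using t that q0 by (intro IVT' continuous_on_subset[OF qc] I_Icc) (auto simp: I)
    then show ?thesis using I_Icc[OF t(1)] by auto
  qed
  define \<sigma> where "\<sigma> = the_inv_into I q"
  have \<sigma>: "\<sigma> \<alpha> \<in> I" "q (\<sigma> \<alpha>) = \<alpha>" if "p \<le> \<alpha>" for \<alpha>
    using im[OF that] the_inv_into_into[OF inj _ order_refl] f_the_inv_into_f[OF inj] by (auto simp: \<sigma>_def)
  have \<sigma>q: "\<sigma> (q t) = t" if "t \<in> I" for t
    using that by (simp add: \<sigma>_def the_inv_into_f_f[OF inj])
  have mono: "strict_mono_on {p..} \<sigma>"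
  proof (rule strict_mono_onI)
    fix x y assume "x \<in> {p..}" "y \<in> {p..}" "x < y"
    then show "\<sigma> x < \<sigma> y" using q_less_iff[OF \<sigma>(1) \<sigma>(1), of x y] by (simp add: \<sigma>)
  qed
  have \<sigma>p: "\<sigma> p = 0" using \<sigma>q[OF I0] q0 by simp
  have cont: "continuous_on {p..b} \<sigma>" for b
  proof (cases "p \<le> b")
    case True
    have sub: "{0..\<sigma> b} \<subseteq> I" using I_Icc \<sigma>(1)[OF True] by auto
    have "continuous_on (q ` {0..\<sigma> b}) \<sigma>"
      using sub \<sigma>q by (intro continuous_on_inv continuous_on_subset[OF qc]) auto
    moreover have "{p..b} \<subseteq> q ` {0..\<sigma> b}"
    proof
      fix \<alpha> assume \<alpha>: "\<alpha> \<in> {p..b}"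
      then have "\<not> \<sigma> \<alpha> > \<sigma> b" using q_less_iff[OF \<sigma>(1)[OF True] \<sigma>(1)[of \<alpha>]] \<sigma>(2)[of \<alpha>] \<sigma>(2)[OF True] by auto
      moreover have "0 \<le> \<sigma> \<alpha>" using \<sigma>(1)[of \<alpha>] \<alpha> by (simp add: I)
      ultimately show "\<alpha> \<in> q ` {0..\<sigma> b}" using \<sigma>(2)[of \<alpha>] \<alpha> by (intro image_eqI[of _ _ "\<sigma> \<alpha>"]) auto
    qed
    ultimately show ?thesis by (rule continuous_on_subset)
  qed simp
  have der: "(\<sigma> has_real_derivative D \<alpha> / \<alpha>\<^sup>2) (at \<alpha>)" if \<alpha>: "p < \<alpha>" for \<alpha>
  proof -
    \<comment> \<open>Beyond \<open>p\<close> the time \<open>\<sigma> \<alpha>\<close> is interior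
      to \<open>I\<close>, which turns the derivative within \<open>I\<close> into a two-sided one,
      as the inverse function rule requires.\<close>
    have s0: "0 < \<sigma> \<alpha>" using strict_mono_onD[OF mono, of p \<alpha>] \<alpha> \<sigma>p by simp
    have s1: "\<sigma> \<alpha> < \<sigma> (\<alpha> + 1)" using strict_mono_onD[OF mono, of \<alpha> "\<alpha> + 1"] \<alpha> by simp
    have "{0..\<sigma> (\<alpha> + 1)} \<subseteq> I" using \<alpha> by (intro I_Icc \<sigma>(1)) simp
    then have "{0<..<\<sigma> (\<alpha> + 1)} \<subseteq> I" using greaterThanLessThan_subseteq_atLeastAtMost_iff by blast
    from interiorI[OF open_greaterThanLessThan _ this, of "\<sigma> \<alpha>"] have "\<sigma> \<alpha> \<in> interior I"
      using s0 s1 by simp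
    then have "at (\<sigma> \<alpha>) within I = at (\<sigma> \<alpha>)" by (rule at_within_interior)
    then have "(q has_real_derivative \<alpha>\<^sup>2 / D \<alpha>) (at (\<sigma> \<alpha>))"
      using qd[OF \<sigma>(1)[OF less_imp_le[OF \<alpha>]]] unfolding \<sigma>(2)[OF less_imp_le[OF \<alpha>]] by metis
    then have "(\<sigma> has_real_derivative inverse (\<alpha>\<^sup>2 / D \<alpha>)) (at \<alpha>)"
    proof (rule DERIV_inverse_function[where a = p and b = "\<alpha> + 1"])
      show "\<alpha>\<^sup>2 / D \<alpha> \<noteq> 0" using \<alpha> p D[of \<alpha>] by auto
      show "q (\<sigma> y) = y" if "p < y" for y using \<sigma>(2) that by simp
      show "isCont \<sigma> \<alpha>" using cont[of "\<alpha> + 1"] \<alpha> by (intro continuous_on_interior[of "{p..\<alpha> + 1}"]) auto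
    qed (use \<alpha> in auto)
    then show ?thesis by simp
  qed
  show ?thesis by (rule that[OF \<sigma>p mono cont der])
qed

text \<open>Below \<open>p\<close> the constant \<open>D p\<close> drives the clock:
  \<open>\<rho>\<close> is the antiderivative of \<open>D p / \<alpha>\<^sup>2\<close> vanishing at
  \<open>p\<close>, where it is glued to \<open>\<sigma>\<close>. The bound \<open>T\<close>
  consists of the finite integral from \<open>p\<close> on and the fixed amount
  \<open>- \<rho> 2\<close>, so it serves all final exponents.\<close>

lemma exponent_time_change:
  assumes ode: "exponent_ode_solvable D p" and p: "2 \<le> p" and D: "\<And>r. p \<le> r \<Longrightarrow> 0 < D r"
    and fin: "(\<integral>\<^sup>+ \<alpha> \<in> {p..}. ennreal (D \<alpha> / \<alpha>\<^sup>2) \<partial>lebesgue) < \<infinity>"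
  obtains \<tau> :: "real \<Rightarrow> real" and T where "strict_mono_on {2..} \<tau>" "\<And>b. continuous_on {2..b} \<tau>"
    "\<And>\<alpha>. 2 < \<alpha> \<Longrightarrow> \<alpha> \<noteq> p \<Longrightarrow> (\<tau> has_real_derivative D (max \<alpha> p) / \<alpha>\<^sup>2) (at \<alpha>)"
    "\<And>\<alpha>. 2 \<le> \<alpha> \<Longrightarrow> \<tau> \<alpha> - \<tau> 2 \<le> T"
proof -
  obtain \<sigma> where \<sigma>p: "\<sigma> p = 0" and mono: "strict_mono_on {p..} \<sigma>" and cont: "\<And>b. continuous_on {p..b} \<sigma>"
    and der: "\<And>\<alpha>. p < \<alpha> \<Longrightarrow> (\<sigma> has_real_derivative D \<alpha> / \<alpha>\<^sup>2) (at \<alpha>)"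
    using exponent_ode_inverse[OF ode _ D] p by auto
  define N where "N = enn2real (\<integral>\<^sup>+ \<alpha> \<in> {p..}. ennreal (D \<alpha> / \<alpha>\<^sup>2) \<partial>lebesgue)"
  have \<sigma>_le: "\<sigma> b \<le> N" if b: "p \<le> b" for b
  proof -
    have int: "((\<lambda>\<alpha>. D \<alpha> / \<alpha>\<^sup>2) has_integral (\<sigma> b - \<sigma> p)) {p..b}"
      using b cont der
      by (intro fundamental_theorem_of_calculus_interior) (auto simp: has_real_derivative_iff_has_vector_derivative[symmetric])
    \<comment> \<open>The fundamental theorem gives a gauge integral; as the integrand is
      nonnegative it is also a Lebesgue integral, bounded by the one over
      \<open>{p..}\<close>.\<close>
    have "set_integrable lebesgue {p..b} (\<lambda>\<alpha>. D \<alpha> / \<alpha>\<^sup>2)"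
      by (rule nonnegative_absolutely_integrable_1) (use int D in \<open>auto simp: has_integral_integrable less_imp_le\<close>)
    then have "ennreal (LINT \<alpha>:{p..b}|lebesgue. D \<alpha> / \<alpha>\<^sup>2)
        = (\<integral>\<^sup>+ \<alpha>. ennreal (indicator {p..b} \<alpha> *\<^sub>R (D \<alpha> / \<alpha>\<^sup>2)) \<partial>lebesgue)"
      unfolding set_lebesgue_integral_def set_integrable_def
      by (intro nn_integral_eq_integral[symmetric]) (auto simp: indicator_def D less_imp_le)
    also have "\<dots> \<le> (\<integral>\<^sup>+ \<alpha> \<in> {p..}. ennreal (D \<alpha> / \<alpha>\<^sup>2) \<partial>lebesgue)"
      by (intro nn_integral_mono) (auto simp: indicator_def)
    also have "\<dots> = ennreal N" using fin by (simp add: N_def)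
    finally have "(LINT \<alpha>:{p..b}|lebesgue. D \<alpha> / \<alpha>\<^sup>2) \<le> N"
      by (subst (asm) ennreal_le_iff) (auto simp: N_def)
    moreover have "(LINT \<alpha>:{p..b}|lebesgue. D \<alpha> / \<alpha>\<^sup>2) = \<sigma> b - \<sigma> p"
      using has_integral_unique[OF has_integral_set_lebesgue int] \<open>set_integrable _ _ _\<close> by blast
    ultimately show ?thesis using \<sigma>p by simp
  qed
  define \<rho> where "\<rho> = (\<lambda>\<alpha>. D p * (1 / p - 1 / \<alpha>))"
  define \<tau> where "\<tau> = (\<lambda>\<alpha>. if \<alpha> \<le> p then \<rho> \<alpha> else \<sigma> \<alpha>)"
  have \<rho>p: "\<rho> p = 0" by (simp add: \<rho>_def)
  have \<rho>_mono: "\<rho> x < \<rho> y" if "0 < x" "x < y" for x y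
    using that D[of p] by (simp add: \<rho>_def divide_strict_left_mono)
  show ?thesis
  proof
    show "strict_mono_on {2..} \<tau>"
    proof (rule strict_mono_onI)
      fix x y :: real assume xy: "x \<in> {2..}" "y \<in> {2..}" "x < y"
      have "x \<le> p \<Longrightarrow> \<rho> x \<le> 0" using \<rho>_mono[of x p] \<rho>p xy by (cases "x = p") auto
      moreover have "p < y \<Longrightarrow> 0 < \<sigma> y" using strict_mono_onD[OF mono, of p y] \<sigma>p by simp
      moreover have "p < x \<Longrightarrow> \<sigma> x < \<sigma> y" using strict_mono_onD[OF mono, of x y] xy by simp
      ultimately show "\<tau> x < \<tau> y" using \<rho>_mono[of x y] xy by (auto simp: \<tau>_def)
    qed
    show "continuous_on {2..b} \<tau>" for b
      unfolding \<tau>_def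
    proof (rule continuous_on_cases_le)
      show "continuous_on {x \<in> {2..b}. x \<le> p} \<rho>"
        unfolding \<rho>_def by (intro continuous_intros) auto
      show "continuous_on {x \<in> {2..b}. p \<le> x} \<sigma>"
        by (rule continuous_on_subset[OF cont[of b]]) auto
    qed (use \<rho>p \<sigma>p in auto)
    show "(\<tau> has_real_derivative D (max \<alpha> p) / \<alpha>\<^sup>2) (at \<alpha>)" if \<alpha>: "2 < \<alpha>" "\<alpha> \<noteq> p" for \<alpha>
    proof (cases "\<alpha> < p")
      case True
      have ev: "\<forall>\<^sub>F x in nhds \<alpha>. \<tau> x = \<rho> x"
        using eventually_nhds_in_open[of "{..<p}" \<alpha>] True by (auto elim!: eventually_mono simp: \<tau>_def)
      have "(\<rho> has_real_derivative D p / \<alpha>\<^sup>2) (at \<alpha>)"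
        unfolding \<rho>_def using \<alpha> by (auto intro!: derivative_eq_intros simp: power2_eq_square)
      then show ?thesis using DERIV_cong_ev[OF refl ev refl] True by (simp add: max_def)
    next
      case False
      then have "p < \<alpha>" using \<alpha> by simp
      have ev: "\<forall>\<^sub>F x in nhds \<alpha>. \<tau> x = \<sigma> x"
        using eventually_nhds_in_open[of "{p<..}" \<alpha>] \<open>p < \<alpha>\<close> by (auto elim!: eventually_mono simp: \<tau>_def)
      show ?thesis using DERIV_cong_ev[OF refl ev refl] der[OF \<open>p < \<alpha>\<close>] \<open>p < \<alpha>\<close> by (simp add: max_def)
    qed
    have "0 \<le> N" by (simp add: N_def)
    show "\<tau> \<alpha> - \<tau> 2 \<le> N - \<rho> 2" if "2 \<le> \<alpha>" for \<alpha>
    proof -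
      have "\<alpha> \<le> p \<Longrightarrow> \<rho> \<alpha> \<le> 0" using \<rho>_mono[of \<alpha> p] \<rho>p that by (cases "\<alpha> = p") auto
      then show ?thesis using \<sigma>_le[of \<alpha>] \<open>0 \<le> N\<close> p by (auto simp: \<tau>_def)
    qed
  qed
qed

text \<open>On \<open>{a..p}\<close> the coefficient is frozen at \<open>C p\<close>, matching the
  use of the inequality at \<open>p\<close> for lower exponents. On a bounded interval the weight
  \<open>1 / \<alpha>\<^sup>2\<close> can be removed because
  \<open>\<alpha>\<^sup>2 \<le> b\<^sup>2\<close>.\<close>

lemma set_integrable_extend_left:
  fixes C :: "real \<Rightarrow> real"
  assumes "0 < a" "a \<le> p" "p \<le> b" and int: "set_integrable lebesgue {p..b} (\<lambda>\<alpha>. C \<alpha> / \<alpha>\<^sup>2)"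
  shows "set_integrable lebesgue {a..b} (\<lambda>\<alpha>. C (max \<alpha> p) / \<alpha>\<^sup>2)"
    and "set_integrable lebesgue {a..b} (\<lambda>\<alpha>. C (max \<alpha> p))"
    and "(LINT \<alpha>:{a..b}|lebesgue. C (max \<alpha> p) / \<alpha>\<^sup>2)
      = integral {a..p} (\<lambda>\<alpha>. C p / \<alpha>\<^sup>2) + (LINT \<alpha>:{p..b}|lebesgue. C \<alpha> / \<alpha>\<^sup>2)"
proof -
  let ?f = "\<lambda>\<alpha>. C (max \<alpha> p) / \<alpha>\<^sup>2"
  have 1: "set_integrable lebesgue {a..p} ?f"
  proof -
    have "continuous_on {a..p} (\<lambda>\<alpha>. C p / \<alpha>\<^sup>2)" using assms by (intro continuous_intros) auto
    then have "set_integrable lebesgue {a..p} (\<lambda>\<alpha>. C p / \<alpha>\<^sup>2)" by (rule absolutely_integrable_continuous_real)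
    then show ?thesis by (rule set_integrable_cong[THEN iffD1, rotated 3]) (auto simp: max_def)
  qed
  have 2: "set_integrable lebesgue {p..b} ?f"
    using int by (rule set_integrable_cong[THEN iffD1, rotated 3]) (auto simp: max_def)
  have un: "{a..b} = {a..p} \<union> {p..b}" using assms by auto
  show f: "set_integrable lebesgue {a..b} ?f"
    unfolding un using 1 2 by (rule set_integrable_Un) auto
  show "set_integrable lebesgue {a..b} (\<lambda>\<alpha>. C (max \<alpha> p))"
    unfolding set_integrable_def
  proof (rule Bochner_Integration.integrable_bound)
    show "integrable lebesgue (\<lambda>\<alpha>. b\<^sup>2 * (indicator {a..b} \<alpha> *\<^sub>R ?f \<alpha>))"
      using f unfolding set_integrable_def by (rule integrable_mult_right)
    have eq: "indicator {a..b} \<alpha> *\<^sub>R C (max \<alpha> p) = \<alpha>\<^sup>2 * (indicator {a..b} \<alpha> *\<^sub>R ?f \<alpha>)" for \<alpha>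
      using \<open>0 < a\<close> by (auto simp: indicator_def)
    have "(\<lambda>\<alpha>. indicator {a..b} \<alpha> *\<^sub>R ?f \<alpha>) \<in> borel_measurable lebesgue"
      using f unfolding set_integrable_def by (rule borel_measurable_integrable)
    moreover have "(\<lambda>\<alpha>::real. \<alpha>\<^sup>2) \<in> borel_measurable lebesgue"
      by (intro measurable_completion) simp
    ultimately show "(\<lambda>\<alpha>. indicator {a..b} \<alpha> *\<^sub>R C (max \<alpha> p)) \<in> borel_measurable lebesgue"
      unfolding eq by (intro borel_measurable_times)
    show "AE \<alpha> in lebesgue. norm (indicator {a..b} \<alpha> *\<^sub>R C (max \<alpha> p))
        \<le> norm (b\<^sup>2 * (indicator {a..b} \<alpha> *\<^sub>R ?f \<alpha>))"
    proof (rule AE_I2)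
      fix \<alpha> :: real
      have "\<alpha>\<^sup>2 * \<bar>?f \<alpha>\<bar> \<le> b\<^sup>2 * \<bar>?f \<alpha>\<bar>" if "\<alpha> \<in> {a..b}"
        using that \<open>0 < a\<close> by (intro mult_right_mono power_mono) auto
      then show "norm (indicator {a..b} \<alpha> *\<^sub>R C (max \<alpha> p)) \<le> norm (b\<^sup>2 * (indicator {a..b} \<alpha> *\<^sub>R ?f \<alpha>))"
        using \<open>0 < a\<close> unfolding eq by (auto simp: indicator_def abs_mult split: if_splits)
    qed
  qed
  have "(LINT \<alpha>:{a..b}|lebesgue. ?f \<alpha>) = integral {a..b} ?f"
    using f by (rule set_lebesgue_integral_eq_integral)
  also have "\<dots> = integral {a..p} ?f + integral {p..b} ?f"
    using assms set_lebesgue_integral_eq_integral(1)[OF f] by (simp add: Henstock_Kurzweil_Integration.integral_combine)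
  also have "integral {a..p} ?f = integral {a..p} (\<lambda>\<alpha>. C p / \<alpha>\<^sup>2)"
    by (rule Henstock_Kurzweil_Integration.integral_cong) (auto simp: max_def)
  also have "integral {p..b} ?f = integral {p..b} (\<lambda>\<alpha>. C \<alpha> / \<alpha>\<^sup>2)"
    by (rule Henstock_Kurzweil_Integration.integral_cong) (auto simp: max_def)
  also have "\<dots> = (LINT \<alpha>:{p..b}|lebesgue. C \<alpha> / \<alpha>\<^sup>2)"
    using int by (rule set_lebesgue_integral_eq_integral(2)[symmetric])
  finally show "(LINT \<alpha>:{a..b}|lebesgue. ?f \<alpha>)
      = integral {a..p} (\<lambda>\<alpha>. C p / \<alpha>\<^sup>2) + (LINT \<alpha>:{p..b}|lebesgue. C \<alpha> / \<alpha>\<^sup>2)" .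
qed

text \<open>For \<open>e > 0\<close> the thresholds \<open>n b\<close> eventually fall below
  \<open>m + e\<close>, so the excess over \<open>m + e\<close> has integral at most
  \<open>1 / b\<close> for all large \<open>b\<close>, hence integral 0.\<close>

lemma Linf_norm_le_of_excess:
  fixes f :: "real ^ 'n \<Rightarrow> real"
  assumes f: "f \<in> borel_measurable lebesgue" and n: "(n \<longlongrightarrow> m) at_top"
    and int: "\<forall>\<^sub>F b in at_top. integrable lebesgue (\<lambda>x. max 0 (\<bar>f x\<bar> - n b))"
    and le: "\<forall>\<^sub>F b in at_top. b * (LINT x|lebesgue. max 0 (\<bar>f x\<bar> - n b)) \<le> 1"
  shows "Linf_norm f \<le> ereal m"
proof (rule ereal_le_epsilon2)
  fix e :: real assume "0 < e"
  let ?g = "\<lambda>x. max 0 (\<bar>f x\<bar> - (m + e))"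
  have ev: "\<forall>\<^sub>F b in at_top. n b < m + e" using n \<open>0 < e\<close> by (intro order_tendstoD) auto
  have "\<forall>\<^sub>F b in at_top. integrable lebesgue ?g \<and> (LINT x|lebesgue. ?g x) \<le> 1 / b"
    using int le ev eventually_gt_at_top[of 0]
  proof eventually_elim
    case (elim b)
    have g: "integrable lebesgue ?g"
      by (rule Bochner_Integration.integrable_bound[OF elim(1)])
        (use f elim in \<open>auto intro!: borel_measurable_max\<close>)
    have "(LINT x|lebesgue. ?g x) \<le> (LINT x|lebesgue. max 0 (\<bar>f x\<bar> - n b))"
      using g elim by (intro integral_mono) auto
    also have "\<dots> \<le> 1 / b" using elim by (simp add: field_simps)
    finally show ?case using g by simp
  qed
  then have g: "integrable lebesgue ?g" and ev: "\<forall>\<^sub>F b in at_top. (LINT x|lebesgue. ?g x) \<le> 1 / b"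
    by (auto simp: eventually_conj_iff)
  have "((\<lambda>b::real. 1 / b) \<longlongrightarrow> 0) at_top" by real_asymp
  from tendsto_lowerbound[OF this ev] have "(LINT x|lebesgue. ?g x) \<le> 0" by simp
  moreover have "0 \<le> (LINT x|lebesgue. ?g x)" by (intro integral_nonneg_AE) auto
  ultimately have "(LINT x|lebesgue. ?g x) = 0" by simp
  then have "AE x in lebesgue. ?g x = 0" using integral_nonneg_eq_0_iff_AE[OF g] by simp
  then have "AE x in lebesgue. ereal \<bar>f x\<bar> \<le> ereal (m + e)" by eventually_elim (auto simp: max_def split: if_splits)
  then show "Linf_norm f \<le> ereal m + ereal e"
    unfolding Linf_norm_def using f by (intro esssup_I) auto
qed

section \<open>Passage to the limit in the final exponent\<close>

theorem corollary3p16: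
  fixes J :: "real ^ 'n \<Rightarrow> real ^ 'n \<Rightarrow> real"
    and p :: real
    and C D :: "real \<Rightarrow> real"
  assumes "levy_kernel J"
    and "2 \<le> p"
    and "\<And>r. p \<le> r \<Longrightarrow> 0 < D r"
    and "\<And>r. p \<le> r \<Longrightarrow> log_sobolev J r (C r) (D r)"
    and "exponent_ode_solvable D p"
    and "\<And>b. set_integrable lebesgue {p..b} (\<lambda>\<alpha>. C \<alpha> / \<alpha>\<^sup>2)"
    and "(\<integral>\<^sup>+ \<alpha> \<in> {p..}. ennreal (D \<alpha> / \<alpha>\<^sup>2) \<partial>lebesgue) < \<infinity>"
    and "\<exists>L :: ereal. L < \<infinity> \<and>
           ((\<lambda>b. ereal (LINT \<alpha>:{p..b}|lebesgue. C \<alpha> / \<alpha>\<^sup>2)) \<longlongrightarrow> L) at_top"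
  shows "eventually_ultracontractive J"
proof -
  note J = assms(1) and p = assms(2)
  obtain \<tau> T where \<tau>_mono: "strict_mono_on {2..} \<tau>" and \<tau>_cont: "\<And>b. continuous_on {2..b} \<tau>"
    and \<tau>_der: "\<And>\<alpha>. 2 < \<alpha> \<Longrightarrow> \<alpha> \<noteq> p \<Longrightarrow> (\<tau> has_real_derivative D (max \<alpha> p) / \<alpha>\<^sup>2) (at \<alpha>)"
    and \<tau>_le: "\<And>\<alpha>. 2 \<le> \<alpha> \<Longrightarrow> \<tau> \<alpha> - \<tau> 2 \<le> T"
    using exponent_time_change[OF assms(5,2,3,7)] by blast
  obtain L :: ereal where L: "L < \<infinity>"
    "((\<lambda>b. ereal (LINT \<alpha>:{p..b}|lebesgue. C \<alpha> / \<alpha>\<^sup>2)) \<longlongrightarrow> L) at_top"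
    using assms(8) by blast
  \<comment> \<open>\<open>L\<close> may be \<open>-\<infinity>\<close>; what is extracted is a real
    upper bound for the integrals of \<open>C\<close> with large \<open>b\<close>.\<close>
  obtain L' :: real where "L < ereal L'" using L(1) ereal_dense2 by blast
  then have L': "\<forall>\<^sub>F b in at_top. (LINT \<alpha>:{p..b}|lebesgue. C \<alpha> / \<alpha>\<^sup>2) < L'"
    using order_tendstoD(2)[OF L(2) \<open>L < ereal L'\<close>] by simp
  define c where "c = integral {2..p} (\<lambda>\<alpha>. C p / \<alpha>\<^sup>2) + L'"
  have T: "0 \<le> T" using \<tau>_le[of 2] by simp
  have bound: "Linf_norm (u t) \<le> ereal (2 * exp (c + 1) * Lp_norm 2 u0)"
    if t: "T + 1 \<le> t" and u0: "u0 \<in> Lp 2" and sol: "levy_solution J u0 u" for t u0 and u :: "real \<Rightarrow> real ^ 'n \<Rightarrow> real"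
  proof (rule ereal_le_epsilon2)
    fix e :: real assume e: "0 < e"
    obtain v where curve: "levy_curve J u v" using levy_solution_imp_levy_curve[OF sol] .
    \<comment> \<open>\<open>k\<close> has to be positive even when \<open>u0\<close> vanishes. The
      correction is scaled so that the limit \<open>k * exp (c + 1)\<close> exceeds the claimed
      bound by exactly \<open>e\<close>; the factor 2 is the square root of the 4 in the starting
      condition.\<close>
    define k where "k = 2 * Lp_norm 2 u0 + e / exp (c + 1)"
    have k: "0 < k" "2 * Lp_norm 2 u0 \<le> k"
      using e Lp_norm_nonneg[of 2 u0] by (auto simp: k_def add_nonneg_pos)
    define n where "n = (\<lambda>b. exp (b / (b - 1) * (ln k + c + 1)))"
    have excess: "integrable lebesgue (\<lambda>x. max 0 (\<bar>u t x\<bar> - n b)) \<and>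
        b * (LINT x|lebesgue. max 0 (\<bar>u t x\<bar> - n b)) \<le> 1"
      if b: "2 < b" "p < b" and Cb: "(LINT \<alpha>:{p..b}|lebesgue. C \<alpha> / \<alpha>\<^sup>2) < L'" for b
    proof -
      \<comment> \<open>The run is timed to reach exponent \<open>b\<close> at time
        \<open>t\<close>. It starts at \<open>t - (\<tau> b - \<tau> 2)\<close>, which varies with
        \<open>b\<close> but is at least \<open>t - T\<close>, hence at least 1.\<close>
      define \<theta> where "\<theta> = (\<lambda>\<alpha>. t - \<tau> b + \<tau> \<alpha>)"
      have \<theta>_pos: "0 < \<theta> \<alpha>" if "\<alpha> \<in> {2..b}" for \<alpha>
      proof -
        have "\<tau> 2 \<le> \<tau> \<alpha>"
          using strict_mono_onD[OF \<tau>_mono, of 2 \<alpha>] that by (cases "\<alpha> = 2") auto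
        then show ?thesis using \<tau>_le[of b] b t by (simp add: \<theta>_def)
      qed
      note C_int = set_integrable_extend_left[OF _ p less_imp_le[OF b(2)] assms(6)]
      have \<theta>b: "\<theta> b = t" by (simp add: \<theta>_def)
      have start: "4 * (LINT x|lebesgue. (u (\<theta> 2) x)\<^sup>2) \<le> k\<^sup>2"
      proof -
        have "(LINT x|lebesgue. (u (\<theta> 2) x)\<^sup>2) \<le> (LINT x|lebesgue. (u0 x)\<^sup>2)"
          using \<theta>_pos[of 2] b by (intro levy_solution_L2_contraction[OF J sol u0]) auto
        also have "\<dots> = (Lp_norm 2 u0)\<^sup>2" by (simp add: Lp_norm_2)
        finally have "4 * (LINT x|lebesgue. (u (\<theta> 2) x)\<^sup>2) \<le> (2 * Lp_norm 2 u0)\<^sup>2"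
          by (simp add: power_mult_distrib)
        also have "\<dots> \<le> k\<^sup>2" using k Lp_norm_nonneg[of 2 u0] by (intro power_mono) auto
        finally show ?thesis .
      qed
      have "(LINT \<alpha>:{2..b}|lebesgue. C (max \<alpha> p) / \<alpha>\<^sup>2) \<le> c"
        using C_int(3) Cb by (simp add: c_def)
      moreover have "continuous_on {2..b} \<theta>" unfolding \<theta>_def by (intro continuous_intros \<tau>_cont)
      moreover have "inj_on \<theta> {2..b}"
        using inj_on_subset[OF strict_mono_on_imp_inj_on[OF \<tau>_mono], of "{2..b}"]
        by (auto simp: \<theta>_def inj_on_def)
      moreover have "(\<theta> has_real_derivative D (max \<alpha> p) / \<alpha>\<^sup>2) (at \<alpha>)" if "2 < \<alpha>" "\<alpha> \<noteq> p" for \<alpha>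
        unfolding \<theta>_def using DERIV_add[OF DERIV_const \<tau>_der[OF that]] by simp
      moreover have "\<exists>R\<ge>\<alpha>. log_sobolev J R (C (max \<alpha> p)) (D (max \<alpha> p))" for \<alpha>
        using assms(4)[of "max \<alpha> p"] by (intro exI[of _ "max \<alpha> p"]) simp
      moreover have "0 < D (max \<alpha> p)" for \<alpha> using assms(3) by simp
      ultimately have "integrable lebesgue (\<lambda>x. max 0 (\<bar>u (\<theta> b) x\<bar> - n b))"
        "b * (LINT x|lebesgue. max 0 (\<bar>u (\<theta> b) x\<bar> - n b)) \<le> 1"
        unfolding n_def using \<theta>_pos start k(1) C_int(1,2)
        by (intro levy_curve_excess_le[OF J curve b(1),
              where p = p and C = "\<lambda>\<alpha>. C (max \<alpha> p)" and D = "\<lambda>\<alpha>. D (max \<alpha> p)" and c = c]; simp)+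
      then show ?thesis by (simp add: \<theta>b)
    qed
    have ev: "\<forall>\<^sub>F b in at_top. 2 < b \<and> p < b \<and> (LINT \<alpha>:{p..b}|lebesgue. C \<alpha> / \<alpha>\<^sup>2) < L'"
      using L' eventually_gt_at_top[of 2] eventually_gt_at_top[of p] by eventually_elim auto
    have "((\<lambda>b::real. b / (b - 1)) \<longlongrightarrow> 1) at_top" by real_asymp
    then have "(n \<longlongrightarrow> exp (1 * (ln k + c + 1))) at_top"
      unfolding n_def by (intro tendsto_intros)
    then have "Linf_norm (u t) \<le> ereal (exp (1 * (ln k + c + 1)))"
    proof (rule Linf_norm_le_of_excess[rotated])
      show "u t \<in> borel_measurable lebesgue" using levy_curveD(1)[OF curve] t T by simp
    qed (use ev excess in \<open>auto elim!: eventually_mono\<close>)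
    also have "exp (1 * (ln k + c + 1)) = 2 * exp (c + 1) * Lp_norm 2 u0 + e"
      using k(1) by (simp add: exp_add k_def field_simps)
    finally show "Linf_norm (u t) \<le> ereal (2 * exp (c + 1) * Lp_norm 2 u0) + ereal e" by simp
  qed
  show ?thesis
    unfolding eventually_ultracontractive_def
    by (rule exI[of _ "T + 1"], rule conjI, use T in simp, rule exI[of _ "\<lambda>_. 2 * exp (c + 1)"])
      (use bound in blast)
qed

end
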